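(* There exists a hereditary graph class (i.e., closed under vertex deletion) of unbounded treewidth for which Edge Steiner Tree can be solved in polynomial time.
   Context: Edge Steiner Tree: given a connected graph $G=(V,E)$, an edge weighting $w:E\to\mathbb{Q}^+$ (strictly positive rationals), a set $U\subseteq V$ of terminals and a positive integer $k$, decide whether $G$ has a tree (a subgraph of $G$) containing all vertices of $U$ whose total edge weight is at most $k$. A class has unbounded treewidth if for every $c$ some graph in the class has treewidth greater than $c$. *)

theory Defs
  imports Complex_Main "HOL-Computational_Algebra.Polynomial"
begin

section \<open>Finite simple graphs\<close>

type_synonym 'a graph = "'a set \<times> 'a set set"

abbreviation verts :: "'a graph \<Rightarrow> 'a set" where "verts \<equiv> fst"
abbreviation edges :: "'a graph \<Rightarrow> 'a set set" where "edges \<equiv> snd"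

definition simple_graph :: "'a graph \<Rightarrow> bool" where
  "simple_graph G \<longleftrightarrow>
     finite (verts G) \<and> (\<forall>e\<in>edges G. e \<subseteq> verts G \<and> card e = 2)"

definition subgraph :: "'a graph \<Rightarrow> 'a graph \<Rightarrow> bool" where
  "subgraph H G \<longleftrightarrow> simple_graph H \<and> verts H \<subseteq> verts G \<and> edges H \<subseteq> edges G"

definition induced_subgraph :: "'a graph \<Rightarrow> 'a set \<Rightarrow> 'a graph" where
  "induced_subgraph G S = (verts G \<inter> S, {e \<in> edges G. e \<subseteq> S})"

definition delete_vertex :: "'a graph \<Rightarrow> 'a \<Rightarrow> 'a graph" where
  "delete_vertex G v = induced_subgraph G (verts G - {v})"

definition isomorphic :: "'a graph \<Rightarrow> 'b graph \<Rightarrow> bool" where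
  "isomorphic G H \<longleftrightarrow>
     (\<exists>f. bij_betw f (verts G) (verts H) \<and> edges H = (\<lambda>e. f ` e) ` edges G)"

text \<open>The graph without vertices is a simple graph, but it is neither connected nor a tree.\<close>

definition connected_graph :: "'a graph \<Rightarrow> bool" where
  "connected_graph G \<longleftrightarrow> verts G \<noteq> {} \<and>
     (\<forall>u\<in>verts G. \<forall>v\<in>verts G. (u, v) \<in> {(x, y). {x, y} \<in> edges G}\<^sup>*)"

definition is_cycle :: "'a graph \<Rightarrow> 'a list \<Rightarrow> bool" where
  "is_cycle G vs \<longleftrightarrow> length vs \<ge> 3 \<and> distinct vs \<and>
     (\<forall>i<length vs. {vs ! i, vs ! (Suc i mod length vs)} \<in> edges G)"

definition is_tree :: "'a graph \<Rightarrow> bool" where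
  "is_tree T \<longleftrightarrow> simple_graph T \<and> connected_graph T \<and> (\<nexists>vs. is_cycle T vs)"


section \<open>Treewidth\<close>

definition tree_decomposition :: "'a graph \<Rightarrow> 'b graph \<Rightarrow> ('b \<Rightarrow> 'a set) \<Rightarrow> bool" where
  "tree_decomposition G T B \<longleftrightarrow> is_tree T \<and>
     (\<Union>t\<in>verts T. B t) = verts G \<and>
     (\<forall>e\<in>edges G. \<exists>t\<in>verts T. e \<subseteq> B t) \<and>
     (\<forall>v\<in>verts G. connected_graph (induced_subgraph T {t \<in> verts T. v \<in> B t}))"

text \<open>Truncated subtraction only matters if all bags are empty, i.e. for the graph without
  vertices, which gets treewidth 0 here.\<close>

definition decomposition_width :: "'b graph \<Rightarrow> ('b \<Rightarrow> 'a set) \<Rightarrow> nat" where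
  "decomposition_width T B = Max ((\<lambda>t. card (B t)) ` verts T) - 1"

definition treewidth :: "'a graph \<Rightarrow> nat" where
  "treewidth G = (LEAST k. \<exists>(T :: nat graph) B.
     tree_decomposition G T B \<and> decomposition_width T B = k)"


section \<open>Graph classes\<close>

text \<open>Every finite graph is isomorphic to one whose vertices are natural numbers, so a graph class
  is an isomorphism-closed set of such graphs. Closure under isomorphism prevents a class from
  hiding information in the names of the vertices.\<close>

definition graph_class :: "nat graph set \<Rightarrow> bool" where
  "graph_class C \<longleftrightarrow> (\<forall>G\<in>C. simple_graph G) \<and>
     (\<forall>G\<in>C. \<forall>H. simple_graph H \<and> isomorphic G H \<longrightarrow> H \<in> C)"

definition hereditary :: "nat graph set \<Rightarrow> bool" where
  "hereditary C \<longleftrightarrow> (\<forall>G\<in>C. \<forall>v\<in>verts G. delete_vertex G v \<in> C)"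

definition unbounded_treewidth :: "nat graph set \<Rightarrow> bool" where
  "unbounded_treewidth C \<longleftrightarrow> (\<forall>c. \<exists>G\<in>C. treewidth G > c)"


section \<open>Polynomial time\<close>

text \<open>The machine model is the WHILE language of N. D. Jones (Computability and Complexity from a
  Programming Perspective), whose only data are binary trees and whose programs use finitely many
  variables. The one change is that an assignment is charged for the size of the tree it writes,
  instead of a constant. Hence running time also bounds the space needed, and a Turing machine
  that stores the trees explicitly simulates a program with polynomial overhead; conversely two
  lists represent a Turing tape. So polynomial time agrees with that of Turing machines.\<close>

datatype data = Atom | Pair (left: data) (right: data)
  where "left Atom = Atom" | "right Atom = Atom"

datatype rhs = NilE | VarE nat | ConsE nat nat | HdE nat | TlE nat

datatype com =
    Assign nat rhs
  | Seq com com
  | If nat com com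
  | While nat com

type_synonym store = "nat \<Rightarrow> data"

fun rhs_val :: "rhs \<Rightarrow> store \<Rightarrow> data" where
  "rhs_val NilE s = Atom"
| "rhs_val (VarE x) s = s x"
| "rhs_val (ConsE x y) s = Pair (s x) (s y)"
| "rhs_val (HdE x) s = left (s x)"
| "rhs_val (TlE x) s = right (s x)"

text \<open>\<open>exec c s t s'\<close>: started in \<open>s\<close>, program \<open>c\<close> halts in \<open>s'\<close> after time \<open>t\<close>. The generated
  function \<open>size\<close> counts the occurrences of \<open>Pair\<close>.\<close>

inductive exec :: "com \<Rightarrow> store \<Rightarrow> nat \<Rightarrow> store \<Rightarrow> bool" where
  Assign: "exec (Assign x e) s (1 + size (rhs_val e s)) (s(x := rhs_val e s))"
| Seq: "exec c1 s t1 s' \<Longrightarrow> exec c2 s' t2 s'' \<Longrightarrow> exec (Seq c1 c2) s (t1 + t2) s''"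
| IfTrue: "s x \<noteq> Atom \<Longrightarrow> exec c1 s t s' \<Longrightarrow> exec (If x c1 c2) s (1 + t) s'"
| IfFalse: "s x = Atom \<Longrightarrow> exec c2 s t s' \<Longrightarrow> exec (If x c1 c2) s (1 + t) s'"
| WhileFalse: "s x = Atom \<Longrightarrow> exec (While x c) s 1 s"
| WhileTrue: "s x \<noteq> Atom \<Longrightarrow> exec c s t1 s' \<Longrightarrow> exec (While x c) s' t2 s'' \<Longrightarrow>
    exec (While x c) s (1 + t1 + t2) s''"

lemma exec_deterministic:
  "exec c s t s' \<Longrightarrow> exec c s u s'' \<Longrightarrow> u = t \<and> s'' = s'"
proof (induction arbitrary: u s'' rule: exec.induct)
  case (Assign x e s)
  from Assign.prems show ?case by cases simp
next
  case (Seq c1 s t1 s' c2 t2 s'')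
  from Seq.prems show ?case by cases (metis Seq.IH)
next
  case (IfTrue s x c1 t s' c2)
  from IfTrue.prems show ?case by cases (simp_all add: IfTrue.IH IfTrue.hyps)
next
  case (IfFalse s x c2 t s' c1)
  from IfFalse.prems show ?case by cases (simp_all add: IfFalse.IH IfFalse.hyps)
next
  case (WhileFalse s x c)
  from WhileFalse.prems show ?case by cases (simp_all add: WhileFalse.hyps)
next
  case (WhileTrue s x c t1 s' t2 s'')
  from WhileTrue.prems show ?case by cases (metis WhileTrue.IH WhileTrue.hyps(1))+
qed

text \<open>The input is in variable 0 and all other variables are \<open>Atom\<close> initially. The answer is yes
  iff variable 0 is not \<open>Atom\<close> finally.\<close>

definition initial_store :: "data \<Rightarrow> store" where
  "initial_store d = (\<lambda>x. if x = 0 then d else Atom)"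

text \<open>The decision problem has the set \<open>I\<close> of instances and the set \<open>{i \<in> I. Q i}\<close> of
  yes-instances; \<open>encodes i d\<close> says that \<open>d\<close> is an admissible input representing \<open>i\<close>. An instance
  may have several representations and the program has to succeed on each of them. Nothing is
  required on inputs that do not represent an instance in \<open>I\<close>.\<close>

definition decidable_in_poly_time ::
  "('i \<Rightarrow> data \<Rightarrow> bool) \<Rightarrow> 'i set \<Rightarrow> ('i \<Rightarrow> bool) \<Rightarrow> bool" where
  "decidable_in_poly_time encodes I Q \<longleftrightarrow>
     (\<exists>(c :: com) (p :: nat poly). \<forall>i\<in>I. \<forall>d. encodes i d \<longrightarrow>
        (\<exists>t s. exec c (initial_store d) t s \<and> t \<le> poly p (size d) \<and> (s 0 \<noteq> Atom \<longleftrightarrow> Q i)))"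


section \<open>Encoding into trees\<close>

fun enc_list :: "('a \<Rightarrow> data) \<Rightarrow> 'a list \<Rightarrow> data" where
  "enc_list f [] = Atom"
| "enc_list f (x # xs) = Pair (f x) (enc_list f xs)"

definition enc_bool :: "bool \<Rightarrow> data" where
  "enc_bool b = (if b then Pair Atom Atom else Atom)"

text \<open>Binary representation, least significant bit first, without leading zeros.\<close>

fun nat_bits :: "nat \<Rightarrow> bool list" where
  "nat_bits n = (if n = 0 then [] else odd n # nat_bits (n div 2))"

declare nat_bits.simps [simp del]

definition enc_nat :: "nat \<Rightarrow> data" where
  "enc_nat n = enc_list enc_bool (nat_bits n)"

text \<open>Numerator and denominator in lowest terms. Only used for nonnegative numbers.\<close>

definition enc_rat :: "rat \<Rightarrow> data" where
  "enc_rat q = (case quotient_of q of (a, b) \<Rightarrow> Pair (enc_nat (nat a)) (enc_nat (nat b)))"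


section \<open>Edge Steiner Tree\<close>

text \<open>Graph, edge weights, terminals, bound. The weight function is only relevant on the edges.\<close>

type_synonym est_instance = "nat graph \<times> (nat set \<Rightarrow> rat) \<times> nat set \<times> nat"

definition est_instances :: "nat graph set \<Rightarrow> est_instance set" where
  "est_instances C = {(G, w, U, k). G \<in> C \<and> simple_graph G \<and> connected_graph G \<and>
     (\<forall>e\<in>edges G. w e > 0) \<and> U \<subseteq> verts G \<and> k > 0}"

fun est_yes :: "est_instance \<Rightarrow> bool" where
  "est_yes (G, w, U, k) \<longleftrightarrow>
     (\<exists>T. subgraph T G \<and> is_tree T \<and> U \<subseteq> verts T \<and> (\<Sum>e\<in>edges T. w e) \<le> of_nat k)"

text \<open>A list of the vertices, a list of the edges with their weights, a list of the terminals, and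
  the bound, the lists being in any order and without repetitions. Each edge is listed once, with
  its endpoints in either order.\<close>

fun est_encodes :: "est_instance \<Rightarrow> data \<Rightarrow> bool" where
  "est_encodes (G, w, U, k) d \<longleftrightarrow>
     (\<exists>vs es us.
        distinct vs \<and> set vs = verts G \<and>
        distinct (map (\<lambda>(u, v). {u, v}) es) \<and> set (map (\<lambda>(u, v). {u, v}) es) = edges G \<and>
        distinct us \<and> set us = U \<and>
        d = Pair (enc_list enc_nat vs)
             (Pair (enc_list (\<lambda>(u, v). Pair (Pair (enc_nat u) (enc_nat v)) (enc_rat (w {u, v}))) es)
               (Pair (enc_list enc_nat us) (enc_nat k))))"

definition edge_steiner_tree_in_poly_time :: "nat graph set \<Rightarrow> bool" where
  "edge_steiner_tree_in_poly_time C \<longleftrightarrow>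
     decidable_in_poly_time est_encodes (est_instances C) est_yes"

end

theory Submission
  imports Defs "HOL-Library.Multiset" "HOL-Library.Nat_Bijection"
begin

text \<open>Call a vertex of degree at least 3 a branch vertex. The class consists of the graphs \<open>G\<close> in
  which every connected set containing two branch vertices has at least \<open>2 ^ b\<close> vertices, where \<open>b\<close>
  is the number of branch vertices of \<open>G\<close>. Deleting a vertex creates no branch vertex, so the class
  is hereditary, and complete graphs with sufficiently subdivided edges belong to it, so its
  treewidth is unbounded. A connected graph of the class on \<open>n\<close> vertices satisfies
  \<open>2 ^ b \<le> n + 2\<close>, hence one may try all subsets of branch vertices in polynomial time: the
  vertices are processed one by one, non-terminals of degree at most 2 are bypassed, and each other
  non-terminal is either deleted or declared a terminal. When only terminals are left, the optimum is
  a minimum spanning tree. Polynomial time is established by closure properties: functions on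
  encoded data computable in polynomial time are closed under composition, case distinction and
  iteration over a list, provided that the intermediate results stay polynomially bounded.\<close>

section \<open>Polynomial time functions on encoded data\<close>

text \<open>The plain inequality \<open>2 ^ b \<le> n + 2\<close> would not define a hereditary
  class: deleting vertices of degree 2 can shrink \<open>n\<close> drastically while
  \<open>b\<close> stays. Quantifying over connected sets repairs this, because a connected set of
  an induced subgraph is connected in the whole graph. In effect the condition keeps branch vertices
  far apart, at a distance exponential in their number. The exponent may refer to the original graph
  because no elimination step raises a degree: branching happens only at vertices that were branch
  vertices from the start. Bypassing can create loops and parallel edges, which is why edges form
  lists and multisets instead of sets. The complete graph survives subdivision as a minor, and the
  Helly property of subtrees turns this minor into a large bag of any tree decomposition.\<close>

class enc =
  fixes enc :: "'a \<Rightarrow> data"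

instantiation bool :: enc
begin
definition enc_bool_inst: "enc = enc_bool"
instance ..
end

instantiation nat :: enc
begin
definition enc_nat_inst: "enc = enc_nat"
instance ..
end

instantiation list :: (enc) enc
begin
definition enc_list_inst: "enc = enc_list enc"
instance ..
end

instantiation prod :: (enc, enc) enc
begin
definition enc_prod_inst: "enc = (\<lambda>(x, y). Pair (enc x) (enc y))"
instance ..
end

lemma enc_simps [simp]:
  "enc True = Pair Atom Atom" "enc False = Atom"
  "enc ([] :: 'a::enc list) = Atom" "enc (x # xs) = Pair (enc x) (enc xs)"
  "enc (y, z) = Pair (enc y) (enc z)"
  by (simp_all add: enc_bool_inst enc_bool_def enc_list_inst enc_prod_inst)

lemma enc_pair: "enc z = Pair (enc (fst z)) (enc (snd z))"
  by (cases z) simp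

abbreviation esize :: "'a::enc \<Rightarrow> nat" where "esize x \<equiv> size (enc x)"

lemma esize_bool: "esize (b :: bool) \<le> 1"
  by (cases b) auto

lemma esize_list: "esize xs = (\<Sum>x\<leftarrow>xs. esize x + 1)"
  by (induction xs) auto

lemma length_le_esize: "length xs \<le> esize xs"
  by (induction xs) auto

lemma esize_nth: "i < length xs \<Longrightarrow> esize (xs ! i) < esize xs"
proof (induction xs arbitrary: i)
  case (Cons x xs)
  show ?case
  proof (cases i)
    case (Suc j)
    with Cons have "esize (xs ! j) < esize xs" by simp
    with Suc show ?thesis by simp
  qed simp
qed simp

lemma esize_mem: "x \<in> set xs \<Longrightarrow> esize x < esize xs"
  by (metis esize_nth in_set_conv_nth)

lemma esize_list_le: "\<forall>x\<in>set xs. esize x \<le> B \<Longrightarrow> esize xs \<le> length xs * (B + 1)"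
  by (induction xs) auto


subsection \<open>Polynomial bounds\<close>

lemma poly_nat_mono: "x \<le> y \<Longrightarrow> poly p x \<le> poly p y" for p :: "nat poly"
  by (induction p) (auto intro!: add_mono mult_mono)

text \<open>The set \<open>S\<close> carries a promise on the input. It is there for the number of
  states in \<open>explore\<close>, whose polynomial bound comes from the graph class.\<close>

definition pbounded :: "'a set \<Rightarrow> ('a \<Rightarrow> nat) \<Rightarrow> ('a \<Rightarrow> nat) \<Rightarrow> bool" where
  "pbounded S m g \<longleftrightarrow> (\<exists>p :: nat poly. \<forall>x\<in>S. g x \<le> poly p (m x))"

named_theorems pb_intros

lemma pb_const [pb_intros]: "pbounded S m (\<lambda>x. k)"
  unfolding pbounded_def by (rule exI[of _ "[:k:]"]) simp

lemma pb_self [pb_intros]: "pbounded S m m"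
  unfolding pbounded_def by (rule exI[of _ "[:0, 1:]"]) simp

lemma pb_add [pb_intros]:
  assumes "pbounded S m f" "pbounded S m g"
  shows "pbounded S m (\<lambda>x. f x + g x)"
proof -
  from assms obtain p q where "\<forall>x\<in>S. f x \<le> poly p (m x)" "\<forall>x\<in>S. g x \<le> poly q (m x)"
    unfolding pbounded_def by blast
  then show ?thesis unfolding pbounded_def by (intro exI[of _ "p + q"]) (auto intro: add_mono)
qed

lemma pb_mult [pb_intros]:
  assumes "pbounded S m f" "pbounded S m g"
  shows "pbounded S m (\<lambda>x. f x * g x)"
proof -
  from assms obtain p q where "\<forall>x\<in>S. f x \<le> poly p (m x)" "\<forall>x\<in>S. g x \<le> poly q (m x)"
    unfolding pbounded_def by blast
  then show ?thesis unfolding pbounded_def by (intro exI[of _ "p * q"]) (auto intro: mult_mono)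
qed

lemma pb_mono: "pbounded S m f \<Longrightarrow> (\<And>x. x \<in> S \<Longrightarrow> g x \<le> f x) \<Longrightarrow> pbounded S m g"
  unfolding pbounded_def by (meson le_trans)

lemma pb_subset: "pbounded S m f \<Longrightarrow> T \<subseteq> S \<Longrightarrow> pbounded T m f"
  unfolding pbounded_def by blast

lemma pb_poly [pb_intros]:
  assumes "pbounded S m f"
  shows "pbounded S m (\<lambda>x. poly p (f x))"
proof -
  from assms obtain q where "\<forall>x\<in>S. f x \<le> poly q (m x)" unfolding pbounded_def by blast
  then show ?thesis unfolding pbounded_def
    by (intro exI[of _ "pcompose p q"]) (auto simp: poly_pcompose intro: poly_nat_mono)
qed

lemma pb_compose:
  assumes "pbounded T n g" "\<And>x. x \<in> S \<Longrightarrow> h x \<in> T" "pbounded S m (\<lambda>x. n (h x))"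
  shows "pbounded S m (\<lambda>x. g (h x))"
proof -
  from assms(1) obtain p where "\<forall>x\<in>T. g x \<le> poly p (n x)" unfolding pbounded_def by blast
  then show ?thesis using assms(2) by (intro pb_mono[OF pb_poly[OF assms(3), of p]]) auto
qed


subsection \<open>Composing programs\<close>

text \<open>Only upper bounds on the time are tracked: unlike exact times they can be weakened, so
  that both branches of a conditional and all rounds of a loop can share one bound.\<close>

definition execb :: "com \<Rightarrow> store \<Rightarrow> nat \<Rightarrow> store \<Rightarrow> bool" where
  "execb c s T s' \<longleftrightarrow> (\<exists>t\<le>T. exec c s t s')"

lemma execb_mono: "execb c s T s' \<Longrightarrow> T \<le> T' \<Longrightarrow> execb c s T' s'"
  unfolding execb_def by (meson le_trans)

lemma execb_Assign: "execb (Assign x e) s (1 + size (rhs_val e s)) (s(x := rhs_val e s))"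
  unfolding execb_def using exec.Assign by blast

lemma execb_AssignI:
  "s' = s(x := rhs_val e s) \<Longrightarrow> 1 + size (rhs_val e s) \<le> T \<Longrightarrow> execb (Assign x e) s T s'"
  using execb_Assign execb_mono by blast

lemma execb_Seq: "execb c1 s T1 s' \<Longrightarrow> execb c2 s' T2 s'' \<Longrightarrow> execb (Seq c1 c2) s (T1 + T2) s''"
  unfolding execb_def by (meson add_mono exec.Seq)

lemma execb_If:
  "(s x \<noteq> Atom \<Longrightarrow> execb c1 s T s') \<Longrightarrow> (s x = Atom \<Longrightarrow> execb c2 s T s') \<Longrightarrow>
    execb (If x c1 c2) s (1 + T) s'"
  unfolding execb_def by (metis add_left_mono exec.IfFalse exec.IfTrue)

lemma execb_WhileFalse: "s x = Atom \<Longrightarrow> execb (While x c) s 1 s"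
  unfolding execb_def using exec.WhileFalse by blast

lemma execb_WhileTrue:
  "s x \<noteq> Atom \<Longrightarrow> execb c s T1 s' \<Longrightarrow> execb (While x c) s' T2 s'' \<Longrightarrow>
    execb (While x c) s (1 + T1 + T2) s''"
  unfolding execb_def by (meson add_mono exec.WhileTrue le_refl)

text \<open>Every assignment is charged for the tree it writes, so a variable can grow by at most
  the time spent. This makes the outputs of polynomial-time programs polynomially large.\<close>

lemma exec_size: "exec c s t s' \<Longrightarrow> size (s' y) \<le> t + size (s y)"
  by (induction rule: exec.induct) auto

text \<open>Variable 0 holds the argument and later the result; the scratch variables below \<open>N\<close> are
  cleaned up and all others are untouched, so that programs can be nested without renaming.\<close>

definition runs :: "com \<Rightarrow> nat \<Rightarrow> data \<Rightarrow> nat \<Rightarrow> data \<Rightarrow> bool" where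
  "runs c N d T d' \<longleftrightarrow>
     (\<forall>s. s 0 = d \<and> (\<forall>y. 0 < y \<and> y < N \<longrightarrow> s y = Atom) \<longrightarrow> execb c s T (s(0 := d')))"

lemma runsI:
  "(\<And>s. s 0 = d \<Longrightarrow> (\<And>y. 0 < y \<Longrightarrow> y < N \<Longrightarrow> s y = Atom) \<Longrightarrow> execb c s T (s(0 := d'))) \<Longrightarrow>
    runs c N d T d'"
  unfolding runs_def by blast

lemma runsD:
  "runs c N d T d' \<Longrightarrow> s 0 = d \<Longrightarrow> (\<And>y. 0 < y \<Longrightarrow> y < N \<Longrightarrow> s y = Atom) \<Longrightarrow>
    s' = s(0 := d') \<Longrightarrow> execb c s T s'"
  unfolding runs_def by blast

lemma runs_mono: "runs c N d T d' \<Longrightarrow> N \<le> M \<Longrightarrow> T \<le> T' \<Longrightarrow> runs c M d T' d'"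
  by (rule runsI, rule execb_mono, rule runsD) auto

lemma runs_Seq:
  assumes "runs c1 N d T1 d1" "runs c2 N d1 T2 d2"
  shows "runs (Seq c1 c2) N d (T1 + T2) d2"
proof (rule runsI)
  fix s :: store
  assume s: "s 0 = d" "\<And>y. 0 < y \<Longrightarrow> y < N \<Longrightarrow> s y = Atom"
  have "execb c1 s T1 (s(0 := d1))" by (rule runsD[OF assms(1)]) (use s in auto)
  moreover have "execb c2 (s(0 := d1)) T2 (s(0 := d2))" by (rule runsD[OF assms(2)]) (use s in auto)
  ultimately show "execb (Seq c1 c2) s (T1 + T2) (s(0 := d2))" by (rule execb_Seq)
qed

lemma runs_size:
  assumes "runs c N d T d'"
  shows "size d' \<le> T + size d"
proof -
  have "execb c (initial_store d) T ((initial_store d)(0 := d'))"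
    by (rule runsD[OF assms]) (auto simp: initial_store_def)
  then obtain t where "t \<le> T" "exec c (initial_store d) t ((initial_store d)(0 := d'))"
    unfolding execb_def by blast
  from exec_size[OF this(2), of 0] this(1) show ?thesis by (simp add: initial_store_def)
qed

text \<open>The witness \<open>N\<close> tells a surrounding program which registers are free: it
  keeps its own values in \<open>N\<close>, \<open>N + 1\<close> and so on while the inner program
  runs. \<open>0 < N\<close> protects the argument register.\<close>

definition ptime_on :: "'a::enc set \<Rightarrow> ('a \<Rightarrow> 'b::enc) \<Rightarrow> bool" where
  "ptime_on S f \<longleftrightarrow> (\<exists>c N T. 0 < N \<and> pbounded S esize T \<and>
     (\<forall>x\<in>S. runs c N (enc x) (T x) (enc (f x))))"

abbreviation ptime :: "('a::enc \<Rightarrow> 'b::enc) \<Rightarrow> bool" where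
  "ptime \<equiv> ptime_on UNIV"

named_theorems pt_intros

lemma ptime_onI:
  "(\<And>x. x \<in> S \<Longrightarrow> runs c N (enc x) (T x) (enc (f x))) \<Longrightarrow> 0 < N \<Longrightarrow> pbounded S esize T \<Longrightarrow>
    ptime_on S f"
  unfolding ptime_on_def by blast

lemma ptime_onE:
  assumes "ptime_on S f"
  obtains N T c where "0 < N" "pbounded S esize T"
    "\<forall>x\<in>S. runs c N (enc x) (T x) (enc (f x))"
  using assms unfolding ptime_on_def by (elim exE conjE) (rule that)

lemma ptime_on_subset: "ptime_on S f \<Longrightarrow> T \<subseteq> S \<Longrightarrow> ptime_on T f"
  unfolding ptime_on_def using pb_subset by blast

lemma ptime_on_cong: "ptime_on S f \<Longrightarrow> (\<And>x. x \<in> S \<Longrightarrow> f x = g x) \<Longrightarrow> ptime_on S g"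
  unfolding ptime_on_def by simp

lemma ptime_on_esize: 
  assumes "ptime_on S f"
  shows "pbounded S esize (\<lambda>x. esize (f x))"
proof -
  obtain c N T where "0 < N" and T: "pbounded S esize T"
    and c: "\<forall>x\<in>S. runs c N (enc x) (T x) (enc (f x))" by (rule ptime_onE[OF assms]) (rule that)
  note c = bspec[OF c]
  show ?thesis by (rule pb_mono[OF pb_add[OF T pb_self]]) (rule runs_size[OF c])
qed

text \<open>The size of \<open>f x\<close> is polynomial in that of \<open>x\<close>, so
  substituting it into the bound for \<open>g\<close> gives a polynomial bound again.\<close>

lemma ptime_on_comp:
  assumes g: "ptime_on T g" and f: "ptime_on S f" and ST: "\<And>x. x \<in> S \<Longrightarrow> f x \<in> T"
  shows "ptime_on S (\<lambda>x. g (f x))"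
proof -
  obtain c1 N1 T1 where T1: "0 < N1" "pbounded S esize T1"
    and c1: "\<forall>x\<in>S. runs c1 N1 (enc x) (T1 x) (enc (f x))" by (rule ptime_onE[OF f]) (rule that)
  note c1 = bspec[OF c1]
  obtain c2 N2 T2 where T2: "0 < N2" "pbounded T esize T2"
    and c2: "\<forall>x\<in>T. runs c2 N2 (enc x) (T2 x) (enc (g x))" by (rule ptime_onE[OF g]) (rule that)
  note c2 = bspec[OF c2]
  show ?thesis
  proof (rule ptime_onI)
    fix x assume x: "x \<in> S"
    show "runs (Seq c1 c2) (max N1 N2) (enc x) (T1 x + T2 (f x)) (enc (g (f x)))"
      by (rule runs_Seq; rule runs_mono[OF c1[OF x]] runs_mono[OF c2[OF ST[OF x]]]) auto
  next
    show "pbounded S esize (\<lambda>x. T1 x + T2 (f x))"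
      by (intro pb_add T1 pb_compose[OF T2(2)] ST ptime_on_esize f)
  qed (use T1 in auto)
qed

lemma ptime_comp: "ptime g \<Longrightarrow> ptime_on S f \<Longrightarrow> ptime_on S (\<lambda>x. g (f x))"
  by (rule ptime_on_comp) auto

lemma ptime_id [pt_intros]: "ptime_on S (\<lambda>x. x)"
proof (rule ptime_onI)
  show "pbounded S esize (\<lambda>x. 1 + esize x)" by (rule pb_intros)+
  show "runs (Assign 0 (VarE 0)) 1 (enc x) (1 + esize x) (enc x)" for x :: 'a
    by (rule runsI, rule execb_AssignI) auto
qed simp

text \<open>The constant is assembled bottom-up, the left subtree waiting in register
  \<open>N\<close> while the right one is built. The time does not depend on the old content
  \<open>e\<close>, since overwriting is charged only for the new tree.\<close>

lemma runs_const: "\<exists>c N T. 0 < N \<and> (\<forall>e. runs c N e T d)"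
proof (induction d)
  case Atom
  show ?case
    by (intro exI[of _ "Assign 0 NilE"] exI[of _ 1] exI[of _ 1])
      (auto intro!: runsI execb_AssignI)
next
  case (Pair d1 d2)
  from Pair(1) obtain c1 N1 T1 where N1: "0 < N1" and c1: "\<forall>e. runs c1 N1 e T1 d1"
    by (elim exE conjE)
  from Pair(2) obtain c2 N2 T2 where N2: "0 < N2" and c2: "\<forall>e. runs c2 N2 e T2 d2"
    by (elim exE conjE)
  define N where "N = max N1 N2"
  have c1: "runs c1 N e T1 d1" and c2: "runs c2 N e T2 d2" for e
    by (rule runs_mono[OF spec[OF c1]] runs_mono[OF spec[OF c2]]; simp add: N_def)+
  have N: "0 < N" using N1 by (simp add: N_def)
  have "runs (Seq c1 (Seq (Assign N (VarE 0)) (Seq c2 (Seq (Assign 0 (ConsE N 0)) (Assign N NilE)))))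
     (Suc N) e (T1 + (1 + size d1 + (T2 + (2 + size d1 + size d2 + 1)))) (Pair d1 d2)" for e
  proof (rule runsI)
    fix s :: store
    assume s: "s 0 = e" "\<And>y. 0 < y \<Longrightarrow> y < Suc N \<Longrightarrow> s y = Atom"
    show "execb (Seq c1 (Seq (Assign N (VarE 0)) (Seq c2 (Seq (Assign 0 (ConsE N 0)) (Assign N NilE)))))
      s (T1 + (1 + size d1 + (T2 + (2 + size d1 + size d2 + 1)))) (s(0 := Pair d1 d2))"
      apply (rule execb_Seq[of _ _ _ "s(0 := d1)"])
       apply (rule runsD[OF c1], use s in auto)[1]
      apply (rule execb_Seq[of _ _ _ "s(0 := d1, N := d1)"])
       apply (rule execb_AssignI, use s N in auto)[1]
      apply (rule execb_Seq[of _ _ _ "s(0 := d2, N := d1)"])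
       apply (rule runsD[OF c2], use s N in auto)[1]
      apply (rule execb_Seq[of _ _ _ "s(0 := Pair d1 d2, N := d1)"])
       apply (rule execb_AssignI, use s N in auto)[1]
      apply (rule execb_AssignI, use s N in \<open>auto simp: fun_eq_iff\<close>)
      done
  qed
  then show ?case by (intro exI conjI allI) (rule zero_less_Suc)
qed

lemma ptime_const [pt_intros]: "ptime_on S (\<lambda>x. k)"
proof -
  obtain c N T where "0 < N" "\<forall>e. runs c N e T (enc k)" using runs_const by metis
  then show ?thesis by (intro ptime_onI[of S c N "\<lambda>x. T"] pb_const) auto
qed

lemma ptime_Pair [pt_intros]:
  assumes f: "ptime_on S f" and g: "ptime_on S g"
  shows "ptime_on S (\<lambda>x. (f x, g x))"
proof -
  obtain c1 N1 T1 where T1: "0 < N1" "pbounded S esize T1"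
    and c1: "\<forall>x\<in>S. runs c1 N1 (enc x) (T1 x) (enc (f x))" by (rule ptime_onE[OF f]) (rule that)
  note c1 = bspec[OF c1]
  obtain c2 N2 T2 where T2: "0 < N2" "pbounded S esize T2"
    and c2: "\<forall>x\<in>S. runs c2 N2 (enc x) (T2 x) (enc (g x))" by (rule ptime_onE[OF g]) (rule that)
  note c2 = bspec[OF c2]
  define N where "N = max N1 N2"
  have N: "0 < N" using T1 by (simp add: N_def)
  have c1: "runs c1 N (enc x) (T1 x) (enc (f x))" and c2: "runs c2 N (enc x) (T2 x) (enc (g x))"
    if "x \<in> S" for x
    by (rule runs_mono[OF c1[OF that]] runs_mono[OF c2[OF that]]; simp add: N_def)+
  \<comment> \<open>Register \<open>N\<close> saves the argument for the second computation and
    \<open>N + 1\<close> keeps the first result; both are reset to \<open>Atom\<close> after use, as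
    \<open>runs\<close> demands.\<close>
  define c where "c = Seq (Assign N (VarE 0)) (Seq c1 (Seq (Assign (N+1) (VarE 0))
    (Seq (Assign 0 (VarE N)) (Seq (Assign N NilE) (Seq c2 (Seq (Assign 0 (ConsE (N+1) 0))
    (Assign (N+1) NilE)))))))"
  define T where "T = (\<lambda>x. 1 + esize x + (T1 x + (1 + esize (f x) + (1 + esize x + (1 + (T2 x +
    ((2 + esize (f x) + esize (g x)) + 1)))))))"
  show ?thesis
  proof (rule ptime_onI)
    fix x assume x: "x \<in> S"
    show "runs c (N + 2) (enc x) (T x) (enc (f x, g x))"
    proof (rule runsI)
      fix s :: store
      assume s: "s 0 = enc x" "\<And>y. 0 < y \<Longrightarrow> y < N + 2 \<Longrightarrow> s y = Atom"
      show "execb c s (T x) (s(0 := enc (f x, g x)))"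
        unfolding c_def T_def
        apply (rule execb_Seq[of _ _ _ "s(N := enc x)"])
         apply (rule execb_AssignI, use s N in auto)[1]
        apply (rule execb_Seq[of _ _ _ "s(N := enc x, 0 := enc (f x))"])
         apply (rule runsD[OF c1[OF x]], use s N in auto)[1]
        apply (rule execb_Seq[of _ _ _ "s(N := enc x, 0 := enc (f x), N+1 := enc (f x))"])
         apply (rule execb_AssignI, use s N in auto)[1]
        apply (rule execb_Seq[of _ _ _ "s(N := enc x, 0 := enc x, N+1 := enc (f x))"])
         apply (rule execb_AssignI, use s N in auto)[1]
        apply (rule execb_Seq[of _ _ _ "s(N := Atom, 0 := enc x, N+1 := enc (f x))"])
         apply (rule execb_AssignI, use s N in auto)[1]
        apply (rule execb_Seq[of _ _ _ "s(N := Atom, 0 := enc (g x), N+1 := enc (f x))"])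
         apply (rule runsD[OF c2[OF x]], use s N in auto)[1]
        apply (rule execb_Seq[of _ _ _ "s(N := Atom, 0 := enc (f x, g x), N+1 := enc (f x))"])
         apply (rule execb_AssignI, use s N in auto)[1]
        apply (rule execb_AssignI, use s N in \<open>auto simp: fun_eq_iff\<close>)
        done
    qed
  next
    show "pbounded S esize T" unfolding T_def
      by (rule pb_intros T1 T2 ptime_on_esize[OF f] ptime_on_esize[OF g])+
  qed auto
qed

lemma ptime_fst [pt_intros]:
  assumes "ptime_on S f"
  shows "ptime_on S (\<lambda>x. fst (f x))"
proof (rule ptime_comp[OF ptime_onI assms])
  show "pbounded UNIV esize (\<lambda>z :: 'b \<times> 'c. 1 + esize z)" by (rule pb_intros)+
qed (auto intro!: runsI[of _ 1 "Assign 0 (HdE 0)"] execb_AssignI simp: enc_pair)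

lemma ptime_snd [pt_intros]:
  assumes "ptime_on S f"
  shows "ptime_on S (\<lambda>x. snd (f x))"
proof (rule ptime_comp[OF ptime_onI assms])
  show "pbounded UNIV esize (\<lambda>z :: 'b \<times> 'c. 1 + esize z)" by (rule pb_intros)+
qed (auto intro!: runsI[of _ 1 "Assign 0 (TlE 0)"] execb_AssignI simp: enc_pair)

text \<open>A list cell and a pair have the same encoding, so pairing already is the list
  constructor.\<close>

lemma ptime_Cons [pt_intros]:
  assumes "ptime_on S f" "ptime_on S g"
  shows "ptime_on S (\<lambda>x. f x # g x)"
  using ptime_Pair[OF assms] unfolding ptime_on_def by simp

lemma ptime_hd [pt_intros]:
  assumes "ptime_on S f" "\<And>x. x \<in> S \<Longrightarrow> f x \<noteq> []"
  shows "ptime_on S (\<lambda>x. hd (f x))"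
proof -
  have "enc xs = enc (hd xs, tl xs)" if "xs \<noteq> []" for xs :: "'b list"
    using that by (cases xs) auto
  then have "ptime_on S (\<lambda>x. (hd (f x), tl (f x)))"
    using assms unfolding ptime_on_def by simp
  from ptime_fst[OF this] show ?thesis by simp
qed

lemma ptime_tl [pt_intros]:
  assumes "ptime_on S f"
  shows "ptime_on S (\<lambda>x. tl (f x))"
proof (rule ptime_comp[OF ptime_onI assms])
  show "pbounded UNIV esize (\<lambda>z :: 'b list. 1 + esize z)" by (rule pb_intros)+
next
  fix xs :: "'b list"
  show "runs (Assign 0 (TlE 0)) 1 (enc xs) (1 + esize xs) (enc (tl xs))"
    by (cases xs) (auto intro!: runsI execb_AssignI)
qed auto

lemma ptime_null [pt_intros]:
  assumes "ptime_on S f"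
  shows "ptime_on S (\<lambda>x. f x = [])"
proof (rule ptime_comp[of "\<lambda>xs. xs = []", OF ptime_onI assms])
  show "pbounded UNIV esize (\<lambda>z :: 'b list. 1 + 2)" by (rule pb_intros)+
next
  fix xs :: "'b list"
  show "runs (If 0 (Assign 0 NilE) (Assign 0 (ConsE 0 0))) 1 (enc xs) (1 + 2) (enc (xs = []))"
    by (intro runsI execb_If execb_AssignI; cases xs) auto
qed auto

text \<open>Each branch has to be polynomial only on the inputs that reach it, which permits
  \<open>hd\<close> behind a test for emptiness.\<close>

lemma ptime_If [pt_intros]:
  assumes b: "ptime_on S b" and f: "ptime_on {x \<in> S. b x} f" and g: "ptime_on {x \<in> S. \<not> b x} g"
  shows "ptime_on S (\<lambda>x. if b x then f x else g x)"
proof -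
  obtain c0 N0 T0 where T0: "0 < N0" "pbounded S esize T0"
    and c0: "\<forall>x\<in>S. runs c0 N0 (enc x) (T0 x) (enc (b x))" by (rule ptime_onE[OF b]) (rule that)
  note c0 = bspec[OF c0]
  obtain c1 N1 T1 where T1: "0 < N1" "pbounded {x \<in> S. b x} esize T1"
    and c1: "\<forall>x\<in>{x \<in> S. b x}. runs c1 N1 (enc x) (T1 x) (enc (f x))"
    by (rule ptime_onE[OF f]) (rule that)
  note c1 = bspec[OF c1]
  obtain c2 N2 T2 where T2: "0 < N2" "pbounded {x \<in> S. \<not> b x} esize T2"
    and c2: "\<forall>x\<in>{x \<in> S. \<not> b x}. runs c2 N2 (enc x) (T2 x) (enc (g x))"
    by (rule ptime_onE[OF g]) (rule that)
  note c2 = bspec[OF c2]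
  define N where "N = max N0 (max N1 N2)"
  have N: "0 < N" using T0 by (simp add: N_def)
  have c0: "runs c0 N (enc x) (T0 x) (enc (b x))" if "x \<in> S" for x
    by (rule runs_mono[OF c0[OF that]]) (auto simp: N_def)
  have c1: "runs c1 N (enc x) (T1 x) (enc (f x))" if "x \<in> S" "b x" for x
    by (rule runs_mono[OF c1]) (use that in \<open>auto simp: N_def\<close>)
  have c2: "runs c2 N (enc x) (T2 x) (enc (g x))" if "x \<in> S" "\<not> b x" for x
    by (rule runs_mono[OF c2]) (use that in \<open>auto simp: N_def\<close>)
  define c where "c = Seq (Assign N (VarE 0)) (Seq c0 (Seq (Assign (N+1) (VarE 0))
    (Seq (Assign 0 (VarE N)) (Seq (Assign N NilE)
    (If (N+1) (Seq (Assign (N+1) NilE) c1) (Seq (Assign (N+1) NilE) c2))))))"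
  define T3 where "T3 = (\<lambda>x. if b x then T1 x else T2 x)"
  define T where "T = (\<lambda>x. 1 + esize x + (T0 x + (2 + (1 + esize x + (1 + (1 + (1 + T3 x)))))))"
  have T3: "pbounded S esize T3"
  proof -
    obtain p q where p: "\<forall>x\<in>{x \<in> S. b x}. T1 x \<le> poly p (esize x)"
      and q: "\<forall>x\<in>{x \<in> S. \<not> b x}. T2 x \<le> poly q (esize x)"
      using T1(2) T2(2) unfolding pbounded_def by blast
    \<comment> \<open>The two polynomials are valid on complementary parts of \<open>S\<close>;
      their sum is valid on all of it.\<close>
    show ?thesis
      by (rule pb_mono[OF pb_add[OF pb_poly[OF pb_self, of _ _ p] pb_poly[OF pb_self, of _ _ q]]])
        (use p q in \<open>auto simp: T3_def intro: trans_le_add1 trans_le_add2\<close>)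
  qed
  show ?thesis
  proof (rule ptime_onI)
    fix x assume x: "x \<in> S"
    show "runs c (N + 2) (enc x) (T x) (enc (if b x then f x else g x))"
    proof (rule runsI)
      fix s :: store
      assume s: "s 0 = enc x" "\<And>y. 0 < y \<Longrightarrow> y < N + 2 \<Longrightarrow> s y = Atom"
      have 1: "execb c1 (s(0 := enc x)) (T3 x) (s(0 := enc (if b x then f x else g x)))" if "enc (b x) \<noteq> Atom"
      proof -
        have "b x" using that by (cases "b x") auto
        then have "T3 x = T1 x" by (simp add: T3_def)
        then show ?thesis using runsD[OF c1[OF x \<open>b x\<close>], of "s(0 := enc x)"] s(2) \<open>b x\<close> by simp
      qed
      have 2: "execb c2 (s(0 := enc x)) (T3 x) (s(0 := enc (if b x then f x else g x)))" if "enc (b x) = Atom"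
      proof -
        have "\<not> b x" using that by (cases "b x") auto
        then have "T3 x = T2 x" by (simp add: T3_def)
        then show ?thesis using runsD[OF c2[OF x \<open>\<not> b x\<close>], of "s(0 := enc x)"] s(2) \<open>\<not> b x\<close> by simp
      qed
      show "execb c s (T x) (s(0 := enc (if b x then f x else g x)))"
        unfolding c_def T_def
        apply (rule execb_Seq[of _ _ _ "s(N := enc x)"])
         apply (rule execb_AssignI, use s N in auto)[1]
        apply (rule execb_Seq[of _ _ _ "s(N := enc x, 0 := enc (b x))"])
         apply (rule runsD[OF c0[OF x]], use s N in auto)[1]
        apply (rule execb_Seq[of _ _ _ "s(N := enc x, 0 := enc (b x), N+1 := enc (b x))"])
         apply (rule execb_AssignI, use s N esize_bool[of "b x"] in auto)[1]
        apply (rule execb_Seq[of _ _ _ "s(N := enc x, 0 := enc x, N+1 := enc (b x))"])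
         apply (rule execb_AssignI, use s N in auto)[1]
        apply (rule execb_Seq[of _ _ _ "s(N := Atom, 0 := enc x, N+1 := enc (b x))"])
         apply (rule execb_AssignI, use s N in auto)[1]
        apply (rule execb_If; rule execb_Seq[of _ _ _ "s(0 := enc x)"])
           apply (rule execb_AssignI, use s N in \<open>auto simp: fun_eq_iff\<close>)[1]
          apply (rule 1, use N in \<open>auto split: if_splits\<close>)[1]
         apply (rule execb_AssignI, use s N in \<open>auto simp: fun_eq_iff\<close>)[1]
        apply (rule 2, use N in \<open>auto split: if_splits\<close>)[1]
        done
    qed
  next
    show "pbounded S esize T" unfolding T_def by (rule pb_intros T0 T3)+
  qed auto
qed


subsection \<open>Lists\<close>

text \<open>Register \<open>N\<close> holds the parameter \<open>x\<close>, \<open>N + 1\<close> the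
  accumulator, \<open>N + 2\<close> the rest of the list, and \<open>N + 3\<close> the current
  element while the argument of the body is put together. One bound \<open>B\<close> serves for all
  values and for the time of the body; \<open>z\<close> is what the last round leaves in register
  0.\<close>

lemma execb_fold_loop:
  fixes ys :: "'y::enc list" and a :: "'a::enc" and x :: "'x::enc"
  assumes N: "0 < N"
    and c: "\<And>i. i < length ys \<Longrightarrow> runs c N (enc (x, foldl f a (take i ys), ys ! i)) B
      (enc (f (foldl f a (take i ys)) (ys ! i)))"
    and B: "\<And>i. i < length ys \<Longrightarrow> esize (x, foldl f a (take i ys), ys ! i) \<le> B"
      "\<And>i. i < length ys \<Longrightarrow> esize (f (foldl f a (take i ys)) (ys ! i)) \<le> B"
      "esize ys \<le> B"
    and s: "s N = enc x" "s (N + 1) = enc a" "s (N + 2) = enc ys" "s (N + 3) = Atom"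
      "\<And>y. 0 < y \<Longrightarrow> y < N \<Longrightarrow> s y = Atom"
  shows "\<exists>z. execb (While (N + 2) (Seq (Assign (N + 3) (HdE (N + 2)))
      (Seq (Assign 0 (ConsE (N + 1) (N + 3))) (Seq (Assign 0 (ConsE N 0)) (Seq (Assign (N + 3) NilE)
      (Seq c (Seq (Assign (N + 1) (VarE 0)) (Assign (N + 2) (TlE (N + 2)))))))))) s
    (1 + length ys * (7 * B + 7)) (s(0 := z, N + 1 := enc (foldl f a ys), N + 2 := Atom))"
    (is "\<exists>z. execb (While _ ?body) s _ _")
  using c B s
proof (induction ys arbitrary: a s)
  case Nil
  have "execb (While (N + 2) ?body) s 1 s" by (rule execb_WhileFalse) (use Nil in simp)
  moreover have "s(0 := s 0, N + 1 := enc a, N + 2 := Atom) = s" using Nil by (auto simp: fun_eq_iff)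
  ultimately show ?case
    by (intro exI[of _ "s 0"]) (simp only: foldl_Nil list.size mult_zero_left add_0_right)
next
  case (Cons y ys)
  note s = Cons.prems(5-)
  define a' where "a' = f a y"
  have c: "runs c N (enc (x, a, y)) B (enc a')" using Cons.prems(1)[of 0] by (simp add: a'_def)
  have Ba: "esize (x, a, y) \<le> B" "esize a' \<le> B" "esize (y # ys) \<le> B"
    using Cons.prems(2)[of 0] Cons.prems(3)[of 0] Cons.prems(4) by (simp_all add: a'_def)
  let ?s1 = "s(0 := enc a', N + 1 := enc a', N + 2 := enc ys)"
  have "\<exists>z. execb (While (N + 2) ?body) ?s1 (1 + length ys * (7 * B + 7))
     (?s1(0 := z, N + 1 := enc (foldl f a' ys), N + 2 := Atom))"
  proof (rule Cons.IH)
    fix i assume i: "i < length ys"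
    show "runs c N (enc (x, foldl f a' (take i ys), ys ! i)) B
       (enc (f (foldl f a' (take i ys)) (ys ! i)))"
      "esize (x, foldl f a' (take i ys), ys ! i) \<le> B"
      "esize (f (foldl f a' (take i ys)) (ys ! i)) \<le> B"
      using Cons.prems(1-3)[of "Suc i"] i by (simp_all add: a'_def)
  qed (use N s Ba in auto)
  then obtain z where z: "execb (While (N + 2) ?body) ?s1 (1 + length ys * (7 * B + 7))
     (?s1(0 := z, N + 1 := enc (foldl f a' ys), N + 2 := Atom))" ..
  have "execb ?body s ((1 + B) + ((1 + B) + ((1 + B) + (1 + (B + ((1 + B) + (1 + B))))))) ?s1"
    apply (rule execb_Seq[of _ _ _ "s(N + 3 := enc y)"])
     apply (rule execb_AssignI, use s N Ba in auto)[1]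
    apply (rule execb_Seq[of _ _ _ "s(N + 3 := enc y, 0 := enc (a, y))"])
     apply (rule execb_AssignI, use s N Ba in auto)[1]
    apply (rule execb_Seq[of _ _ _ "s(N + 3 := enc y, 0 := enc (x, a, y))"])
     apply (rule execb_AssignI, use s N Ba in auto)[1]
    apply (rule execb_Seq[of _ _ _ "s(0 := enc (x, a, y))"])
     apply (rule execb_AssignI, use s N in \<open>auto simp: fun_eq_iff\<close>)[1]
    apply (rule execb_Seq[of _ _ _ "s(0 := enc a')"])
     apply (rule runsD[OF c], use s in auto)[1]
    apply (rule execb_Seq[of _ _ _ "s(0 := enc a', N + 1 := enc a')"])
     apply (rule execb_AssignI, use s N Ba in auto)[1]
    apply (rule execb_AssignI, use s N Ba in auto)
    done
  from execb_WhileTrue[OF _ this z] have "execb (While (N + 2) ?body) s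
    (1 + ((1 + B) + ((1 + B) + ((1 + B) + (1 + (B + ((1 + B) + (1 + B))))))) + (1 + length ys * (7 * B + 7)))
    (?s1(0 := z, N + 1 := enc (foldl f a' ys), N + 2 := Atom))" using s by simp
  then have "execb (While (N + 2) ?body) s (1 + length (y # ys) * (7 * B + 7))
    (?s1(0 := z, N + 1 := enc (foldl f a' ys), N + 2 := Atom))" by (rule execb_mono) simp
  moreover have "?s1(0 := z, N + 1 := enc (foldl f a' ys), N + 2 := Atom) =
    s(0 := z, N + 1 := enc (foldl f a (y # ys)), N + 2 := Atom)" using N by (auto simp: a'_def fun_eq_iff)
  ultimately show ?case by metis
qed

text \<open>Iterating a polynomial-time step over a list can take exponential time, since the
  accumulator may double in every round. Hence each fold has to supply a bound \<open>q\<close> on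
  all intermediate accumulators. The step need be polynomial only on \<open>T\<close>, which has to
  contain the triples that occur.\<close>

lemma ptime_foldl:
  fixes h :: "'x::enc \<Rightarrow> 'a::enc \<Rightarrow> 'y::enc \<Rightarrow> 'a"
  assumes h: "ptime_on T (\<lambda>z. h (fst z) (fst (snd z)) (snd (snd z)))"
    and a: "ptime_on S a" and l: "ptime_on S l"
    and T: "\<And>x i. x \<in> S \<Longrightarrow> i < length (l x) \<Longrightarrow> (x, foldl (h x) (a x) (take i (l x)), l x ! i) \<in> T"
    and q: "pbounded S esize q"
      "\<And>x i. x \<in> S \<Longrightarrow> i \<le> length (l x) \<Longrightarrow> esize (foldl (h x) (a x) (take i (l x))) \<le> q x"
  shows "ptime_on S (\<lambda>x. foldl (h x) (a x) (l x))"
proof -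
  obtain N T0 c where N: "0 < N" and T0: "pbounded T esize T0"
    and c: "\<forall>z\<in>T. runs c N (enc z) (T0 z) (enc (h (fst z) (fst (snd z)) (snd (snd z))))"
    by (rule ptime_onE[OF h]) (rule that)
  from T0 obtain p where p: "\<forall>z\<in>T. T0 z \<le> poly p (esize z)" unfolding pbounded_def by blast
  \<comment> \<open>\<open>B0\<close> bounds the encoded argument of the body, so
    \<open>poly p (B0 x)\<close> bounds its running time, and \<open>B\<close> bounds both.\<close>
  define B0 where "B0 = (\<lambda>x. esize x + q x + esize (l x) + 2)"
  define B where "B = (\<lambda>x. poly p (B0 x) + B0 x)"
  have B0: "pbounded S esize B0" unfolding B0_def
    by (rule pb_intros q(1) ptime_on_esize[OF l])+
  have B: "pbounded S esize B" unfolding B_def by (rule pb_intros B0)+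
  let ?body = "Seq (Assign (N + 3) (HdE (N + 2)))
      (Seq (Assign 0 (ConsE (N + 1) (N + 3))) (Seq (Assign 0 (ConsE N 0)) (Seq (Assign (N + 3) NilE)
      (Seq c (Seq (Assign (N + 1) (VarE 0)) (Assign (N + 2) (TlE (N + 2))))))))"
  let ?prog = "Seq (Assign N (HdE 0)) (Seq (Assign 0 (TlE 0)) (Seq (Assign (N + 1) (HdE 0))
    (Seq (Assign (N + 2) (TlE 0)) (Seq (While (N + 2) ?body)
    (Seq (Assign 0 (VarE (N + 1))) (Seq (Assign N NilE) (Assign (N + 1) NilE)))))))"
  let ?T = "\<lambda>x. (1 + B x) + ((2 + 2 * B x) + ((1 + B x) + ((1 + B x) +
    (1 + B x * (7 * B x + 7) + ((1 + B x) + (1 + 1))))))"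
  define S' where "S' = (\<lambda>x. (x, a x, l x)) ` S"
  have "runs ?prog (N + 4) (enc (x, a x, l x)) (?T x) (enc (foldl (h x) (a x) (l x)))"
    if x: "x \<in> S" for x
  proof (rule runsI)
    fix s :: store
    assume s: "s 0 = enc (x, a x, l x)" "\<And>y. 0 < y \<Longrightarrow> y < N + 4 \<Longrightarrow> s y = Atom"
    have q': "esize (foldl (h x) (a x) (take i (l x))) \<le> q x" if "i \<le> length (l x)" for i
      using q(2)[OF x that] .
    have le: "esize x \<le> B x" "esize (l x) \<le> B x" "esize (a x) \<le> B x" "length (l x) \<le> B x"
      "esize (foldl (h x) (a x) (l x)) \<le> B x"
      using q'[of 0] q'[of "length (l x)"] length_le_esize[of "l x"] by (auto simp: B_def B0_def)
    have arg: "esize (x, foldl (h x) (a x) (take i (l x)), l x ! i) \<le> B0 x" if "i < length (l x)" for i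
      using q'[of i] esize_nth[of i "l x"] that by (simp add: B0_def)
    let ?s = "s(N := enc x, 0 := enc (a x, l x), N + 1 := enc (a x), N + 2 := enc (l x))"
    have "\<exists>z. execb (While (N + 2) ?body) ?s (1 + length (l x) * (7 * B x + 7))
       (?s(0 := z, N + 1 := enc (foldl (h x) (a x) (l x)), N + 2 := Atom))"
    proof (rule execb_fold_loop[OF N, where x = x])
      fix i assume i: "i < length (l x)"
      let ?z = "(x, foldl (h x) (a x) (take i (l x)), l x ! i)"
      have "T0 ?z \<le> poly p (esize ?z)" using p T[OF x i] by blast
      also have "\<dots> \<le> poly p (B0 x)" by (rule poly_nat_mono) (rule arg[OF i])
      finally have "T0 ?z \<le> B x" by (simp add: B_def)
      with bspec[OF c T[OF x i]]
      show "runs c N (enc ?z) (B x) (enc (h x (foldl (h x) (a x) (take i (l x))) (l x ! i)))"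
        by (auto elim: runs_mono)
      show "esize ?z \<le> B x" using arg[OF i] by (simp add: B_def)
      have "foldl (h x) (a x) (take (Suc i) (l x)) = h x (foldl (h x) (a x) (take i (l x))) (l x ! i)"
        using i by (simp add: take_Suc_conv_app_nth)
      then show "esize (h x (foldl (h x) (a x) (take i (l x))) (l x ! i)) \<le> B x"
        using q'[of "Suc i"] i by (simp add: B_def B0_def)
    qed (use le s N in auto)
    then obtain z where z: "execb (While (N + 2) ?body) ?s (1 + length (l x) * (7 * B x + 7))
       (?s(0 := z, N + 1 := enc (foldl (h x) (a x) (l x)), N + 2 := Atom))" ..
    have z: "execb (While (N + 2) ?body) ?s (1 + B x * (7 * B x + 7))
       (?s(0 := z, N + 1 := enc (foldl (h x) (a x) (l x)), N + 2 := Atom))"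
      by (rule execb_mono[OF z]) (use le in simp)
    have aB: "esize (a x) + esize (l x) \<le> B x"
      using q'[of 0] by (simp add: B_def B0_def)
    let ?r = "enc (foldl (h x) (a x) (l x))"
    show "execb ?prog s (?T x) (s(0 := ?r))"
      apply (rule execb_Seq[of _ _ _ "s(N := enc x)"])
       apply (rule execb_AssignI, use s N le in auto)[1]
      apply (rule execb_Seq[of _ _ _ "s(N := enc x, 0 := enc (a x, l x))"])
       apply (rule execb_AssignI, use s N aB in auto)[1]
      apply (rule execb_Seq[of _ _ _ "s(N := enc x, 0 := enc (a x, l x), N + 1 := enc (a x))"])
       apply (rule execb_AssignI, use s N le in auto)[1]
      apply (rule execb_Seq[of _ _ _ ?s])
       apply (rule execb_AssignI, use s N le in auto)[1]
      apply (rule execb_Seq[OF z])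
      apply (rule execb_Seq[of _ _ _ "s(N := enc x, 0 := ?r, N + 1 := ?r)"])
       apply (rule execb_AssignI, use s N le in \<open>auto simp: fun_eq_iff\<close>)[1]
      apply (rule execb_Seq[of _ _ _ "s(0 := ?r, N + 1 := ?r)"])
       apply (rule execb_AssignI, use s N le in \<open>auto simp: fun_eq_iff\<close>)[1]
      apply (rule execb_AssignI, use s N le in \<open>auto simp: fun_eq_iff\<close>)
      done
  qed
  moreover have "pbounded S esize ?T" by (rule pb_intros B)+
  \<comment> \<open>The program starts from the triple, which is no smaller than \<open>x\<close>,
    so a polynomial in the size of \<open>x\<close> remains valid.\<close>
  then have "pbounded S' esize (\<lambda>z. ?T (fst z))"
  proof -
    assume "pbounded S esize ?T"
    then obtain r where "\<forall>x\<in>S. ?T x \<le> poly r (esize x)" unfolding pbounded_def by blast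
    moreover have "poly r (esize x) \<le> poly r (esize (x, a x, l x))" for x
      by (rule poly_nat_mono) simp
    ultimately show ?thesis unfolding pbounded_def S'_def
      by (intro exI[of _ r]) (auto intro: order_trans)
  qed
  ultimately have "ptime_on S' (\<lambda>z. foldl (h (fst z)) (fst (snd z)) (snd (snd z)))"
    by (intro ptime_onI[of S' ?prog "N + 4" "\<lambda>z. ?T (fst z)"]) (auto simp: S'_def)
  from ptime_on_comp[OF this, of S "\<lambda>x. (x, a x, l x)"] show ?thesis
    by (simp add: S'_def ptime_Pair ptime_id a l)
qed

lemma ptime_foldl':
  fixes h :: "'x::enc \<Rightarrow> 'a::enc \<Rightarrow> 'y::enc \<Rightarrow> 'a"
  assumes "ptime (\<lambda>z. h (fst z) (fst (snd z)) (snd (snd z)))" "ptime_on S a" "ptime_on S l"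
    and "pbounded S esize q"
      "\<And>x i. x \<in> S \<Longrightarrow> i \<le> length (l x) \<Longrightarrow> esize (foldl (h x) (a x) (take i (l x))) \<le> q x"
  shows "ptime_on S (\<lambda>x. foldl (h x) (a x) (l x))"
  by (rule ptime_foldl[of UNIV, OF assms(1,2,3) _ assms(4,5)]) auto

section \<open>Common list functions and Boolean connectives\<close>

lemma esize_append [simp]: "esize (xs @ ys) = esize xs + esize ys"
  by (induction xs) auto

lemma esize_rev [simp]: "esize (rev xs) = esize xs"
  by (induction xs) auto

lemma esize_take: "esize (take i xs) \<le> esize xs"
  by (metis append_take_drop_id esize_append le_add1)

lemma ptime_rev [pt_intros]:
  assumes "ptime_on S f"
  shows "ptime_on S (\<lambda>x. rev (f x))"
proof (rule ptime_comp[OF _ assms])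
  have foldl: "foldl (\<lambda>a y. y # a) a xs = rev xs @ a" for a xs :: "'b list"
    by (induction xs arbitrary: a) auto
  have "ptime (\<lambda>xs :: 'b list. foldl (\<lambda>a y. y # a) [] xs)"
    by (rule ptime_foldl'[where q = esize])
      (rule pt_intros pb_intros | simp add: foldl esize_rev esize_take)+
  then show "ptime (\<lambda>xs :: 'b list. rev xs)" by (simp add: foldl)
qed

text \<open>The fold conses results onto the accumulator and produces them in reverse order; a final
  reversal restores it. For the accumulator bound, each result has size polynomial in
  \<open>x\<close> and one element, and there are at most \<open>esize (l x)\<close> of
  them.\<close>

lemma ptime_map [pt_intros]:
  fixes f :: "'x::enc \<Rightarrow> 'y::enc \<Rightarrow> 'z::enc"
  assumes f: "ptime (\<lambda>z. f (fst z) (snd z))" and l: "ptime_on S l"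
  shows "ptime_on S (\<lambda>x. map (f x) (l x))"
proof -
  have foldl: "foldl (\<lambda>a y. f x y # a) a ys = rev (map (f x) ys) @ a" for x a ys
    by (induction ys arbitrary: a) auto
  from ptime_on_esize[OF f] obtain p where p: "\<And>x y. esize (f x y) \<le> poly p (esize (x, y))"
    unfolding pbounded_def by auto
  have "ptime_on S (\<lambda>x. foldl (\<lambda>a y. f x y # a) [] (l x))"
  proof (rule ptime_foldl'[where q = "\<lambda>x. esize (l x) * (poly p (esize x + esize (l x) + 1) + 1)"])
    show "ptime (\<lambda>z. f (fst z) (snd (snd z)) # fst (snd z))"
      by (rule pt_intros ptime_comp[OF f, of _ "\<lambda>z. (fst z, snd (snd z))", simplified])+
    show "pbounded S esize (\<lambda>x. esize (l x) * (poly p (esize x + esize (l x) + 1) + 1))"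
      by (rule pb_intros ptime_on_esize[OF l])+
    fix x i assume "i \<le> length (l x)"
    have "\<forall>z\<in>set (map (f x) (take i (l x))). esize z \<le> poly p (esize x + esize (l x) + 1)"
    proof
      fix z assume "z \<in> set (map (f x) (take i (l x)))"
      then obtain y where y: "z = f x y" "y \<in> set (l x)" by (auto dest: in_set_takeD)
      have "esize z \<le> poly p (esize (x, y))" using p y by simp
      also have "\<dots> \<le> poly p (esize x + esize (l x) + 1)"
        by (rule poly_nat_mono) (use esize_mem[OF y(2)] in simp)
      finally show "esize z \<le> poly p (esize x + esize (l x) + 1)" .
    qed
    from esize_list_le[OF this]
    have "esize (map (f x) (take i (l x)))
      \<le> length (map (f x) (take i (l x))) * (poly p (esize x + esize (l x) + 1) + 1)" .
    also have "\<dots> \<le> esize (l x) * (poly p (esize x + esize (l x) + 1) + 1)"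
      by (rule mult_le_mono1) (use length_le_esize[of "l x"] in simp)
    finally show "esize (foldl (\<lambda>a y. f x y # a) [] (take i (l x)))
      \<le> esize (l x) * (poly p (esize x + esize (l x) + 1) + 1)"
      by (simp only: foldl esize_rev append_Nil2)
  qed (rule pt_intros l)+
  from ptime_rev[OF this] show ?thesis by (simp add: foldl)
qed

lemma esize_filter: "esize (filter P xs) \<le> esize xs"
  by (induction xs) auto

lemma ptime_filter [pt_intros]:
  fixes P :: "'x::enc \<Rightarrow> 'y::enc \<Rightarrow> bool"
  assumes P: "ptime (\<lambda>z. P (fst z) (snd z))" and l: "ptime_on S l"
  shows "ptime_on S (\<lambda>x. filter (P x) (l x))"
proof -
  have foldl: "foldl (\<lambda>a y. if P x y then y # a else a) a ys = rev (filter (P x) ys) @ a" for x a ys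
    by (induction ys arbitrary: a) auto
  have "ptime_on S (\<lambda>x. foldl (\<lambda>a y. if P x y then y # a else a) [] (l x))"
  proof (rule ptime_foldl'[where q = "\<lambda>x. esize (l x)"])
    show "ptime (\<lambda>z. if P (fst z) (snd (snd z)) then snd (snd z) # fst (snd z) else fst (snd z))"
      by (rule pt_intros ptime_comp[OF P, of _ "\<lambda>z. (fst z, snd (snd z))", simplified])+
    show "esize (foldl (\<lambda>a y. if P x y then y # a else a) [] (take i (l x))) \<le> esize (l x)" for x i
      using le_trans[OF esize_filter esize_take] by (simp add: foldl esize_rev)
  qed (rule pt_intros l ptime_on_esize)+
  from ptime_rev[OF this] show ?thesis by (simp add: foldl)
qed

lemma ptime_append [pt_intros]:
  assumes "ptime_on S f" "ptime_on S g"
  shows "ptime_on S (\<lambda>x. f x @ g x)"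
proof -
  have foldl: "foldl (\<lambda>a y. y # a) a xs = rev xs @ a" for a xs :: "'b list"
    by (induction xs arbitrary: a) auto
  have "ptime_on S (\<lambda>x. foldl (\<lambda>a y. y # a) (g x) (rev (f x)))"
  proof (rule ptime_foldl'[where q = "\<lambda>x. esize (f x) + esize (g x)"])
    show "esize (foldl (\<lambda>a y. y # a) (g x) (take i (rev (f x)))) \<le> esize (f x) + esize (g x)" for x i
      using esize_take[of i "rev (f x)"] by (simp add: foldl esize_rev)
  qed (rule pt_intros pb_intros assms ptime_on_esize)+
  then show ?thesis by (simp add: foldl)
qed

lemma ptime_concat [pt_intros]:
  assumes "ptime_on S f"
  shows "ptime_on S (\<lambda>x. concat (f x))"
proof (rule ptime_comp[OF _ assms])
  have foldl: "foldl (\<lambda>a y. a @ y) a xs = a @ concat xs" for a and xs :: "'b list list"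
    by (induction xs arbitrary: a) auto
  have concat: "esize (concat xs) \<le> esize xs" for xs :: "'b list list"
    by (induction xs) auto
  have "ptime (\<lambda>xs :: 'b list list. foldl (\<lambda>a y. a @ y) [] xs)"
  proof (rule ptime_foldl'[where q = esize])
    show "esize (foldl (\<lambda>a y. a @ y) [] (take i xs)) \<le> esize xs" for i and xs :: "'b list list"
      using le_trans[OF concat esize_take] by (simp add: foldl)
  qed (rule pt_intros pb_intros)+
  then show "ptime (\<lambda>xs :: 'b list list. concat xs)" by (simp add: foldl)
qed

lemma ptime_case_list [pt_intros]:
  fixes g :: "'x::enc \<Rightarrow> 'y::enc \<Rightarrow> 'y list \<Rightarrow> 'z::enc"
  assumes "ptime_on S l" "ptime_on S f"
    and g: "ptime (\<lambda>z. g (fst z) (fst (snd z)) (snd (snd z)))"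
  shows "ptime_on S (\<lambda>x. case l x of [] \<Rightarrow> f x | y # ys \<Rightarrow> g x y ys)"
proof -
  let ?S = "{x \<in> S. l x \<noteq> []}"
  have "ptime_on ?S l" using assms(1) by (rule ptime_on_subset) auto
  then have "ptime_on ?S (\<lambda>x. g x (hd (l x)) (tl (l x)))"
    by (intro ptime_comp[OF g, of _ "\<lambda>x. (x, hd (l x), tl (l x))", simplified] pt_intros) auto
  moreover have "ptime_on {x \<in> S. l x = []} f" using assms(2) by (rule ptime_on_subset) auto
  ultimately have "ptime_on S (\<lambda>x. if l x = [] then f x else g x (hd (l x)) (tl (l x)))"
    by (intro ptime_If ptime_null assms)
  then show ?thesis by (rule ptime_on_cong) (auto split: list.split)
qed

lemma ptime_not [pt_intros]: "ptime_on S P \<Longrightarrow> ptime_on S (\<lambda>x. \<not> P x)"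
  by (rule ptime_on_cong[of S "\<lambda>x. if P x then False else True"]) (rule pt_intros | simp)+

lemma ptime_conj [pt_intros]:
  assumes "ptime_on S P" "ptime_on S Q"
  shows "ptime_on S (\<lambda>x. P x \<and> Q x)"
proof -
  have "ptime_on S (\<lambda>x. if P x then Q x else False)"
    by (rule pt_intros assms ptime_on_subset[OF assms(2)] | blast)+
  then show ?thesis by (rule ptime_on_cong) auto
qed

lemma ptime_disj [pt_intros]:
  assumes "ptime_on S P" "ptime_on S Q"
  shows "ptime_on S (\<lambda>x. P x \<or> Q x)"
proof -
  have "ptime_on S (\<lambda>x. if P x then True else Q x)"
    by (rule pt_intros assms ptime_on_subset[OF assms(2)] | blast)+
  then show ?thesis by (rule ptime_on_cong) auto
qed

lemma ptime_eq_bool [pt_intros]: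
  fixes P Q :: "'a::enc \<Rightarrow> bool"
  assumes "ptime_on S P" "ptime_on S Q"
  shows "ptime_on S (\<lambda>x. P x = Q x)"
proof -
  have "ptime_on S (\<lambda>x. P x \<and> Q x \<or> \<not> P x \<and> \<not> Q x)"
    by (rule pt_intros assms)+
  then show ?thesis by (rule ptime_on_cong) auto
qed


subsection \<open>Binary arithmetic\<close>

text \<open>Leading zeros are tolerated here, in contrast to \<open>nat_bits\<close>. Arithmetic can
  thus work on bit lists of convenient length and normalise only at the end.\<close>

fun bits_val :: "bool list \<Rightarrow> nat" where
  "bits_val [] = 0"
| "bits_val (b # bs) = of_bool b + 2 * bits_val bs"

abbreviation nbits :: "nat \<Rightarrow> nat" where "nbits n \<equiv> length (nat_bits n)"

lemma bits_val_nat_bits [simp]: "bits_val (nat_bits n) = n"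
proof (induction n rule: less_induct)
  case (less n)
  show ?case
  proof (cases "n = 0")
    case False
    then have "bits_val (nat_bits (n div 2)) = n div 2" by (intro less) auto
    then show ?thesis using False by (subst nat_bits.simps) simp
  qed (simp add: nat_bits.simps)
qed

lemma nat_bits_0 [simp]: "nat_bits 0 = []"
  by (simp add: nat_bits.simps)

lemma nat_bits_Nil_iff [simp]: "nat_bits n = [] \<longleftrightarrow> n = 0"
  by (subst nat_bits.simps) auto

lemma nat_bits_double: "nat_bits (of_bool b + 2 * v) = (if b \<or> v \<noteq> 0 then b # nat_bits v else [])"
  by (subst nat_bits.simps) auto

lemma bits_val_append: "bits_val (xs @ ys) = bits_val xs + 2 ^ length xs * bits_val ys"
  by (induction xs) (auto simp: algebra_simps)

lemma bits_val_less: "bits_val bs < 2 ^ length bs"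
  by (induction bs) auto

lemma bits_val_pos_iff: "0 < bits_val bs \<longleftrightarrow> True \<in> set bs"
  by (induction bs) auto

lemma less_nbits: "n < 2 ^ nbits n"
  using bits_val_less[of "nat_bits n"] by simp

lemma nbits_le: "n < 2 ^ k \<Longrightarrow> nbits n \<le> k"
proof (induction k arbitrary: n)
  case (Suc k)
  have "n div 2 < 2 ^ k" using Suc.prems by auto
  from Suc.IH[OF this] show ?case by (subst nat_bits.simps) auto
qed simp

lemma nbits_mono: "m \<le> n \<Longrightarrow> nbits m \<le> nbits n"
  by (rule nbits_le) (use less_nbits[of n] in simp)

lemma nbits_mult: "nbits (m * n) \<le> nbits m + nbits n"
  by (rule nbits_le) (simp add: power_add mult_strict_mono less_nbits)

lemma nbits_add:
  assumes "nbits m \<le> k" "nbits n \<le> k"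
  shows "nbits (m + n) \<le> Suc k"
proof (rule nbits_le)
  have "m < 2 ^ k" "n < 2 ^ k"
    using assms less_nbits[of m] less_nbits[of n]
    by (meson less_le_trans one_le_numeral power_increasing)+
  then show "m + n < 2 ^ Suc k" by simp
qed

lemma enc_bits: "enc (nat_bits n) = enc n"
  by (simp add: enc_nat_inst enc_nat_def enc_list_inst enc_bool_inst)

lemma nbits_le_esize: "nbits n \<le> esize n"
  using length_le_esize[of "nat_bits n"] by (simp add: enc_bits)

text \<open>Supplies the bound required by \<open>ptime_foldl'\<close> when each element enlarges
  the accumulator by a limited amount.\<close>

lemma foldl_measure_le:
  fixes m :: "'a \<Rightarrow> nat"
  assumes "\<And>a y. m (f a y) \<le> m a + w y"
  shows "m (foldl f a ys) \<le> m a + (\<Sum>y\<leftarrow>ys. w y)"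
proof (induction ys arbitrary: a)
  case (Cons y ys)
  have "m (foldl f (f a y) ys) \<le> m (f a y) + (\<Sum>y\<leftarrow>ys. w y)" by (rule Cons.IH)
  with assms[of a y] show ?case by simp
qed simp

text \<open>A number and its bit list have the same encoding, so nothing is computed here. The
  converse conversion has to strip leading zeros.\<close>

lemma ptime_nat_bits [pt_intros]: "ptime_on S f \<Longrightarrow> ptime_on S (\<lambda>x. nat_bits (f x))"
  unfolding ptime_on_def by (simp add: enc_bits)

text \<open>Read from the most significant end, zeros are skipped as long as the accumulator is
  empty.\<close>

lemma nat_bits_of_bits_val:
  "foldl (\<lambda>a b. if b \<or> a \<noteq> [] then b # a else []) [] (rev bs) = nat_bits (bits_val bs)"
  by (induction bs) (auto simp: nat_bits_double)

lemma ptime_bits_val [pt_intros]: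
  assumes "ptime_on S f"
  shows "ptime_on S (\<lambda>x. bits_val (f x))"
proof (rule ptime_comp[OF _ assms])
  have "ptime (\<lambda>bs. foldl (\<lambda>a b. if b \<or> a \<noteq> [] then b # a else []) [] (rev bs))"
  proof (rule ptime_foldl'[where q = esize])
    have esize: "esize (foldl (\<lambda>a b. if b \<or> a \<noteq> [] then b # a else []) a bs) \<le> esize a + esize bs"
      for a bs using foldl_measure_le[of esize "\<lambda>a b. if b \<or> a \<noteq> [] then b # a else []" "\<lambda>b. esize b + 1" a bs]
      by (simp add: esize_list[of bs] del: sum_list_Suc sum_list_addf)
    show "esize (foldl (\<lambda>a b. if b \<or> a \<noteq> [] then b # a else []) [] (take i (rev bs))) \<le> esize bs"
      for i bs using esize[of "[]" "take i (rev bs)"] esize_take[of i "rev bs"] by simp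
  qed (rule pt_intros pb_intros)+
  then show "ptime bits_val"
    unfolding nat_bits_of_bits_val ptime_on_def by (simp add: enc_bits)
qed

section \<open>Addition of bit lists with carry\<close>

definition hd_bit :: "bool list \<Rightarrow> bool" where
  "hd_bit bs = (case bs of [] \<Rightarrow> False | b # _ \<Rightarrow> b)"

lemma bits_val_hd_tl: "bits_val bs = of_bool (hd_bit bs) + 2 * bits_val (tl bs)"
  by (cases bs) (auto simp: hd_bit_def)

lemma ptime_hd_bit [pt_intros]: "ptime_on S f \<Longrightarrow> ptime_on S (\<lambda>x. hd_bit (f x))"
  unfolding hd_bit_def by (rule pt_intros | assumption)+

text \<open>The state holds the unread bits of the other summand, the carry, and the output in
  reverse. The carry is a majority vote, and the iterated equivalence is the parity of the three
  bits.\<close>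

definition add_step :: "bool list \<times> bool \<times> bool list \<Rightarrow> bool \<Rightarrow> bool list \<times> bool \<times> bool list" where
  "add_step a x = (tl (fst a),
     x \<and> hd_bit (fst a) \<or> x \<and> fst (snd a) \<or> hd_bit (fst a) \<and> fst (snd a),
     (x = (hd_bit (fst a) = fst (snd a))) # snd (snd a))"

text \<open>The loop invariant: the output as a number, plus carry and unread bits at the current
  place value. A step changes it only by the value of the bit read.\<close>

definition adder_val :: "bool list \<times> bool \<times> bool list \<Rightarrow> nat" where
  "adder_val a = bits_val (rev (snd (snd a))) +
     2 ^ length (snd (snd a)) * (of_bool (fst (snd a)) + bits_val (fst a))"

lemma adder_val_step:
  "adder_val (add_step a x) = adder_val a + 2 ^ length (snd (snd a)) * of_bool x"
  using bits_val_hd_tl[of "fst a"]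
  by (auto simp: adder_val_def add_step_def bits_val_append algebra_simps)

lemma length_add_step: "length (snd (snd (add_step a x))) = Suc (length (snd (snd a)))"
  by (simp add: add_step_def)

lemma adder_val_foldl:
  "adder_val (foldl add_step a xs) = adder_val a + 2 ^ length (snd (snd a)) * bits_val xs"
  by (induction xs arbitrary: a) (simp_all add: adder_val_step length_add_step algebra_simps)

lemma length_foldl_add_step:
  "length (snd (snd (foldl add_step a xs))) = length (snd (snd a)) + length xs"
  by (induction xs arbitrary: a) (auto simp: add_step_def)

lemma fst_foldl_add_step: "fst (foldl add_step a xs) = drop (length xs) (fst a)"
  by (induction xs arbitrary: a) (auto simp: add_step_def drop_Suc drop_tl)

lemma esize_bool_list: "esize bs \<le> 2 * length bs" for bs :: "bool list"
proof (induction bs)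
  case (Cons b bs)
  then show ?case using esize_bool[of b] by simp
qed simp

lemma esize_le_nbits: "esize n \<le> 2 * nbits n"
  using esize_bool_list[of "nat_bits n"] by (simp add: enc_bits)

text \<open>Once \<open>xs\<close> is used up, a second pass feeds the leftover bits of
  \<open>ys\<close> against the empty list to propagate the carry. If \<open>xs\<close> is the
  longer list, \<open>hd_bit\<close> pads \<open>ys\<close> with zeros.\<close>

definition adder :: "bool list \<Rightarrow> bool list \<Rightarrow> bool list \<times> bool \<times> bool list" where
  "adder xs ys = (let a = foldl add_step (ys, False, []) xs in foldl add_step ([], snd a) (fst a))"

lemma add_eq_adder:
  "m + n = (let a = adder (nat_bits m) (nat_bits n) in bits_val (rev (snd (snd a)) @ [fst (snd a)]))"
proof -
  define a where "a = foldl add_step (nat_bits n, False, []) (nat_bits m)"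
  define b where "b = foldl add_step ([], snd a) (fst a)"
  have "adder_val b = adder_val a"
    unfolding b_def adder_val_foldl by (simp add: adder_val_def algebra_simps)
  also have "\<dots> = m + n"
    unfolding a_def adder_val_foldl by (simp add: adder_val_def)
  finally have "adder_val b = m + n" .
  moreover have "fst b = []"
    using fst_foldl_add_step[of "([], snd a)" "fst a"] by (simp add: b_def)
  ultimately show ?thesis
    by (simp add: adder_def adder_val_def bits_val_append a_def[symmetric] b_def[symmetric] Let_def)
qed

lemma ptime_foldl_add_step:
  assumes "ptime_on S f" "ptime_on S g"
  shows "ptime_on S (\<lambda>x. foldl add_step (f x) (g x))"
proof (rule ptime_foldl'[where q = "\<lambda>x. 6 * (esize (f x) + esize (g x)) + 6"])
  fix x i
  define a where "a = foldl add_step (f x) (take i (g x))"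
  have "length (fst a) \<le> esize (f x)" "length (snd (snd a)) \<le> esize (f x) + esize (g x)"
    using length_foldl_add_step[of "f x" "take i (g x)"] fst_foldl_add_step[of "f x" "take i (g x)"]
      length_le_esize[of "fst (f x)"] length_le_esize[of "snd (snd (f x))"] length_le_esize[of "g x"]
    by (auto simp: a_def enc_pair[of "f x"] enc_pair[of "snd (f x)"])
  then show "esize a \<le> 6 * (esize (f x) + esize (g x)) + 6"
    using esize_bool_list[of "fst a"] esize_bool_list[of "snd (snd a)"] esize_bool[of "fst (snd a)"]
    by (simp add: enc_pair[of a] enc_pair[of "snd a"])
qed (unfold add_step_def, (rule pt_intros pb_intros assms ptime_on_esize)+)

lemma ptime_add [pt_intros]:
  fixes f g :: "'a::enc \<Rightarrow> nat"
  assumes "ptime_on S f" "ptime_on S g"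
  shows "ptime_on S (\<lambda>x. f x + g x)"
  unfolding add_eq_adder adder_def Let_def
  by (rule pt_intros ptime_foldl_add_step assms)+

section \<open>Comparison of bit lists\<close>

definition le_step :: "bool list \<times> bool \<Rightarrow> bool \<Rightarrow> bool list \<times> bool" where
  "le_step a x = (tl (fst a), if x = hd_bit (fst a) then snd a else hd_bit (fst a))"

text \<open>Bits arrive in order of increasing significance, so a later difference overrides the
  verdict so far. In the end, any one among the unread bits decides for the second number.\<close>

lemma le_foldl:
  "(let b = foldl le_step a xs in filter (\<lambda>y. y) (fst b) \<noteq> [] \<or> snd b) \<longleftrightarrow>
    bits_val xs < bits_val (fst a) \<or> bits_val xs = bits_val (fst a) \<and> snd a"
proof (induction xs arbitrary: a)
  case Nil
  show ?case
    using bits_val_pos_iff[of "fst a"] by (auto simp: filter_empty_conv)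
next
  case (Cons x xs)
  show ?case using bits_val_hd_tl[of "fst a"]
    unfolding foldl_Cons Cons.IH by (auto simp: le_step_def)
qed

lemma le_eq_foldl:
  "m \<le> n \<longleftrightarrow> (let b = foldl le_step (nat_bits n, True) (nat_bits m) in
    filter (\<lambda>y. y) (fst b) \<noteq> [] \<or> snd b)"
  unfolding le_foldl by auto

lemma ptime_foldl_le_step:
  assumes "ptime_on S f" "ptime_on S g"
  shows "ptime_on S (\<lambda>x. foldl le_step (f x) (g x))"
proof (rule ptime_foldl'[where q = "\<lambda>x. esize (f x) + 2"])
  fix x i
  define a where "a = foldl le_step (f x) (take i (g x))"
  have "esize (tl xs) \<le> esize xs" for xs :: "bool list" by (cases xs) auto
  then have "esize (fst a) \<le> esize (fst (f x)) + (\<Sum>y\<leftarrow>take i (g x). 0)"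
    unfolding a_def by (intro foldl_measure_le[of "\<lambda>a. esize (fst a)"]) (simp add: le_step_def)
  then show "esize a \<le> esize (f x) + 2"
    using esize_bool[of "snd a"] by (simp add: enc_pair[of a] enc_pair[of "f x"])
qed (unfold le_step_def, (rule pt_intros pb_intros assms ptime_on_esize)+)

lemma ptime_le [pt_intros]:
  fixes f g :: "'a::enc \<Rightarrow> nat"
  assumes "ptime_on S f" "ptime_on S g"
  shows "ptime_on S (\<lambda>x. f x \<le> g x)"
  unfolding le_eq_foldl Let_def
  by (rule pt_intros ptime_foldl_le_step assms)+

lemma ptime_eq_nat [pt_intros]:
  fixes f g :: "'a::enc \<Rightarrow> nat"
  assumes "ptime_on S f" "ptime_on S g"
  shows "ptime_on S (\<lambda>x. f x = g x)"
  unfolding order_eq_iff by (rule pt_intros assms)+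

section \<open>Multiplication by doubling and adding\<close>

lemma foldl_mult: "foldl (\<lambda>a b. a + a + (if b then y else 0)) 0 (rev bs) = bits_val bs * y" for y :: nat
  by (induction bs) (auto simp: algebra_simps)

lemma bits_val_drop: "bits_val (drop i bs) \<le> bits_val bs"
proof (induction bs arbitrary: i)
  case (Cons b bs)
  show ?case by (cases i) (auto intro: le_trans[OF Cons.IH])
qed simp

lemma ptime_mult [pt_intros]:
  fixes f g :: "'a::enc \<Rightarrow> nat"
  assumes "ptime_on S f" "ptime_on S g"
  shows "ptime_on S (\<lambda>x. f x * g x)"
proof -
  have "ptime (\<lambda>x :: nat \<times> nat.
    foldl (\<lambda>a b. a + a + (if b then snd x else 0)) 0 (rev (nat_bits (fst x))))"
  proof (rule ptime_foldl'[where q = "\<lambda>x. 2 * esize x"])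
    fix x :: "nat \<times> nat" and i
    let ?a = "foldl (\<lambda>a b. a + a + (if b then snd x else 0)) 0 (take i (rev (nat_bits (fst x))))"
    \<comment> \<open>The partial result is \<open>snd x\<close> times the number formed by the more
      significant bits of the first factor, hence at most the full product. This limits its bit
      length.\<close>
    have "?a \<le> fst x * snd x"
      using bits_val_drop[of _ "nat_bits (fst x)"] by (simp add: take_rev foldl_mult)
    then have "nbits ?a \<le> nbits (fst x * snd x)" by (rule nbits_mono)
    also have "\<dots> \<le> esize x"
      using nbits_mult[of "fst x" "snd x"] nbits_le_esize[of "fst x"] nbits_le_esize[of "snd x"]
      by (simp add: enc_pair)
    finally show "esize ?a \<le> 2 * esize x"
      using esize_le_nbits[of ?a] by simp
  qed (rule pt_intros pb_intros)+
  then have "ptime (\<lambda>x :: nat \<times> nat. fst x * snd x)" by (simp add: foldl_mult)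
  from ptime_comp[OF this ptime_Pair[OF assms]] show ?thesis by simp
qed


section \<open>The algorithm\<close>

type_synonym wedge = "nat \<times> nat \<times> nat"

definition away :: "nat \<Rightarrow> wedge list \<Rightarrow> wedge list" where
  "away v E = filter (\<lambda>e. \<not> (fst e = v \<or> fst (snd e) = v)) E"

text \<open>The edges at \<open>v\<close> as pairs of the other endpoint and the weight. Loops are dropped.\<close>

definition inc :: "nat \<Rightarrow> wedge list \<Rightarrow> (nat \<times> nat) list" where
  "inc v E = map (\<lambda>e. (if fst e = v then fst (snd e) else fst e, snd (snd e)))
     (filter (\<lambda>e. \<not> (fst e = v) = (fst (snd e) = v)) E)"

text \<open>A state consists of the remaining edges and the terminals. A non-terminal of degree at most 2
  is bypassed; otherwise it is either deleted or made a terminal.\<close>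

definition elim :: "nat \<Rightarrow> wedge list \<times> nat list \<Rightarrow> (wedge list \<times> nat list) list" where
  "elim v st =
     (if filter (\<lambda>x. x = v) (snd st) \<noteq> [] then [st]
      else case inc v (fst st) of
        [] \<Rightarrow> [(away v (fst st), snd st)]
      | a # as \<Rightarrow> (case as of
          [] \<Rightarrow> [(away v (fst st), snd st)]
        | b # bs \<Rightarrow>
            if bs = [] then [((fst a, fst b, snd a + snd b) # away v (fst st), snd st)]
            else [(away v (fst st), snd st), (fst st, v # snd st)]))"

definition explore :: "nat list \<Rightarrow> wedge list \<times> nat list \<Rightarrow> (wedge list \<times> nat list) list" where
  "explore vs st = foldl (\<lambda>sts v. concat (map (elim v) sts)) [st] vs"

definition lightest :: "nat \<times> nat \<Rightarrow> (nat \<times> nat) list \<Rightarrow> nat \<times> nat" where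
  "lightest a es = foldl (\<lambda>m e. if snd e \<le> snd m then e else m) a es"

text \<open>Once all vertices are terminals, some minimum spanning tree contains the lightest edge at \<open>v\<close>.\<close>

definition contract :: "bool \<times> wedge list \<times> nat \<Rightarrow> nat \<Rightarrow> bool \<times> wedge list \<times> nat" where
  "contract a v = (case inc v (fst (snd a)) of
       [] \<Rightarrow> (False, snd a)
     | e # es \<Rightarrow> (fst a, away v (fst (snd a)) @ map (\<lambda>f. (fst (lightest e es), f)) (e # es),
         snd (snd a) + snd (lightest e es)))"

text \<open>The first terminal is never contracted; contracting all others pays for the edges of a
  minimum spanning tree. The flag becomes \<open>False\<close> when a vertex has no edge to another
  vertex, so that no spanning tree exists.\<close>

definition spans :: "wedge list \<times> nat list \<Rightarrow> nat \<Rightarrow> bool" where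
  "spans st k = (case snd st of
       [] \<Rightarrow> True
     | r # rs \<Rightarrow> fst (foldl contract (True, fst st, 0) rs) \<and>
         snd (snd (foldl contract (True, fst st, 0) rs)) \<le> k)"

text \<open>Clears the denominators; the second component is the common denominator.\<close>

definition scale_step :: "wedge list \<times> nat \<Rightarrow> (nat \<times> nat) \<times> (nat \<times> nat) \<Rightarrow> wedge list \<times> nat" where
  "scale_step a e = ((fst (fst e), snd (fst e), fst (snd e) * snd a) #
     map (\<lambda>f. (fst f, fst (snd f), snd (snd f) * snd (snd e))) (fst a), snd a * snd (snd e))"

definition scale :: "((nat \<times> nat) \<times> (nat \<times> nat)) list \<Rightarrow> wedge list \<times> nat" where
  "scale es = foldl scale_step ([], 1) es"

type_synonym est_input =
  "nat list \<times> ((nat \<times> nat) \<times> (nat \<times> nat)) list \<times> nat list \<times> nat"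

definition initial_state :: "est_input \<Rightarrow> wedge list \<times> nat list" where
  "initial_state x = (fst (scale (fst (snd x))), fst (snd (snd x)))"

definition steiner :: "est_input \<Rightarrow> bool" where
  "steiner x \<longleftrightarrow> filter (\<lambda>st. spans st (snd (snd (snd x)) * snd (scale (fst (snd x)))))
     (explore (fst x) (initial_state x)) \<noteq> []"


subsection \<open>Running time\<close>

text \<open>Bit lengths and the number of edges are controlled separately: during elimination the
  former grow by at most one per processed vertex, the latter never grows, and together they bound
  the encoding.\<close>

definition bits_bound :: "nat \<Rightarrow> wedge list \<Rightarrow> bool" where
  "bits_bound M E \<longleftrightarrow>
     (\<forall>e\<in>set E. nbits (fst e) \<le> M \<and> nbits (fst (snd e)) \<le> M \<and> nbits (snd (snd e)) \<le> M)"

lemma bits_bound_mono: "bits_bound M E \<Longrightarrow> M \<le> M' \<Longrightarrow> bits_bound M' E"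
  unfolding bits_bound_def by (meson le_trans)

lemma bits_bound_away: "bits_bound M E \<Longrightarrow> bits_bound M (away v E)"
  unfolding bits_bound_def away_def by auto

lemma bits_bound_inc:
  "bits_bound M E \<Longrightarrow> e \<in> set (inc v E) \<Longrightarrow> nbits (fst e) \<le> M \<and> nbits (snd e) \<le> M"
  unfolding bits_bound_def inc_def by auto

lemma length_away_inc: "length (away v E) + length (inc v E) \<le> length E"
  unfolding away_def inc_def by (induction E) auto

lemma bits_bound_esize: "bits_bound (esize E) E"
  unfolding bits_bound_def
proof
  fix e assume "e \<in> set E"
  then have "esize e \<le> esize E" using esize_mem[of e E] by simp
  then show "nbits (fst e) \<le> esize E \<and> nbits (fst (snd e)) \<le> esize E \<and> nbits (snd (snd e)) \<le> esize E"
    using nbits_le_esize[of "fst e"] nbits_le_esize[of "fst (snd e)"] nbits_le_esize[of "snd (snd e)"]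
    by (simp add: enc_pair[of e] enc_pair[of "snd e"])
qed

lemma esize_wedges_le:
  assumes "bits_bound M E" "length E \<le> m"
  shows "esize E \<le> m * (6 * M + 3)"
proof -
  have "\<forall>e\<in>set E. esize e \<le> 6 * M + 2"
  proof
    fix e assume "e \<in> set E"
    then show "esize e \<le> 6 * M + 2"
      using assms(1) esize_le_nbits[of "fst e"] esize_le_nbits[of "fst (snd e)"]
        esize_le_nbits[of "snd (snd e)"]
      by (force simp add: bits_bound_def enc_pair[of e] enc_pair[of "snd e"])
  qed
  from esize_list_le[OF this] have "esize E \<le> length E * (6 * M + 3)" by (simp add: algebra_simps)
  also have "\<dots> \<le> m * (6 * M + 3)" using assms(2) by (rule mult_le_mono1)
  finally show ?thesis .
qed

lemma ptime_comp2:
  "ptime (\<lambda>z. F (fst z) (snd z)) \<Longrightarrow> ptime_on S f \<Longrightarrow> ptime_on S g \<Longrightarrow> ptime_on S (\<lambda>x. F (f x) (g x))"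
  by (drule ptime_comp[OF _ ptime_Pair]) simp_all

lemma ptime_away [pt_intros]:
  "ptime_on S f \<Longrightarrow> ptime_on S g \<Longrightarrow> ptime_on S (\<lambda>x. away (f x) (g x))"
  by (rule ptime_comp2[of away], unfold away_def) (rule pt_intros | assumption)+

lemma ptime_inc [pt_intros]:
  "ptime_on S f \<Longrightarrow> ptime_on S g \<Longrightarrow> ptime_on S (\<lambda>x. inc (f x) (g x))"
  by (rule ptime_comp2[of inc], unfold inc_def) (rule pt_intros | assumption)+

lemma ptime_elim [pt_intros]:
  "ptime_on S f \<Longrightarrow> ptime_on S g \<Longrightarrow> ptime_on S (\<lambda>x. elim (f x) (g x))"
  by (rule ptime_comp2[of elim], unfold elim_def) (rule pt_intros | assumption)+

text \<open>The only new number is the sum of two weights in a bypass, at the cost of one bit, and a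
  bypass trades two edges for one.\<close>

lemma elim_bounds:
  assumes "st' \<in> set (elim v st)" "bits_bound M (fst st)"
  shows "bits_bound (Suc M) (fst st')" "length (fst st') \<le> length (fst st)"
    "esize (snd st') \<le> esize (snd st) + esize v + 1"
proof -
  note bounds = bits_bound_mono[OF assms(2), of "Suc M"] bits_bound_mono[OF bits_bound_away[OF assms(2)], of "Suc M"]
  have len: "length (away v (fst st)) \<le> length (fst st)"
    using length_away_inc[of v "fst st"] by simp
  consider "st' = st" | "st' = (away v (fst st), snd st)" | "st' = (fst st, v # snd st)"
    | a b where "inc v (fst st) = [a, b]"
      "st' = ((fst a, fst b, snd a + snd b) # away v (fst st), snd st)"
    using assms(1) unfolding elim_def
    by (auto split: if_splits list.splits)
  then have "bits_bound (Suc M) (fst st') \<and> length (fst st') \<le> length (fst st) \<and>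
    esize (snd st') \<le> esize (snd st) + esize v + 1"
  proof cases
    case (4 a b)
    have ab: "nbits (fst a) \<le> M" "nbits (snd a) \<le> M" "nbits (fst b) \<le> M" "nbits (snd b) \<le> M"
      using bits_bound_inc[OF assms(2), of _ v] 4(1) by auto
    have "bits_bound (Suc M) (fst st')"
      using bounds(2) ab nbits_add[OF ab(2,4)] unfolding 4(2) bits_bound_def by auto
    then show ?thesis using length_away_inc[of v "fst st"] 4 by simp
  qed (use bounds len in auto)
  then show "bits_bound (Suc M) (fst st')" "length (fst st') \<le> length (fst st)"
    "esize (snd st') \<le> esize (snd st) + esize v + 1" by auto
qed

lemma explore_snoc: "explore (vs @ [v]) st = concat (map (elim v) (explore vs st))"
  by (simp add: explore_def)

lemma explore_bounds:
  assumes "st' \<in> set (explore vs st)" "bits_bound M (fst st)"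
  shows "bits_bound (M + length vs) (fst st') \<and> length (fst st') \<le> length (fst st) \<and>
    esize (snd st') \<le> esize (snd st) + esize vs"
  using assms(1)
proof (induction vs arbitrary: st' rule: rev_induct)
  case Nil
  then show ?case using assms(2) by (simp add: explore_def)
next
  case (snoc v vs)
  then obtain st1 where st1: "st1 \<in> set (explore vs st)" "st' \<in> set (elim v st1)"
    by (auto simp: explore_snoc)
  from snoc.IH[OF st1(1)] elim_bounds[OF st1(2), of "M + length vs"] show ?case by auto
qed

text \<open>Each single state stays small; only the number of states could explode, so its bound
  \<open>L\<close> is left as a hypothesis.\<close>

lemma ptime_explore:
  assumes vs: "ptime_on S vs" and st: "ptime_on S st" and L: "pbounded S esize L"
    and le: "\<And>x i. x \<in> S \<Longrightarrow> length (explore (take i (vs x)) (st x)) \<le> L x"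
  shows "ptime_on S (\<lambda>x. explore (vs x) (st x))"
  unfolding explore_def
proof (rule ptime_foldl')
  let ?q = "\<lambda>x. L x * (esize (fst (st x)) * (6 * (esize (fst (st x)) + esize (vs x)) + 3)
     + esize (snd (st x)) + esize (vs x) + 2)"
  show "pbounded S esize ?q"
    by (rule pb_intros ptime_on_esize pt_intros L vs st)+
  fix x i assume x: "x \<in> S"
  let ?sts = "explore (take i (vs x)) (st x)"
  let ?B = "esize (fst (st x)) * (6 * (esize (fst (st x)) + esize (vs x)) + 3)
     + esize (snd (st x)) + esize (vs x) + 1"
  have "\<forall>st'\<in>set ?sts. esize st' \<le> ?B"
  proof
    fix st' assume "st' \<in> set ?sts"
    note b = explore_bounds[OF this bits_bound_esize]
    have "length (take i (vs x)) \<le> esize (vs x)" using length_le_esize[of "vs x"] by simp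
    then have "bits_bound (esize (fst (st x)) + esize (vs x)) (fst st')"
      using b by (blast intro: bits_bound_mono add_left_mono)
    moreover have "length (fst st') \<le> esize (fst (st x))"
      using b length_le_esize[of "fst (st x)"] by simp
    ultimately have "esize (fst st') \<le> esize (fst (st x)) * (6 * (esize (fst (st x)) + esize (vs x)) + 3)"
      by (rule esize_wedges_le)
    then show "esize st' \<le> ?B" using b esize_take[of i "vs x"] by (simp add: enc_pair[of st'])
  qed
  from esize_list_le[OF this] have "esize ?sts \<le> length ?sts * (?B + 1)" .
  also have "\<dots> \<le> L x * (?B + 1)" by (rule mult_le_mono1) (rule le[OF x])
  finally show "esize (foldl (\<lambda>sts v. concat (map (elim v) sts)) [st x] (take i (vs x))) \<le> ?q x"
    by (simp add: explore_def)
qed (rule pt_intros vs st)+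

lemma ptime_lightest [pt_intros]:
  assumes "ptime_on S f" "ptime_on S g"
  shows "ptime_on S (\<lambda>x. lightest (f x) (g x))"
  unfolding lightest_def
proof (rule ptime_foldl'[where q = "\<lambda>x. esize (f x) + esize (g x)"])
  fix x i
  let ?f = "\<lambda>m e :: nat \<times> nat. if snd e \<le> snd m then e else m"
  have "esize (foldl ?f (f x) (take i (g x))) \<le> esize (f x) + esize (take i (g x))"
    using foldl_measure_le[of esize ?f "\<lambda>e. esize e + 1" "f x" "take i (g x)"]
    by (simp add: esize_list[of "take i (g x)"])
  then show "esize (foldl ?f (f x) (take i (g x))) \<le> esize (f x) + esize (g x)"
    using esize_take[of i "g x"] by simp
qed (rule pt_intros pb_intros assms ptime_on_esize)+

lemma lightest_in: "lightest e es \<in> set (e # es)"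
proof (induction es arbitrary: e)
  case (Cons a es)
  from Cons[of "if snd a \<le> snd e then a else e"] show ?case
    by (auto simp: lightest_def split: if_splits)
qed (simp add: lightest_def)

lemma ptime_contract [pt_intros]:
  "ptime_on S f \<Longrightarrow> ptime_on S g \<Longrightarrow> ptime_on S (\<lambda>x. contract (f x) (g x))"
  by (rule ptime_comp2[of contract], unfold contract_def) (rule pt_intros | assumption)+

text \<open>Contraction renames endpoints to existing ones and copies weights, so \<open>M\<close>
  persists; only the running total gains a bit.\<close>

lemma contract_bounds:
  assumes "bits_bound M (fst (snd a))" "nbits (snd (snd a)) \<le> N" "M \<le> N"
  shows "bits_bound M (fst (snd (contract a v)))"
    "length (fst (snd (contract a v))) \<le> length (fst (snd a))"
    "nbits (snd (snd (contract a v))) \<le> Suc N"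
proof -
  have "bits_bound M (fst (snd (contract a v))) \<and>
    length (fst (snd (contract a v))) \<le> length (fst (snd a)) \<and>
    nbits (snd (snd (contract a v))) \<le> Suc N"
  proof (cases "inc v (fst (snd a))")
    case Nil
    then show ?thesis using assms by (simp add: contract_def)
  next
    case (Cons e es)
    have in1: "nbits (fst f) \<le> M \<and> nbits (snd f) \<le> M" if "f \<in> set (e # es)" for f
      using bits_bound_inc[OF assms(1), of f v] that Cons by simp
    have "bits_bound M (map (\<lambda>f. (fst (lightest e es), f)) (e # es))"
      unfolding bits_bound_def set_map ball_simps fst_conv snd_conv
      using in1 in1[OF lightest_in[of e es]] by blast
    then have "bits_bound M (fst (snd (contract a v)))"
      using bits_bound_away[OF assms(1), of v]
      unfolding bits_bound_def contract_def Cons by (simp add: ball_Un)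
    moreover have "nbits (snd (snd a) + snd (lightest e es)) \<le> Suc N"
      by (rule nbits_add) (use assms in1[OF lightest_in[of e es]] in auto)
    ultimately show ?thesis
      using length_away_inc[of v "fst (snd a)"] by (simp add: contract_def Cons)
  qed
  then show "bits_bound M (fst (snd (contract a v)))"
    "length (fst (snd (contract a v))) \<le> length (fst (snd a))"
    "nbits (snd (snd (contract a v))) \<le> Suc N" by auto
qed

lemma foldl_contract_bounds:
  assumes "bits_bound M E"
  shows "bits_bound M (fst (snd (foldl contract (True, E, 0) rs))) \<and>
    length (fst (snd (foldl contract (True, E, 0) rs))) \<le> length E \<and>
    nbits (snd (snd (foldl contract (True, E, 0) rs))) \<le> M + length rs"
proof (induction rs rule: rev_induct)
  case Nil
  then show ?case using assms by simp
next
  case (snoc r rs)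
  then show ?case
    using contract_bounds[of M "foldl contract (True, E, 0) rs" "M + length rs" r] by auto
qed

lemma ptime_foldl_contract [pt_intros]:
  assumes "ptime_on S f" "ptime_on S g"
  shows "ptime_on S (\<lambda>x. foldl contract (True, f x, 0) (g x))"
proof (rule ptime_foldl')
  let ?q = "\<lambda>x. esize (f x) * (6 * esize (f x) + 3) + 2 * (esize (f x) + esize (g x)) + 3"
  show "pbounded S esize ?q" by (rule pb_intros ptime_on_esize assms)+
  fix x i
  let ?a = "foldl contract (True, f x, 0) (take i (g x))"
  note b = foldl_contract_bounds[OF bits_bound_esize, of "f x" "take i (g x)"]
  have "esize (fst (snd ?a)) \<le> esize (f x) * (6 * esize (f x) + 3)"
    by (rule esize_wedges_le) (use b length_le_esize[of "f x"] in auto)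
  moreover have "esize (snd (snd ?a)) \<le> 2 * (esize (f x) + esize (g x))"
  proof -
    have "length (take i (g x)) \<le> esize (g x)" using length_le_esize[of "g x"] by simp
    then have "nbits (snd (snd ?a)) \<le> esize (f x) + esize (g x)"
      by (intro le_trans[OF conjunct2[OF conjunct2[OF b]]] add_left_mono)
    then have "2 * nbits (snd (snd ?a)) \<le> 2 * (esize (f x) + esize (g x))" by (rule mult_le_mono2)
    then show ?thesis by (rule le_trans[OF esize_le_nbits])
  qed
  ultimately show "esize ?a \<le> ?q x"
    using esize_bool[of "fst ?a"] by (simp add: enc_pair[of ?a] enc_pair[of "snd ?a"])
qed (rule pt_intros assms)+

lemma ptime_spans [pt_intros]:
  "ptime_on S f \<Longrightarrow> ptime_on S g \<Longrightarrow> ptime_on S (\<lambda>x. spans (f x) (g x))"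
  by (rule ptime_comp2[of spans], unfold spans_def) (rule pt_intros | assumption)+

text \<open>The common denominator is the product of all denominators, and a product has at most as
  many bits as its factors together. The summand 1 is the bit of the initial denominator.\<close>

lemma scale_bounds:
  "bits_bound (1 + esize es) (fst (scale es)) \<and> length (fst (scale es)) = length es \<and>
    nbits (snd (scale es)) \<le> 1 + esize es"
proof (induction es rule: rev_induct)
  case Nil
  show ?case using nbits_le[of 1 1] by (simp add: scale_def bits_bound_def)
next
  case (snoc e es)
  have e: "nbits (fst (fst e)) + nbits (snd (fst e)) + nbits (fst (snd e)) + nbits (snd (snd e)) \<le> esize e"
    using nbits_le_esize[of "fst (fst e)"] nbits_le_esize[of "snd (fst e)"]
      nbits_le_esize[of "fst (snd e)"] nbits_le_esize[of "snd (snd e)"]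
    by (simp add: enc_pair[of e] enc_pair[of "snd e"] enc_pair[of "fst e"])
  have sc: "scale (es @ [e]) = scale_step (scale es) e" by (simp add: scale_def)
  have "nbits (fst (snd e) * snd (scale es)) \<le> 1 + esize (es @ [e])"
    using nbits_mult[of "fst (snd e)" "snd (scale es)"] e snoc.IH by simp
  moreover have "nbits (snd (scale es) * snd (snd e)) \<le> 1 + esize (es @ [e])"
    using nbits_mult[of "snd (scale es)" "snd (snd e)"] e snoc.IH by simp
  moreover have "nbits (snd (snd f) * snd (snd e)) \<le> 1 + esize (es @ [e])"
    "nbits (fst f) \<le> 1 + esize (es @ [e])" "nbits (fst (snd f)) \<le> 1 + esize (es @ [e])"
    if "f \<in> set (fst (scale es))" for f
  proof -
    have f: "nbits (fst f) \<le> 1 + esize es" "nbits (fst (snd f)) \<le> 1 + esize es"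
      "nbits (snd (snd f)) \<le> 1 + esize es" using snoc.IH that by (auto simp: bits_bound_def)
    then show "nbits (snd (snd f) * snd (snd e)) \<le> 1 + esize (es @ [e])"
      "nbits (fst f) \<le> 1 + esize (es @ [e])" "nbits (fst (snd f)) \<le> 1 + esize (es @ [e])"
      using nbits_mult[of "snd (snd f)" "snd (snd e)"] e by simp_all
  qed
  ultimately show ?case using e snoc.IH by (auto simp: sc scale_step_def bits_bound_def)
qed

lemma ptime_scale [pt_intros]:
  assumes "ptime_on S f"
  shows "ptime_on S (\<lambda>x. scale (f x))"
  unfolding scale_def
proof (rule ptime_foldl')
  let ?q = "\<lambda>x. esize (f x) * (6 * (1 + esize (f x)) + 3) + 2 * (1 + esize (f x)) + 1"
  show "pbounded S esize ?q" by (rule pb_intros ptime_on_esize assms)+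
  show "ptime (\<lambda>z :: 'a \<times> (wedge list \<times> nat) \<times> (nat \<times> nat) \<times> (nat \<times> nat).
    scale_step (fst (snd z)) (snd (snd z)))"
    unfolding scale_step_def by (rule pt_intros)+
  fix x i
  let ?a = "scale (take i (f x))"
  note b = scale_bounds[of "take i (f x)"]
  have le: "esize (take i (f x)) \<le> esize (f x)" by (rule esize_take)
  have "esize (fst ?a) \<le> esize (f x) * (6 * (1 + esize (f x)) + 3)"
    by (rule esize_wedges_le[OF bits_bound_mono]) (use b le length_le_esize[of "f x"] in auto)
  moreover have "esize (snd ?a) \<le> 2 * (1 + esize (f x))"
    using esize_le_nbits[of "snd ?a"] b le by simp
  ultimately show "esize (foldl scale_step ([], 1) (take i (f x))) \<le> ?q x"
    unfolding scale_def[symmetric] by (simp add: enc_pair[of ?a])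
qed (rule pt_intros assms)+

lemma ptime_steiner:
  assumes L: "pbounded S esize L"
    and le: "\<And>x i. x \<in> S \<Longrightarrow> length (explore (take i (fst x)) (initial_state x)) \<le> L x"
  shows "ptime_on S steiner"
proof -
  have ex: "ptime_on S (\<lambda>x. explore (fst x) (initial_state x))"
    by (rule ptime_explore[OF _ _ L le]) (unfold initial_state_def, (rule pt_intros)+)
  show ?thesis unfolding steiner_def by (rule pt_intros ex)+
qed


section \<open>Correctness of the algorithm\<close>

subsection \<open>Connecting sets of terminals\<close>

definition adj :: "'a set set \<Rightarrow> ('a \<times> 'a) set" where
  "adj A = {(x, y). {x, y} \<in> A}"

definition linked :: "'a set set \<Rightarrow> 'a set \<Rightarrow> bool" where
  "linked A R \<longleftrightarrow> (\<forall>x\<in>R. \<forall>y\<in>R. (x, y) \<in> (adj A)\<^sup>*)"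

text \<open>Connecting edge sets take the place of trees, which keeps the reductions local, and a
  budget takes the place of an optimum, so that no minimum has to be handled. Multisets allow
  parallel edges of equal weight.\<close>

definition feas :: "('a set \<times> nat) multiset \<Rightarrow> 'a set \<Rightarrow> nat \<Rightarrow> bool" where
  "feas M R k \<longleftrightarrow> (\<exists>F. F \<subseteq># M \<and> linked (fst ` set_mset F) R \<and> (\<Sum>e\<in>#F. snd e) \<le> k)"

lemma adj_iff: "(x, y) \<in> adj A \<longleftrightarrow> {x, y} \<in> A"
  by (simp add: adj_def)

lemma adj_sym: "(x, y) \<in> (adj A)\<^sup>* \<Longrightarrow> (y, x) \<in> (adj A)\<^sup>*"
  by (rule symD[OF sym_rtrancl]) (auto simp: sym_def adj_def insert_commute)

text \<open>If every edge is mapped to a walk, then walks are mapped to walks. Most reductions below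
  transfer connectivity in this way, \<open>g\<close> being the identity or a map that moves a
  single vertex.\<close>

lemma rtrancl_hom:
  assumes "(a, b) \<in> r\<^sup>*" "\<And>x y. (x, y) \<in> r \<Longrightarrow> (g x, g y) \<in> s\<^sup>*"
  shows "(g a, g b) \<in> s\<^sup>*"
  using assms(1)
proof induction
  case (step y z)
  from step.IH assms(2)[OF step.hyps(2)] show ?case by (rule rtrancl_trans)
qed simp

lemma linked_hom:
  assumes "linked A R" "\<And>x y. {x, y} \<in> A \<Longrightarrow> (g x, g y) \<in> (adj A')\<^sup>*"
  shows "linked A' (g ` R)"
  unfolding linked_def
proof (intro ballI)
  fix x' y' assume "x' \<in> g ` R" "y' \<in> g ` R"
  then obtain x y where xy: "x' = g x" "y' = g y" "x \<in> R" "y \<in> R" by auto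
  then have "(x, y) \<in> (adj A)\<^sup>*" using assms(1) by (simp add: linked_def)
  then have "(g x, g y) \<in> (adj A')\<^sup>*" by (rule rtrancl_hom) (auto simp: adj_iff assms(2))
  then show "(x', y') \<in> (adj A')\<^sup>*" using xy by simp
qed

lemma linked_mono: "linked A R \<Longrightarrow> A \<subseteq> A' \<Longrightarrow> linked A' R"
proof -
  assume "linked A R" "A \<subseteq> A'"
  moreover from this have "(adj A)\<^sup>* \<subseteq> (adj A')\<^sup>*" by (intro rtrancl_mono) (auto simp: adj_def)
  ultimately show ?thesis unfolding linked_def by blast
qed

lemma linked_subset: "linked A R \<Longrightarrow> R' \<subseteq> R \<Longrightarrow> linked A R'"
  unfolding linked_def by blast

lemma linked_insert:
  assumes "linked A R" "r \<in> R" "(r, v) \<in> (adj A)\<^sup>*"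
  shows "linked A (insert v R)"
proof -
  have 1: "(x, v) \<in> (adj A)\<^sup>*" if "x \<in> R" for x
  proof -
    have "(x, r) \<in> (adj A)\<^sup>*" using assms(1,2) that by (simp add: linked_def)
    then show ?thesis using assms(3) by (rule rtrancl_trans)
  qed
  have "(v, x) \<in> (adj A)\<^sup>*" if "x \<in> R" for x
    by (rule adj_sym[OF 1[OF that]])
  with 1 show ?thesis using assms(1) unfolding linked_def by simp
qed

lemma subseteq_plusE:
  assumes "F \<subseteq># N + J"
  obtains F1 F2 where "F = F1 + F2" "F1 \<subseteq># N" "F2 \<subseteq># J"
proof (rule that)
  show "F = F \<inter># N + (F - N)" by (rule multiset_eqI) simp
  show "F - N \<subseteq># J" using assms by (simp add: subset_eq_diff_conv add.commute)
qed simp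

lemma subseteq_image_msetE:
  assumes "F' \<subseteq># image_mset f M"
  obtains F where "F \<subseteq># M" "F' = image_mset f F"
proof -
  obtain C where "image_mset f M = F' + C" using assms by (metis subset_mset.le_iff_add)
  from image_mset_eq_plusD[OF this] show ?thesis using that by (metis mset_subset_eq_add_left)
qed

lemma feas_mono: "feas M R k \<Longrightarrow> M \<subseteq># M' \<Longrightarrow> k \<le> k' \<Longrightarrow> feas M' R k'"
  unfolding feas_def by (meson le_trans subset_mset.order_trans)

lemma feas_empty [simp]: "feas M {} k"
  unfolding feas_def by (rule exI[of _ "{#}"]) (simp add: linked_def)

lemma feas_singleton [simp]: "feas M {r} k"
  unfolding feas_def by (rule exI[of _ "{#}"]) (simp add: linked_def)

lemma feas_loops:
  assumes "\<forall>e\<in>#L. fst e = {v}"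
  shows "feas (M + L) R k \<longleftrightarrow> feas M R k"
proof
  assume "feas (M + L) R k"
  then obtain F where F: "F \<subseteq># M + L" "linked (fst ` set_mset F) R" "(\<Sum>e\<in>#F. snd e) \<le> k"
    unfolding feas_def by blast
  from F(1) obtain F1 F2 where F12: "F = F1 + F2" "F1 \<subseteq># M" "F2 \<subseteq># L" by (rule subseteq_plusE)
  have "linked (fst ` set_mset F1) ((\<lambda>x. x) ` R)"
  proof (rule linked_hom[OF F(2)])
    fix x y assume "{x, y} \<in> fst ` set_mset F"
    then obtain e where e: "e \<in># F" "fst e = {x, y}" by auto
    have "e \<in># F1 \<or> e \<in># F2" using e(1) F12(1) by simp
    then show "(x, y) \<in> (adj (fst ` set_mset F1))\<^sup>*"
    proof
      assume "e \<in># F1"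
      then have "{x, y} \<in> fst ` set_mset F1" using e(2) by (metis imageI)
      then show ?thesis by (simp add: adj_iff r_into_rtrancl)
    next
      assume "e \<in># F2"
      then have "{x, y} = {v}" using mset_subset_eqD[OF F12(3)] assms e(2) by metis
      then show ?thesis by (simp add: doubleton_eq_iff)
    qed
  qed
  then show "feas M R k" using F F12 unfolding feas_def by (intro exI[of _ F1]) auto
next
  assume "feas M R k"
  then show "feas (M + L) R k" by (rule feas_mono) auto
qed

text \<open>Sending \<open>v\<close> to a neighbour contracts the edge between them.\<close>

lemma linked_reroute:
  assumes "linked (A \<union> B) R" "v \<notin> R" "v \<notin> \<Union>A"
    and "\<And>s. s \<in> B \<Longrightarrow> \<exists>y. s = {v, y} \<and> y \<noteq> v \<and> (x, y) \<in> (adj A')\<^sup>*" "A \<subseteq> A'"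
  shows "linked A' R"
proof -
  have "linked A' ((id(v := x)) ` R)"
  proof (rule linked_hom[OF assms(1)])
    fix p q assume "{p, q} \<in> A \<union> B"
    then consider "{p, q} \<in> A" | y where "{p, q} = {v, y}" "y \<noteq> v" "(x, y) \<in> (adj A')\<^sup>*"
      using assms(4)[of "{p, q}"] by blast
    then show "((id(v := x)) p, (id(v := x)) q) \<in> (adj A')\<^sup>*"
    proof cases
      case 1
      then have "p \<noteq> v" "q \<noteq> v" "(p, q) \<in> adj A'" using assms(3,5) by (auto simp: adj_iff)
      then show ?thesis by auto
    next
      case 2
      then have "p = v \<and> q = y \<or> p = y \<and> q = v" by (simp add: doubleton_eq_iff)
      then show ?thesis using 2(2,3) adj_sym[OF 2(3)] by auto
    qed
  qed
  moreover have "(id(v := x)) ` R = R" using assms(2) by (auto simp: image_iff)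
  ultimately show ?thesis by simp
qed

text \<open>Moving the non-terminal \<open>v\<close> onto its only neighbour \<open>x\<close> turns
  a connecting set into one without the pendant edge.\<close>

lemma feas_pendant:
  assumes "v \<notin> R" "v \<notin> \<Union>(fst ` set_mset N)" "x \<noteq> v"
  shows "feas (N + {#({v, x}, w)#}) R k \<longleftrightarrow> feas N R k"
proof
  assume "feas (N + {#({v, x}, w)#}) R k"
  then obtain F where F: "F \<subseteq># N + {#({v, x}, w)#}" "linked (fst ` set_mset F) R" "(\<Sum>e\<in>#F. snd e) \<le> k"
    unfolding feas_def by blast
  from F(1) obtain F1 F2 where F12: "F = F1 + F2" "F1 \<subseteq># N" "F2 \<subseteq># {#({v, x}, w)#}"
    by (rule subseteq_plusE)
  have "linked (fst ` set_mset F1) R"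
  proof (rule linked_reroute)
    show "linked (fst ` set_mset F1 \<union> fst ` set_mset F2) R" using F(2) F12 by (simp add: image_Un)
    show "v \<notin> \<Union>(fst ` set_mset F1)" using assms(2) set_mset_mono[OF F12(2)] by blast
    fix s assume "s \<in> fst ` set_mset F2"
    then have "s = {v, x}" using set_mset_mono[OF F12(3)] by auto
    then show "\<exists>y. s = {v, y} \<and> y \<noteq> v \<and> (x, y) \<in> (adj (fst ` set_mset F1))\<^sup>*"
      using assms(3) by (intro exI[of _ x]) simp
  qed (use assms in auto)
  then show "feas N R k" using F F12 unfolding feas_def by (intro exI[of _ F1]) auto
next
  assume "feas N R k"
  then show "feas (N + {#({v, x}, w)#}) R k" by (rule feas_mono) auto
qed

lemma subset_eq_single_iff: "F \<subseteq># {#e#} \<longleftrightarrow> F = {#} \<or> F = {#e#}"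
proof
  assume "F \<subseteq># {#e#}"
  show "F = {#} \<or> F = {#e#}"
  proof (cases "e \<in># F")
    case True
    then have "{#e#} \<subseteq># F" by (rule mset_subset_eq_single)
    with \<open>F \<subseteq># {#e#}\<close> show ?thesis by (metis subset_mset.order_antisym)
  next
    case False
    then have "set_mset F = {}" using set_mset_mono[OF \<open>F \<subseteq># {#e#}\<close>] by auto
    then show ?thesis by simp
  qed
next
  assume "F = {#} \<or> F = {#e#}"
  then show "F \<subseteq># {#e#}" by (elim disjE) simp_all
qed

lemma sub_pairE:
  assumes "F \<subseteq># {#e, f#}"
  obtains "F \<subseteq># {#e#}" | "F \<subseteq># {#f#}" | "F = {#e, f#}"
proof -
  have "F \<subseteq># {#e#} + {#f#}" using assms by (simp add: add_mset_commute)
  then obtain F1 F2 where "F = F1 + F2" "F1 \<subseteq># {#e#}" "F2 \<subseteq># {#f#}"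
    by (rule subseteq_plusE)
  moreover from this(2,3) have "F1 = {#} \<or> F1 = {#e#}" "F2 = {#} \<or> F2 = {#f#}"
    by (auto simp: subset_eq_single_iff)
  ultimately show ?thesis using that by auto
qed

lemma feas_bypass:
  assumes "v \<notin> R" "v \<notin> \<Union>(fst ` set_mset N)" "x \<noteq> v" "y \<noteq> v"
  shows "feas (N + {#({v, x}, a), ({v, y}, b)#}) R k \<longleftrightarrow> feas (N + {#({x, y}, a + b)#}) R k"
proof
  assume "feas (N + {#({v, x}, a), ({v, y}, b)#}) R k"
  then obtain F where F: "F \<subseteq># N + {#({v, x}, a), ({v, y}, b)#}" "linked (fst ` set_mset F) R"
    "(\<Sum>e\<in>#F. snd e) \<le> k"
    unfolding feas_def by blast
  from F(1) obtain F1 F2 where F12: "F = F1 + F2" "F1 \<subseteq># N" "F2 \<subseteq># {#({v, x}, a), ({v, y}, b)#}"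
    by (rule subseteq_plusE)
  from F12(3) show "feas (N + {#({x, y}, a + b)#}) R k"
  proof (cases rule: sub_pairE)
    case 1
    have "F \<subseteq># N + {#({v, x}, a)#}" unfolding F12(1) by (rule subset_mset.add_mono[OF F12(2) 1])
    then have "feas (N + {#({v, x}, a)#}) R k" using F(2,3) unfolding feas_def by (intro exI conjI)
    then have "feas N R k" by (rule iffD1[OF feas_pendant, rotated -1]) (use assms in auto)
    then show ?thesis by (rule feas_mono) auto
  next
    case 2
    have "F \<subseteq># N + {#({v, y}, b)#}" unfolding F12(1) by (rule subset_mset.add_mono[OF F12(2) 2])
    then have "feas (N + {#({v, y}, b)#}) R k" using F(2,3) unfolding feas_def by (intro exI conjI)
    then have "feas N R k" by (rule iffD1[OF feas_pendant, rotated -1]) (use assms in auto)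
    then show ?thesis by (rule feas_mono) auto
  next
    case 3
    let ?F = "F1 + {#({x, y}, a + b)#}"
    have "linked (fst ` set_mset ?F) R"
    proof (rule linked_reroute)
      show "linked (fst ` set_mset F1 \<union> fst ` set_mset F2) R" using F(2) F12 by (simp add: image_Un)
      show "v \<notin> \<Union>(fst ` set_mset F1)" using assms(2) set_mset_mono[OF F12(2)] by blast
      fix s assume "s \<in> fst ` set_mset F2"
      then have "s = {v, x} \<or> s = {v, y}" using 3 by auto
      moreover have "(x, y) \<in> adj (fst ` set_mset ?F)" by (simp add: adj_iff)
      ultimately show "\<exists>z. s = {v, z} \<and> z \<noteq> v \<and> (x, z) \<in> (adj (fst ` set_mset ?F))\<^sup>*"
        using assms(3,4) by blast
    qed (use assms in auto)
    moreover have "?F \<subseteq># N + {#({x, y}, a + b)#}" using F12 by simp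
    moreover have "(\<Sum>e\<in>#?F. snd e) \<le> k" using F(3) F12 3 by simp
    ultimately show ?thesis unfolding feas_def by blast
  qed
next
  assume "feas (N + {#({x, y}, a + b)#}) R k"
  then obtain F where F: "F \<subseteq># N + {#({x, y}, a + b)#}" "linked (fst ` set_mset F) R"
    "(\<Sum>e\<in>#F. snd e) \<le> k"
    unfolding feas_def by blast
  from F(1) obtain F1 F2 where F12: "F = F1 + F2" "F1 \<subseteq># N" "F2 \<subseteq># {#({x, y}, a + b)#}"
    by (rule subseteq_plusE)
  from F12(3) consider "F2 = {#}" | "F2 = {#({x, y}, a + b)#}"
    by (auto simp: subset_eq_single_iff)
  then show "feas (N + {#({v, x}, a), ({v, y}, b)#}) R k"
  proof cases
    case 1
    then have "F \<subseteq># N" using F12 by simp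
    then have "feas N R k" using F(2,3) unfolding feas_def by (intro exI conjI)
    then show ?thesis by (rule feas_mono) auto
  next
    case 2
    let ?F = "F1 + {#({v, x}, a), ({v, y}, b)#}"
    have "linked (fst ` set_mset ?F) ((\<lambda>x. x) ` R)"
    proof (rule linked_hom[OF F(2)])
      fix p q assume "{p, q} \<in> fst ` set_mset F"
      then consider "{p, q} \<in> fst ` set_mset F1" | "{p, q} = {x, y}" using 2 F12 by auto
      then show "(p, q) \<in> (adj (fst ` set_mset ?F))\<^sup>*"
      proof cases
        case 1
        then have "(p, q) \<in> adj (fst ` set_mset ?F)" by (auto simp: adj_iff)
        then show ?thesis by (rule r_into_rtrancl)
      next
        case 2
        have "(x, v) \<in> adj (fst ` set_mset ?F)" "(v, y) \<in> adj (fst ` set_mset ?F)"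
          by (auto simp: adj_iff insert_commute)
        then have "(x, y) \<in> (adj (fst ` set_mset ?F))\<^sup>*" by auto
        with 2 show ?thesis by (auto simp: doubleton_eq_iff intro: adj_sym)
      qed
    qed
    moreover have "?F \<subseteq># N + {#({v, x}, a), ({v, y}, b)#}" using F12 by simp
    moreover have "(\<Sum>e\<in>#?F. snd e) \<le> k" using F(3) F12 2 by simp
    ultimately show ?thesis unfolding feas_def image_ident by (intro exI conjI)
  qed
qed

text \<open>If some terminal reaches \<open>v\<close> in the solution, then \<open>v\<close> may be
  declared a terminal at no cost. Otherwise no walk from a terminal meets \<open>v\<close>, and the
  edges at \<open>v\<close> can be discarded.\<close>

lemma feas_branch:
  assumes "\<forall>e\<in>#J. v \<in> fst e"
  shows "feas (N + J) R k \<longleftrightarrow> feas N R k \<or> feas (N + J) (insert v R) k"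
proof
  assume "feas (N + J) R k"
  then obtain F where F: "F \<subseteq># N + J" "linked (fst ` set_mset F) R" "(\<Sum>e\<in>#F. snd e) \<le> k"
    unfolding feas_def by blast
  show "feas N R k \<or> feas (N + J) (insert v R) k"
  proof (cases "\<exists>r\<in>R. (r, v) \<in> (adj (fst ` set_mset F))\<^sup>*")
    case True
    then have "linked (fst ` set_mset F) (insert v R)" using linked_insert[OF F(2)] by blast
    then show ?thesis using F unfolding feas_def by blast
  next
    case False
    from F(1) obtain F1 F2 where F12: "F = F1 + F2" "F1 \<subseteq># N" "F2 \<subseteq># J" by (rule subseteq_plusE)
    have "(r, y) \<in> (adj (fst ` set_mset F1))\<^sup>*"
      if "(r, y) \<in> (adj (fst ` set_mset F))\<^sup>*" "r \<in> R" for r y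
      using that(1)
    proof induction
      case (step y z)
      have "(r, z) \<in> (adj (fst ` set_mset F))\<^sup>*" using step by auto
      then have "v \<notin> {y, z}" using step that(2) False by blast
      obtain e where e: "e \<in># F" "fst e = {y, z}" using step(2) by (auto simp: adj_iff)
      then have "e \<notin># F2" using \<open>v \<notin> {y, z}\<close> assms set_mset_mono[OF F12(3)] by auto
      then have "e \<in># F1" using e(1) F12(1) by simp
      then have "(y, z) \<in> adj (fst ` set_mset F1)" using e(2) by (metis adj_iff imageI)
      with step.IH show ?case by (rule rtrancl_into_rtrancl)
    qed simp
    then have "linked (fst ` set_mset F1) R" using F(2) unfolding linked_def by blast
    then have "feas N R k" using F F12 unfolding feas_def by (intro exI[of _ F1]) auto
    then show ?thesis ..
  qed
next
  assume "feas N R k \<or> feas (N + J) (insert v R) k"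
  then show "feas (N + J) R k"
  proof
    assume "feas N R k"
    then show ?thesis by (rule feas_mono) auto
  next
    assume "feas (N + J) (insert v R) k"
    then obtain F where "F \<subseteq># N + J" "linked (fst ` set_mset F) (insert v R)" "(\<Sum>e\<in>#F. snd e) \<le> k"
      unfolding feas_def by blast
    moreover from this(2) have "linked (fst ` set_mset F) R" by (rule linked_subset) auto
    ultimately show ?thesis unfolding feas_def by blast
  qed
qed

text \<open>After its last visit to \<open>v\<close> the walk leaves by some edge
  \<open>{v, z}\<close> and avoids \<open>v\<close> from then on. The induction runs backwards from
  the end of the walk.\<close>

lemma first_step:
  assumes "(v, x) \<in> (adj A)\<^sup>*" "x \<noteq> v"
  shows "\<exists>z. {v, z} \<in> A \<and> z \<noteq> v \<and> (z, x) \<in> (adj {s \<in> A. v \<notin> s})\<^sup>*"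
proof -
  let ?P = "\<exists>z. {v, z} \<in> A \<and> z \<noteq> v \<and> (z, x) \<in> (adj {s \<in> A. v \<notin> s})\<^sup>*"
  have "?P \<or> p \<noteq> v \<and> (p, x) \<in> (adj {s \<in> A. v \<notin> s})\<^sup>*" if "(p, x) \<in> (adj A)\<^sup>*" for p
    using that
  proof (induction rule: converse_rtrancl_induct)
    case base
    then show ?case using assms(2) by simp
  next
    case (step p q)
    show ?case
    proof (cases ?P)
      case False
      with step have q: "q \<noteq> v" "(q, x) \<in> (adj {s \<in> A. v \<notin> s})\<^sup>*" by auto
      have "p \<noteq> v" using False q step(1) by (auto simp: adj_iff)
      then have "(p, q) \<in> adj {s \<in> A. v \<notin> s}" using step(1) q by (auto simp: adj_iff)
      then show ?thesis using q \<open>p \<noteq> v\<close> by (meson converse_rtrancl_into_rtrancl)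
    qed blast
  qed
  with assms show ?thesis by blast
qed

lemma in_diff_count_single_neq: "h \<in># F \<Longrightarrow> h \<noteq> f \<Longrightarrow> h \<in># F - {#f#}"
  by (simp add: in_diff_count)

text \<open>An exchange argument. A solution links \<open>v\<close> to the terminal
  \<open>x\<close>; the edge by which the walk finally leaves \<open>v\<close> weighs at least
  \<open>w\<close>, and from there the walk reaches \<open>x\<close> without \<open>v\<close>. So
  that edge may be given up for \<open>{v, x}\<close>, and the rest still connects after
  \<open>v\<close> is merged into \<open>x\<close>. The hypothesis \<open>two\<close> guarantees
  that edges of the image can be lifted back.\<close>

lemma feas_contract:
  assumes e: "({v, x}, w) \<in># M" and x: "x \<noteq> v" "x \<in> R" "v \<in> R"
    and min: "\<And>s w'. (s, w') \<in># M \<Longrightarrow> v \<in> s \<Longrightarrow> s \<noteq> {v} \<Longrightarrow> w \<le> w'"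
    and two: "\<And>s w'. (s, w') \<in># M \<Longrightarrow> \<exists>p q. s = {p, q}"
  shows "feas M R k \<longleftrightarrow>
    w \<le> k \<and> feas (image_mset (\<lambda>e. ((id(v := x)) ` fst e, snd e)) M) (R - {v}) (k - w)"
    (is "_ \<longleftrightarrow> w \<le> k \<and> feas (image_mset ?g M) _ _")
proof
  assume "feas M R k"
  then obtain F where F: "F \<subseteq># M" "linked (fst ` set_mset F) R" "(\<Sum>e\<in>#F. snd e) \<le> k"
    unfolding feas_def by blast
  have "(v, x) \<in> (adj (fst ` set_mset F))\<^sup>*" using F(2) x by (auto simp: linked_def)
  from first_step[OF this x(1)] obtain z where z: "{v, z} \<in> fst ` set_mset F" "z \<noteq> v"
    "(z, x) \<in> (adj {s \<in> fst ` set_mset F. v \<notin> s})\<^sup>*" by blast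
  \<comment> \<open>The edge to be given up: the lightest edge itself if the solution has it,
    otherwise the edge to \<open>z\<close>.\<close>
  define f where "f = (if ({v, x}, w) \<in># F then ({v, x}, w) else (SOME f. f \<in># F \<and> fst f = {v, z}))"
  have "\<exists>f. f \<in># F \<and> fst f = {v, z}" using z(1) by auto
  then have some: "(SOME f. f \<in># F \<and> fst f = {v, z}) \<in># F" "fst (SOME f. f \<in># F \<and> fst f = {v, z}) = {v, z}"
    by (metis (mono_tags, lifting) someI_ex)+
  have f: "f \<in># F" using some by (simp add: f_def)
  have wf: "w \<le> snd f"
  proof (cases "({v, x}, w) \<in># F")
    case False
    then have "fst f = {v, z}" using some by (simp add: f_def)
    moreover have "(fst f, snd f) \<in># M" using f F(1) by (simp add: mset_subset_eqD)
    ultimately show ?thesis using min[of "fst f" "snd f"] z(2) by auto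
  qed (simp add: f_def)
  let ?F = "image_mset ?g (F - {#f#})"
  have F_eq: "F = add_mset f (F - {#f#})" using f by simp
  have "(\<Sum>e\<in>#F. snd e) = snd f + (\<Sum>e\<in>#F - {#f#}. snd e)"
    by (subst F_eq) simp
  then have sum: "(\<Sum>e\<in>#?F. snd e) \<le> k - w" "w \<le> k"
    using F(3) wf by (simp_all add: image_mset.compositionality comp_def)
  have edge: "((id(v := x)) p, (id(v := x)) q) \<in> adj (fst ` set_mset ?F)"
    if "h \<in># F - {#f#}" "fst h = {p, q}" for p q h
  proof -
    have "?g h \<in> set_mset ?F" using that(1) by simp
    then have "fst (?g h) \<in> fst ` set_mset ?F" by (rule imageI)
    then show ?thesis unfolding fst_conv that(2) image_insert image_empty adj_iff .
  qed
  have "linked (fst ` set_mset ?F) ((id(v := x)) ` R)"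
  proof (rule linked_hom[OF F(2)])
    fix p q assume "{p, q} \<in> fst ` set_mset F"
    then obtain h where h: "h \<in># F" "fst h = {p, q}" by auto
    show "((id(v := x)) p, (id(v := x)) q) \<in> (adj (fst ` set_mset ?F))\<^sup>*"
    proof (cases "h = f")
      case False
      then have "h \<in># F - {#f#}" using h by (metis in_diff_count_single_neq)
      then show ?thesis using edge h by blast
    next
      case True
      show ?thesis
      proof (cases "({v, x}, w) \<in># F")
        case True
        then have "{p, q} = {v, x}" using h \<open>h = f\<close> by (simp add: f_def)
        then show ?thesis by (auto simp: doubleton_eq_iff)
      next
        case notin: False
        then have pq: "{p, q} = {v, z}" using h \<open>h = f\<close> some by (simp add: f_def)
        \<comment> \<open>The lost edge would become \<open>{x, z}\<close>. The walk from
          \<open>z\<close> to \<open>x\<close> avoids \<open>v\<close>, so it neither uses the lost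
          edge nor is affected by the renaming, and it serves as a replacement.\<close>
        have "(z, x) \<in> (adj (fst ` set_mset ?F))\<^sup>*"
        proof -
          have "((\<lambda>y. y) z, (\<lambda>y. y) x) \<in> (adj (fst ` set_mset ?F))\<^sup>*"
          proof (rule rtrancl_hom[OF z(3)])
            fix a b assume "(a, b) \<in> adj {s \<in> fst ` set_mset F. v \<notin> s}"
            then obtain h' where h': "h' \<in># F" "fst h' = {a, b}" "a \<noteq> v" "b \<noteq> v"
              by (auto simp: adj_iff)
            then have "h' \<noteq> f" using pq h \<open>h = f\<close> by auto
            then have "h' \<in># F - {#f#}" using h' by (metis in_diff_count_single_neq)
            from edge[OF this h'(2)] h' show "(a, b) \<in> (adj (fst ` set_mset ?F))\<^sup>*" by auto
          qed
          then show ?thesis .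
        qed
        then show ?thesis using pq z(2) by (auto simp: doubleton_eq_iff intro: adj_sym)
      qed
    qed
  qed
  moreover have "R - {v} \<subseteq> (id(v := x)) ` R" by force
  ultimately have "linked (fst ` set_mset ?F) (R - {v})" by (rule linked_subset)
  moreover have "?F \<subseteq># image_mset ?g M"
    using F(1) by (intro image_mset_subseteq_mono) (meson diff_subset_eq_self subset_mset.order_trans)
  ultimately show "w \<le> k \<and> feas (image_mset ?g M) (R - {v}) (k - w)"
    using sum unfolding feas_def by blast
next
  assume *: "w \<le> k \<and> feas (image_mset ?g M) (R - {v}) (k - w)"
  then obtain F' where F': "F' \<subseteq># image_mset ?g M" "linked (fst ` set_mset F') (R - {v})"
    "(\<Sum>e\<in>#F'. snd e) \<le> k - w" unfolding feas_def by blast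
  from F'(1) obtain F where F: "F \<subseteq># M" "F' = image_mset ?g F" by (rule subseteq_image_msetE)
  \<comment> \<open>The multiset union adds the edge only if \<open>F\<close> lacks it; a further
    copy need not be available in \<open>M\<close>.\<close>
  define F0 where "F0 = F \<union># {#({v, x}, w)#}"
  have F0: "F \<subseteq># F0" "({v, x}, w) \<in># F0" "F0 \<subseteq># M"
    using F(1) e by (simp_all add: F0_def)
  have "F0 \<subseteq># F + {#({v, x}, w)#}" by (simp add: F0_def)
  then obtain C where C: "F + {#({v, x}, w)#} = F0 + C" by (metis subset_mset.le_iff_add)
  have "(\<Sum>e\<in>#F0. snd e) \<le> (\<Sum>e\<in>#F + {#({v, x}, w)#}. snd e)" unfolding C by simp
  also have "\<dots> = w + (\<Sum>e\<in>#F. snd e)" by simp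
  also have "\<dots> \<le> w + (k - w)"
    by (rule add_left_mono) (use F'(3) in \<open>simp add: F(2) image_mset.compositionality comp_def\<close>)
  also have "w + (k - w) = k" using conjunct1[OF *] by simp
  finally have sum: "(\<Sum>e\<in>#F0. snd e) \<le> k" .
  let ?A = "adj (fst ` set_mset F0)"
  have "{v, x} \<in> fst ` set_mset F0" using F0(2) by force
  then have vx: "(v, x) \<in> ?A\<^sup>*" by (intro r_into_rtrancl) (simp only: adj_iff)
  have shift: "(p, (id(v := x)) p) \<in> ?A\<^sup>*" for p using vx by simp
  have "linked (fst ` set_mset F0) ((\<lambda>y. y) ` (R - {v}))"
  proof (rule linked_hom[OF F'(2)])
    fix p q assume "{p, q} \<in> fst ` set_mset F'"
    then obtain h where h: "h \<in># F" "(id(v := x)) ` fst h = {p, q}" by (auto simp: F(2))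
    have "(fst h, snd h) \<in># M" using h F(1) by (simp add: mset_subset_eqD)
    then obtain a b where ab: "fst h = {a, b}" using two by blast
    have "{a, b} \<in> fst ` set_mset F0" using mset_subset_eqD[OF F0(1) h(1)] ab by (metis imageI)
    then have 1: "(a, b) \<in> ?A\<^sup>*" by (intro r_into_rtrancl) (simp only: adj_iff)
    have "((id(v := x)) a, (id(v := x)) b) \<in> ?A\<^sup>*"
      by (rule rtrancl_trans[OF adj_sym[OF shift] rtrancl_trans[OF 1 shift]])
    moreover have "{p, q} = {(id(v := x)) a, (id(v := x)) b}" using h(2) ab by auto
    ultimately show "(p, q) \<in> ?A\<^sup>*"
      unfolding doubleton_eq_iff using adj_sym by metis
  qed
  then have "linked (fst ` set_mset F0) (R - {v})" unfolding image_ident .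
  then have "linked (fst ` set_mset F0) (insert v (R - {v}))"
    by (rule linked_insert[OF _ _ adj_sym[OF vx]]) (use x in simp)
  moreover have "insert v (R - {v}) = R" using x by auto
  ultimately show "feas M R k" using sum F0(3) unfolding feas_def by metis
qed

lemma feas_isolated:
  assumes "\<And>s w. (s, w) \<in># M \<Longrightarrow> v \<in> s \<Longrightarrow> s = {v}" "v \<in> R" "r \<in> R" "r \<noteq> v"
  shows "\<not> feas M R k"
proof
  assume "feas M R k"
  then obtain F where F: "F \<subseteq># M" "linked (fst ` set_mset F) R" unfolding feas_def by blast
  then have "(v, r) \<in> (adj (fst ` set_mset F))\<^sup>*" using assms(2,3) by (simp add: linked_def)
  from first_step[OF this assms(4)] obtain z where "{v, z} \<in> fst ` set_mset F" "z \<noteq> v" by blast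
  then obtain w where "({v, z}, w) \<in># F" by auto
  then have "{v, z} = {v}" using assms(1)[of "{v, z}" w] mset_subset_eqD[OF F(1)] by simp
  with \<open>z \<noteq> v\<close> show False by auto
qed


subsection \<open>Eliminating vertices\<close>

definition weighted :: "wedge list \<Rightarrow> (nat set \<times> nat) multiset" where
  "weighted E = image_mset (\<lambda>e. ({fst e, fst (snd e)}, snd (snd e))) (mset E)"

definition ends :: "wedge list \<Rightarrow> nat set" where
  "ends E = (\<Union>e\<in>set E. {fst e, fst (snd e)})"

definition star :: "nat \<Rightarrow> (nat \<times> nat) list \<Rightarrow> (nat set \<times> nat) multiset" where
  "star v I = image_mset (\<lambda>f. ({v, fst f}, snd f)) (mset I)"

definition loops :: "nat \<Rightarrow> wedge list \<Rightarrow> wedge list" where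
  "loops v E = filter (\<lambda>e. fst e = v \<and> fst (snd e) = v) E"

lemma weighted_split:
  "weighted E = weighted (away v E) + star v (inc v E) + weighted (loops v E)"
  by (induction E) (auto simp: weighted_def away_def inc_def loops_def star_def insert_commute)

text \<open>Brings the edges into the form that the reductions expect: those avoiding
  \<open>v\<close>, those from \<open>v\<close> to other vertices, and no loops at
  \<open>v\<close>.\<close>

lemma feas_split:
  "feas (weighted E) R k \<longleftrightarrow> feas (weighted (away v E) + star v (inc v E)) R k"
  unfolding weighted_split[of E v]
  by (rule feas_loops[of _ v]) (auto simp: weighted_def loops_def)

lemma inc_ends: "f \<in> set (inc v E) \<Longrightarrow> fst f \<noteq> v \<and> fst f \<in> ends E"
  by (auto simp: inc_def ends_def intro: bexI[rotated])

lemma away_ends: "ends (away v E) \<subseteq> ends E - {v}"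
  by (auto simp: away_def ends_def)

lemma Union_weighted: "\<Union>(fst ` set_mset (weighted E)) = ends E"
  by (auto simp: weighted_def ends_def)

lemma star_simps: "star v [] = {#}" "star v (f # I) = add_mset ({v, fst f}, snd f) (star v I)"
  by (simp_all add: star_def)

lemma elim_feas:
  "feas (weighted (fst st)) (set (snd st)) k \<longleftrightarrow>
    (\<exists>st'\<in>set (elim v st). feas (weighted (fst st')) (set (snd st')) k)"
proof (cases "v \<in> set (snd st)")
  case True
  then have "elim v st = [st]" by (auto simp: elim_def filter_empty_conv)
  then show ?thesis by simp
next
  case False
  then have no: "filter (\<lambda>x. x = v) (snd st) = []" by (auto simp: filter_empty_conv)
  obtain E R where st: "st = (E, R)" by (cases st)
  have R: "v \<notin> set R" using False st by simp
  have vN: "v \<notin> \<Union>(fst ` set_mset (weighted (away v E)))"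
    unfolding Union_weighted using away_ends by blast
  note split = feas_split[of E "set R" k v]
  consider "inc v E = []" | a where "inc v E = [a]" | a b where "inc v E = [a, b]"
    | a b c I where "inc v E = a # b # c # I" by (metis list.exhaust)
  then show ?thesis
  proof cases
    case 1
    then have "elim v st = [(away v E, R)]" using no st by (simp add: elim_def)
    then show ?thesis using split 1 st by (simp add: star_simps)
  next
    case (2 a)
    then have "elim v st = [(away v E, R)]" using no st by (simp add: elim_def)
    moreover have "fst a \<noteq> v" using inc_ends[of a v E] 2 by simp
    then have "feas (weighted (away v E) + star v (inc v E)) (set R) k \<longleftrightarrow>
        feas (weighted (away v E)) (set R) k"
      using feas_pendant[OF R vN, of "fst a" "snd a" k] 2 by (simp add: star_simps)
    ultimately show ?thesis using split st by simp
  next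
    case (3 a b)
    then have el: "elim v st = [((fst a, fst b, snd a + snd b) # away v E, R)]"
      using no st by (simp add: elim_def)
    have "fst a \<noteq> v" "fst b \<noteq> v" using inc_ends[of _ v E] 3 by auto
    from feas_bypass[OF R vN this, of "snd a" "snd b" k]
    have "feas (weighted (away v E) + star v (inc v E)) (set R) k \<longleftrightarrow>
        feas (weighted ((fst a, fst b, snd a + snd b) # away v E)) (set R) k"
      using 3 by (simp add: star_simps weighted_def)
    then show ?thesis using split st el by simp
  next
    case (4 a b c I)
    then have el: "elim v st = [(away v E, R), (E, v # R)]" using no st by (simp add: elim_def)
    have "\<forall>e\<in>#star v (inc v E). v \<in> fst e" by (auto simp: star_def)
    from feas_branch[OF this, of "weighted (away v E)" "set R" k]
    show ?thesis using split feas_split[of E "insert v (set R)" k v] st el by simp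
  qed
qed

lemma explore_feas:
  "feas (weighted (fst st)) (set (snd st)) k \<longleftrightarrow>
    (\<exists>st'\<in>set (explore vs st). feas (weighted (fst st')) (set (snd st')) k)"
proof (induction vs rule: rev_induct)
  case (snoc v vs)
  have "(\<exists>st'\<in>set (explore vs st). feas (weighted (fst st')) (set (snd st')) k) \<longleftrightarrow>
    (\<exists>st1\<in>set (explore vs st). \<exists>st'\<in>set (elim v st1). feas (weighted (fst st')) (set (snd st')) k)"
    by (rule bex_cong[OF refl]) (rule elim_feas)
  with snoc show ?case by (simp add: explore_snoc)
qed (simp add: explore_def)

text \<open>A processed vertex is a terminal or no longer an endpoint, and this persists because
  later steps create no new endpoints and drop no terminals. When all vertices are processed, only
  edges between terminals remain.\<close>

lemma elim_ends:
  assumes "st' \<in> set (elim v st)" "distinct (snd st)"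
  shows "ends (fst st') \<subseteq> ends (fst st)" "set (snd st) \<subseteq> set (snd st')" "distinct (snd st')"
    "v \<in> ends (fst st') \<Longrightarrow> v \<in> set (snd st')"
proof -
  consider "st' = st" "v \<in> set (snd st)" | "st' = (away v (fst st), snd st)"
    | "st' = (fst st, v # snd st)" "v \<notin> set (snd st)"
    | a b where "inc v (fst st) = [a, b]"
      "st' = ((fst a, fst b, snd a + snd b) # away v (fst st), snd st)"
    using assms(1) unfolding elim_def
    by (auto split: if_splits list.splits simp: filter_empty_conv)
  then have "ends (fst st') \<subseteq> ends (fst st) \<and> set (snd st) \<subseteq> set (snd st') \<and> distinct (snd st') \<and>
    (v \<in> ends (fst st') \<longrightarrow> v \<in> set (snd st'))"
  proof cases
    case (4 a b)
    have "ends (fst st') \<subseteq> insert (fst a) (insert (fst b) (ends (away v (fst st))))"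
      using 4 by (auto simp: ends_def)
    then show ?thesis using 4 inc_ends[of a v "fst st"] inc_ends[of b v "fst st"] away_ends[of v "fst st"]
        assms(2) by auto
  qed (use assms(2) away_ends[of v "fst st"] in auto)
  then show "ends (fst st') \<subseteq> ends (fst st)" "set (snd st) \<subseteq> set (snd st')" "distinct (snd st')"
    "v \<in> ends (fst st') \<Longrightarrow> v \<in> set (snd st')" by auto
qed

lemma explore_ends:
  assumes "st' \<in> set (explore vs st)" "distinct (snd st)"
  shows "ends (fst st') \<subseteq> ends (fst st) \<and> distinct (snd st') \<and> ends (fst st') \<inter> set vs \<subseteq> set (snd st')"
  using assms(1)
proof (induction vs arbitrary: st' rule: rev_induct)
  case Nil
  then show ?case using assms(2) by (simp add: explore_def)
next
  case (snoc v vs)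
  then obtain st1 where st1: "st1 \<in> set (explore vs st)" "st' \<in> set (elim v st1)"
    by (auto simp: explore_snoc)
  from snoc.IH[OF st1(1)] elim_ends[OF st1(2)] show ?case by auto
qed

section \<open>Minimum spanning trees by contraction\<close>

lemma lightest_le: "f \<in> set (e # es) \<Longrightarrow> snd (lightest e es) \<le> snd f"
proof (induction es arbitrary: e f)
  case (Cons a es)
  let ?e = "if snd a \<le> snd e then a else e"
  have "lightest e (a # es) = lightest ?e es" by (simp add: lightest_def)
  moreover have "snd (lightest ?e es) \<le> snd ?e" by (rule Cons.IH) simp
  moreover have "snd ?e \<le> snd a" "snd ?e \<le> snd e" by auto
  moreover have "snd (lightest ?e es) \<le> snd f" if "f \<in> set es" by (rule Cons.IH) (use that in simp)
  ultimately show ?case using Cons.prems by auto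
qed (simp add: lightest_def)

lemma fst_foldl_contract: "fst (foldl contract a rs) \<Longrightarrow> fst a"
proof (induction rs arbitrary: a)
  case (Cons r rs)
  then have "fst (contract a r)" by simp
  then show ?case by (auto simp: contract_def split: list.splits)
qed simp

text \<open>Matches the list operation in \<open>contract\<close> with the renaming in
  \<open>feas_contract\<close>. The contracted edge and its parallels become loops at
  \<open>x\<close>, which stay in the list but are ignored by \<open>inc\<close>.\<close>

lemma weighted_rename:
  assumes "\<forall>f\<in>set I. fst f \<noteq> v"
  shows "image_mset (\<lambda>e. ((id(v := x)) ` fst e, snd e)) (weighted (away v E) + star v I) =
    weighted (away v E @ map (\<lambda>f. (x, f)) I)"
proof -
  have "image_mset (\<lambda>e. ((id(v := x)) ` fst e, snd e)) (weighted (away v E)) = weighted (away v E)"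
    by (induction E) (auto simp: weighted_def away_def)
  moreover have "image_mset (\<lambda>e. ((id(v := x)) ` fst e, snd e)) (star v I) = weighted (map (\<lambda>f. (x, f)) I)"
    using assms by (induction I) (auto simp: weighted_def star_def)
  ultimately show ?thesis by (simp add: weighted_def)
qed

text \<open>As all endpoints are terminals, the neighbour into which \<open>v\<close> is merged is a
  terminal too, as \<open>feas_contract\<close> requires. With \<open>r\<close> alone left, every
  budget suffices. The subtraction is truncated, but \<open>snd (snd a) \<le> k\<close> accompanies
  it.\<close>

lemma foldl_contract_feas:
  assumes "distinct (r # rs)" "ends (fst (snd a)) \<subseteq> set (r # rs)"
  shows "fst (foldl contract a rs) \<and> snd (snd (foldl contract a rs)) \<le> k \<longleftrightarrow>
    fst a \<and> snd (snd a) \<le> k \<and> feas (weighted (fst (snd a))) (set (r # rs)) (k - snd (snd a))"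
  using assms
proof (induction rs arbitrary: a)
  case (Cons v rs)
  obtain ok E tot where a: "a = (ok, E, tot)" by (cases a) auto
  have rv: "r \<noteq> v" "v \<notin> set rs" using Cons.prems by auto
  show ?case
  proof (cases "inc v E")
    case Nil
    then have "contract a v = (False, E, tot)" by (simp add: a contract_def)
    then have "\<not> fst (foldl contract a (v # rs))" using fst_foldl_contract[of "contract a v" rs] by auto
    moreover have "\<not> feas (weighted (away v E) + star v (inc v E)) (set (r # v # rs)) (k - tot)"
    proof (rule feas_isolated[of _ v _ r])
      fix s w assume "(s, w) \<in># weighted (away v E) + star v (inc v E)" "v \<in> s"
      then have "v \<in> \<Union>(fst ` set_mset (weighted (away v E)))" using Nil by (force simp: star_simps)
      then show "s = {v}" unfolding Union_weighted using away_ends by blast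
    qed (use rv in auto)
    ultimately show ?thesis unfolding feas_split[of E _ _ v, symmetric] a by simp
  next
    case (Cons e es)
    define m where "m = lightest e es"
    define E' where "E' = away v E @ map (\<lambda>f. (fst m, f)) (inc v E)"
    have m: "m \<in> set (inc v E)" using lightest_in[of e es] Cons by (simp add: m_def)
    have step: "contract a v = (ok, E', tot + snd m)"
      using Cons by (simp add: contract_def a E'_def m_def)
    have mv: "fst m \<noteq> v" "fst m \<in> set (r # rs)"
      using inc_ends[OF m] Cons.prems(2) a by auto
    have "ends E' \<subseteq> insert (fst m) (ends (away v E) \<union> fst ` set (inc v E))"
      by (auto simp: E'_def ends_def)
    moreover have "ends (away v E) \<subseteq> set (r # rs)" using away_ends[of v E] Cons.prems(2) a by auto
    moreover have "fst ` set (inc v E) \<subseteq> set (r # rs)" using inc_ends[of _ v E] Cons.prems(2) a by fastforce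
    ultimately have ends: "ends E' \<subseteq> set (r # rs)" using mv by blast
    have nv: "\<forall>f\<in>set (inc v E). fst f \<noteq> v" using inc_ends by blast
    have vaway: "v \<notin> s" if "(s, w) \<in># weighted (away v E)" for s w
    proof
      assume "v \<in> s"
      with that have "v \<in> \<Union>(fst ` set_mset (weighted (away v E)))" by force
      then show False unfolding Union_weighted using away_ends by blast
    qed
    have *: "feas (weighted (away v E) + star v (inc v E)) (set (r # v # rs)) (k - tot) \<longleftrightarrow>
      snd m \<le> k - tot \<and> feas (image_mset (\<lambda>e. ((id(v := fst m)) ` fst e, snd e))
        (weighted (away v E) + star v (inc v E))) (set (r # v # rs) - {v}) (k - tot - snd m)"
    proof (rule feas_contract)
      show "({v, fst m}, snd m) \<in># weighted (away v E) + star v (inc v E)"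
        using m by (auto simp: star_def)
    next
      fix s w' assume "(s, w') \<in># weighted (away v E) + star v (inc v E)" "v \<in> s"
      then have "(s, w') \<in># star v (inc v E)" using vaway by auto
      then obtain f where "f \<in> set (inc v E)" "w' = snd f" by (auto simp: star_def)
      then show "snd m \<le> w'" using lightest_le[of f e es] Cons by (simp add: m_def)
    next
      fix s w' assume "(s, w') \<in># weighted (away v E) + star v (inc v E)"
      then show "\<exists>p q. s = {p, q}" by (auto simp: star_def weighted_def)
    qed (use mv in auto)
    have rule: "feas (weighted E) (set (r # v # rs)) (k - tot) \<longleftrightarrow>
      snd m \<le> k - tot \<and> feas (weighted E') (set (r # rs)) (k - (tot + snd m))"
    proof -
      have "set (r # v # rs) - {v} = set (r # rs)" using rv by auto
      with * show ?thesis
        unfolding feas_split[of E _ _ v] weighted_rename[OF nv] E'_def by (simp only: diff_diff_left)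
    qed
    have "fst (foldl contract a (v # rs)) \<and> snd (snd (foldl contract a (v # rs))) \<le> k \<longleftrightarrow>
      ok \<and> tot + snd m \<le> k \<and> feas (weighted E') (set (r # rs)) (k - (tot + snd m))"
      using Cons.IH[of "(ok, E', tot + snd m)"] Cons.prems(1) ends by (simp add: step)
    then show ?thesis using rule unfolding a by auto
  qed
qed simp

lemma spans_iff_feas:
  assumes "distinct (snd st)" "ends (fst st) \<subseteq> set (snd st)"
  shows "spans st k \<longleftrightarrow> feas (weighted (fst st)) (set (snd st)) k"
proof (cases "snd st")
  case (Cons r rs)
  then show ?thesis
    using foldl_contract_feas[of r rs "(True, fst st, 0)" k] assms by (simp add: spans_def)
qed (simp add: spans_def)

lemma steiner_iff_feas:
  assumes "distinct (snd (initial_state x))" "ends (fst (initial_state x)) \<subseteq> set (fst x)"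
  shows "steiner x \<longleftrightarrow> feas (weighted (fst (initial_state x))) (set (snd (initial_state x)))
    (snd (snd (snd x)) * snd (scale (fst (snd x))))"
proof -
  have "spans st k \<longleftrightarrow> feas (weighted (fst st)) (set (snd st)) k"
    if "st \<in> set (explore (fst x) (initial_state x))" for st k
    by (rule spans_iff_feas) (use explore_ends[OF that assms(1)] assms(2) in auto)
  then have "steiner x \<longleftrightarrow> (\<exists>st\<in>set (explore (fst x) (initial_state x)).
    feas (weighted (fst st)) (set (snd st)) (snd (snd (snd x)) * snd (scale (fst (snd x)))))"
    unfolding steiner_def filter_empty_conv by blast
  also have "\<dots> \<longleftrightarrow> feas (weighted (fst (initial_state x))) (set (snd (initial_state x)))
    (snd (snd (snd x)) * snd (scale (fst (snd x))))"
    by (rule explore_feas[symmetric])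
  finally show ?thesis .
qed


subsection \<open>Counting the states\<close>

lemma inc_Cons:
  "length (inc u (e # E)) = length (inc u [e]) + length (inc u E)"
  by (simp add: inc_def)

text \<open>A neighbour bypassed at \<open>v\<close> gains at most one counted edge and loses at
  least one; if both edges lead to the same neighbour, the new edge is a loop and is not counted.
  Hence branching never occurs at a vertex of small initial degree.\<close>

lemma elim_inc:
  assumes "st' \<in> set (elim v st)"
  shows "length (inc u (fst st')) \<le> length (inc u (fst st))"
proof -
  have away: "length (inc u (away v E)) \<le> length (inc u E)" for E
    by (induction E) (auto simp: inc_def away_def)
  consider "fst st' = fst st" | "fst st' = away v (fst st)"
    | a b where "inc v (fst st) = [a, b]"
      "fst st' = (fst a, fst b, snd a + snd b) # away v (fst st)"
    using assms unfolding elim_def by (auto split: if_splits list.splits)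
  then show ?thesis
  proof cases
    case (3 a b)
    have "length (inc u (away v E)) + length (filter (\<lambda>f. fst f = u) (inc v E)) \<le> length (inc u E)"
      if "u \<noteq> v" for E
      using that by (induction E) (auto simp: inc_def away_def)
    from this[of "fst st"] 3 have "u \<noteq> v \<Longrightarrow> ?thesis"
      by (auto simp: inc_Cons[of u _ "away v (fst st)"]) (auto simp: inc_def)
    moreover have "u = v \<Longrightarrow> inc u (fst st') = []"
    proof -
      assume "u = v"
      have "v \<notin> ends (fst st')" using 3(2) inc_ends[of a v "fst st"] inc_ends[of b v "fst st"] 3(1)
          away_ends[of v "fst st"] by (auto simp: ends_def)
      then show ?thesis using \<open>u = v\<close> by (auto simp: inc_def ends_def filter_empty_conv)
    qed
    ultimately show ?thesis by (cases "u = v") auto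
  qed (use away in auto)
qed

lemma explore_inc: "st' \<in> set (explore vs st) \<Longrightarrow> length (inc u (fst st')) \<le> length (inc u (fst st))"
proof (induction vs arbitrary: st' rule: rev_induct)
  case (snoc v vs)
  then show ?case unfolding explore_snoc by (auto dest!: elim_inc[of _ _ _ u] intro: le_trans)
qed (simp add: explore_def)

lemma length_elim:
  "length (elim v st) \<le> (if 3 \<le> length (inc v (fst st)) then 2 else 1)"
  by (auto simp: elim_def Suc_le_eq split: list.splits)

lemma length_explore:
  "length (explore vs st) \<le> 2 ^ length (filter (\<lambda>v. 3 \<le> length (inc v (fst st))) vs)"
proof (induction vs rule: rev_induct)
  case (snoc v vs)
  let ?c = "if 3 \<le> length (inc v (fst st)) then 2 else 1 :: nat"
  have "length (elim v st') \<le> ?c" if "st' \<in> set (explore vs st)" for st'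
    using length_elim[of v st'] explore_inc[OF that, of v] by (auto split: if_splits)
  then have "(\<Sum>st'\<leftarrow>explore vs st. length (elim v st')) \<le> (\<Sum>st'\<leftarrow>explore vs st. ?c)"
    by (intro sum_list_mono)
  also have "\<dots> = length (explore vs st) * ?c" by (simp add: sum_list_triv)
  also have "\<dots> \<le> 2 ^ length (filter (\<lambda>v. 3 \<le> length (inc v (fst st))) vs) * ?c"
    using snoc.IH by (rule mult_le_mono1)
  finally show ?case by (simp add: explore_snoc length_concat comp_def split: if_splits)
qed (simp add: explore_def)


subsection \<open>Steiner trees and connecting edge sets\<close>

lemma connected_graph_iff: "connected_graph G \<longleftrightarrow> verts G \<noteq> {} \<and> linked (edges G) (verts G)"
  by (simp add: connected_graph_def linked_def adj_def)

lemma finite_edges: "simple_graph G \<Longrightarrow> finite (edges G)"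
  by (rule finite_subset[of _ "Pow (verts G)"]) (auto simp: simple_graph_def)

text \<open>Going around the cycle the other way avoids its first edge; length at least 3 makes that
  edge differ from all others.\<close>

lemma cycle_bypass:
  assumes "is_cycle G vs"
  shows "(vs ! 1, vs ! 0) \<in> (adj (edges G - {{vs ! 0, vs ! 1}}))\<^sup>*" "{vs ! 0, vs ! 1} \<in> edges G"
proof -
  let ?A = "adj (edges G - {{vs ! 0, vs ! 1}})"
  have len: "3 \<le> length vs" and d: "distinct vs"
    and e: "\<And>i. i < length vs \<Longrightarrow> {vs ! i, vs ! (Suc i mod length vs)} \<in> edges G"
    using assms by (auto simp: is_cycle_def)
  have neq: "vs ! i = vs ! j \<longleftrightarrow> i = j" if "i < length vs" "j < length vs" for i j
    using d that by (rule nth_eq_iff_index_eq)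
  have path: "(vs ! 1, vs ! Suc i) \<in> ?A\<^sup>*" if "Suc i < length vs" for i
    using that
  proof (induction i)
    case (Suc i)
    have "{vs ! Suc i, vs ! Suc (Suc i)} \<in> edges G" using e[of "Suc i"] Suc.prems by simp
    moreover have "{vs ! Suc i, vs ! Suc (Suc i)} \<noteq> {vs ! 0, vs ! 1}"
      using neq[of "Suc (Suc i)" 0] neq[of "Suc (Suc i)" 1] Suc.prems len
      by (simp add: doubleton_eq_iff flip: length_greater_0_conv)
    ultimately have "(vs ! Suc i, vs ! Suc (Suc i)) \<in> ?A" by (simp add: adj_iff)
    with Suc show ?case by (auto intro: rtrancl_into_rtrancl)
  qed simp
  define l where "l = length vs - 2"
  have l: "Suc (Suc l) = length vs" "1 \<le> l" using len by (simp_all add: l_def)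
  have "{vs ! Suc l, vs ! 0} \<in> edges G" using e[of "Suc l"] l by simp
  moreover have "{vs ! Suc l, vs ! 0} \<noteq> {vs ! 0, vs ! 1}"
    using neq[of "Suc l" 0] neq[of "Suc l" 1] l len by (auto simp: doubleton_eq_iff)
  ultimately have "(vs ! Suc l, vs ! 0) \<in> ?A" by (simp add: adj_iff)
  with path[of l] l show "(vs ! 1, vs ! 0) \<in> ?A\<^sup>*" by (auto intro: rtrancl_into_rtrancl)
  show "{vs ! 0, vs ! 1} \<in> edges G" proof -
    have "0 < length vs" "Suc 0 mod length vs = 1" using len by (linarith, simp)
    from e[OF this(1)] this(2) show ?thesis by simp
  qed
qed

text \<open>Among the edge sets that connect the component \<open>K\<close> of the root, one of
  least cardinality has no cycle, since an edge of a cycle can be dispensed with.\<close>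

lemma spanning_tree:
  assumes G: "simple_graph G" "verts G \<noteq> {}" and A: "A \<subseteq> edges G" "linked A U" and U: "U \<subseteq> verts G"
  shows "\<exists>T. subgraph T G \<and> is_tree T \<and> U \<subseteq> verts T \<and> edges T \<subseteq> A"
proof -
  \<comment> \<open>The root is a terminal if there is one; otherwise any vertex serves, because a
    tree must have a vertex.\<close>
  obtain u0 where u0: "u0 \<in> verts G" "U \<noteq> {} \<Longrightarrow> u0 \<in> U" using G(2) U by blast
  define K where "K = {y. (u0, y) \<in> (adj A)\<^sup>*}"
  define P where "P = (\<lambda>B. B \<subseteq> {e \<in> A. e \<subseteq> K} \<and> (\<forall>y\<in>K. (u0, y) \<in> (adj B)\<^sup>*))"
  have UK: "U \<subseteq> K" using A(2) u0(2) by (auto simp: K_def linked_def)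
  have KG: "K \<subseteq> verts G"
  proof
    fix y assume "y \<in> K"
    then have "(u0, y) \<in> (adj A)\<^sup>*" by (simp add: K_def)
    then show "y \<in> verts G"
    proof induction
      case (step y z)
      then have "{y, z} \<in> edges G" using A(1) by (auto simp: adj_iff)
      then show ?case using G(1) by (auto simp: simple_graph_def)
    qed (rule u0(1))
  qed
  have "(u0, y) \<in> (adj {e \<in> A. e \<subseteq> K})\<^sup>*" if "(u0, y) \<in> (adj A)\<^sup>*" for y
    using that
  proof induction
    case (step y z)
    have "y \<in> K" "z \<in> K" using step.hyps by (auto simp: K_def intro: rtrancl_into_rtrancl)
    then have "(y, z) \<in> adj {e \<in> A. e \<subseteq> K}" using step.hyps(2) by (simp add: adj_iff)
    with step.IH show ?case by (rule rtrancl_into_rtrancl)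
  qed simp
  then have "P {e \<in> A. e \<subseteq> K}" by (simp add: P_def K_def)
  then obtain B where B: "P B" and min: "\<And>B'. P B' \<Longrightarrow> card B \<le> card B'"
    using ex_has_least_nat[of P _ card] by blast
  have BA: "B \<subseteq> A" "\<And>e. e \<in> B \<Longrightarrow> e \<subseteq> K" using B by (auto simp: P_def)
  have finB: "finite B" by (rule finite_subset[OF _ finite_edges[OF G(1)]]) (use BA A in blast)
  have simple: "simple_graph (K, B)"
    using G(1) BA A(1) finite_subset[OF KG] unfolding simple_graph_def by auto
  have "linked B K"
  proof -
    have 1: "(u0, y) \<in> (adj B)\<^sup>*" if "y \<in> K" for y using B that by (simp add: P_def)
    have "(x, y) \<in> (adj B)\<^sup>*" if "x \<in> K" "y \<in> K" for x y
      by (rule rtrancl_trans[OF adj_sym[OF 1[OF that(1)]] 1[OF that(2)]])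
    then show ?thesis by (simp add: linked_def)
  qed
  moreover have "u0 \<in> K" by (simp add: K_def)
  ultimately have conn: "connected_graph (K, B)" unfolding connected_graph_iff by auto
  have "\<not> is_cycle (K, B) vs" for vs
  proof
    assume c: "is_cycle (K, B) vs"
    let ?e = "{vs ! 0, vs ! 1}"
    have bypass: "(vs ! 1, vs ! 0) \<in> (adj (B - {?e}))\<^sup>*" "?e \<in> B" using cycle_bypass[OF c] by simp_all
    have step: "((\<lambda>x. x) p, (\<lambda>x. x) q) \<in> (adj (B - {?e}))\<^sup>*" if "(p, q) \<in> adj B" for p q
    proof (cases "{p, q} = ?e")
      case True
      then show ?thesis using bypass(1) adj_sym[OF bypass(1)] by (auto simp: doubleton_eq_iff)
    next
      case False
      then have "(p, q) \<in> adj (B - {?e})" using that by (simp add: adj_iff)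
      then show ?thesis by blast
    qed
    have "(u0, y) \<in> (adj (B - {?e}))\<^sup>*" if "y \<in> K" for y
    proof -
      have "(u0, y) \<in> (adj B)\<^sup>*" using B that by (simp add: P_def)
      from rtrancl_hom[OF this step] show ?thesis .
    qed
    then have "P (B - {?e})" using B by (auto simp: P_def)
    from min[OF this] have "card B \<le> card (B - {?e})" .
    with card_Diff1_less[OF finB bypass(2)] show False by simp
  qed
  then have "is_tree (K, B)" using simple conn by (simp add: is_tree_def)
  moreover have "subgraph (K, B) G" using simple KG BA(1) A(1) by (simp add: subgraph_def)
  ultimately show ?thesis using UK BA(1) by (intro exI[of _ "(K, B)"]) simp
qed

text \<open>Passing from a connecting set to a tree inside it does not raise the total, as weights
  are positive.\<close>

lemma est_yes_iff:
  assumes G: "simple_graph G" "connected_graph G" and w: "\<forall>e\<in>edges G. w e > 0" and U: "U \<subseteq> verts G"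
  shows "est_yes (G, w, U, k) \<longleftrightarrow> (\<exists>A\<subseteq>edges G. linked A U \<and> (\<Sum>e\<in>A. w e) \<le> of_nat k)"
proof
  assume "est_yes (G, w, U, k)"
  then obtain T where T: "subgraph T G" "is_tree T" "U \<subseteq> verts T" "(\<Sum>e\<in>edges T. w e) \<le> of_nat k"
    by auto
  then have "linked (edges T) (verts T)" by (simp add: is_tree_def connected_graph_iff)
  then have "linked (edges T) U" using T(3) by (rule linked_subset)
  then show "\<exists>A\<subseteq>edges G. linked A U \<and> (\<Sum>e\<in>A. w e) \<le> of_nat k"
    using T by (auto simp: subgraph_def)
next
  assume "\<exists>A\<subseteq>edges G. linked A U \<and> (\<Sum>e\<in>A. w e) \<le> of_nat k"
  then obtain A where A: "A \<subseteq> edges G" "linked A U" "(\<Sum>e\<in>A. w e) \<le> of_nat k" by blast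
  have "verts G \<noteq> {}" using G(2) by (simp add: connected_graph_def)
  from spanning_tree[OF G(1) this A(1,2) U] obtain T
    where T: "subgraph T G" "is_tree T" "U \<subseteq> verts T" "edges T \<subseteq> A" by blast
  have "finite A" by (rule finite_subset[OF A(1) finite_edges[OF G(1)]])
  then have "(\<Sum>e\<in>edges T. w e) \<le> (\<Sum>e\<in>A. w e)"
    by (rule sum_mono2[OF _ T(4)]) (use A(1) w in \<open>auto intro: less_imp_le\<close>)
  then have "(\<Sum>e\<in>edges T. w e) \<le> of_nat k" using A(3) by simp
  then show "est_yes (G, w, U, k)" using T(1-3) unfolding est_yes.simps by (intro exI[of _ T]) simp
qed

lemma feas_mset_set_iff:
  assumes "finite Ed"
  shows "feas (image_mset (\<lambda>e. (e, W e)) (mset_set Ed)) R k \<longleftrightarrow>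
    (\<exists>A\<subseteq>Ed. linked A R \<and> sum W A \<le> k)"
proof
  assume "feas (image_mset (\<lambda>e. (e, W e)) (mset_set Ed)) R k"
  then obtain F where F: "F \<subseteq># image_mset (\<lambda>e. (e, W e)) (mset_set Ed)" "linked (fst ` set_mset F) R"
    "(\<Sum>e\<in>#F. snd e) \<le> k" unfolding feas_def by blast
  from F(1) obtain F0 where F0: "F0 \<subseteq># mset_set Ed" "F = image_mset (\<lambda>e. (e, W e)) F0"
    by (rule subseteq_image_msetE)
  let ?A = "set_mset F0"
  have A: "?A \<subseteq> Ed" using set_mset_mono[OF F0(1)] assms by simp
  \<comment> \<open>Every edge of the input graph has multiplicity one, so submultisets are
    subsets.\<close>
  have "F0 = mset_set ?A"
  proof (rule multiset_eqI)
    fix e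
    have "count F0 e \<le> count (mset_set Ed) e" using F0(1) by (simp add: subseteq_mset_def)
    also have "\<dots> \<le> 1" by (simp add: count_mset_set')
    finally have "count F0 e \<le> 1" .
    show "count F0 e = count (mset_set ?A) e"
    proof (cases "e \<in># F0")
      case True
      then have "0 < count F0 e" by (simp only: count_greater_zero_iff)
      with \<open>count F0 e \<le> 1\<close> have "count F0 e = 1" by linarith
      then show ?thesis using True by (simp add: count_mset_set')
    next
      case False
      then have "count F0 e = 0" by (simp only: not_in_iff)
      then show ?thesis using False by (simp add: count_mset_set')
    qed
  qed
  then have "(\<Sum>e\<in>#F0. W e) = sum W ?A" unfolding sum_unfold_sum_mset by simp
  moreover have "(\<Sum>e\<in>#F. snd e) = (\<Sum>e\<in>#F0. W e)"
    unfolding F0(2) by (simp add: image_mset.compositionality comp_def)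
  moreover have "fst ` set_mset F = ?A" unfolding F0(2) by (simp add: image_image)
  ultimately show "\<exists>A\<subseteq>Ed. linked A R \<and> sum W A \<le> k" using A F(2,3) by (intro exI[of _ ?A]) simp
next
  assume "\<exists>A\<subseteq>Ed. linked A R \<and> sum W A \<le> k"
  then obtain A where A: "A \<subseteq> Ed" "linked A R" "sum W A \<le> k" by blast
  let ?F = "image_mset (\<lambda>e. (e, W e)) (mset_set A)"
  have fin: "finite A" using A(1) assms by (rule finite_subset)
  have "?F \<subseteq># image_mset (\<lambda>e. (e, W e)) (mset_set Ed)"
    by (intro image_mset_subseteq_mono subset_imp_msubset_mset_set A(1) assms)
  moreover have "fst ` set_mset ?F = A" using fin by (simp add: image_image)
  moreover have "(\<Sum>e\<in>#?F. snd e) = sum W A"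
    unfolding sum_unfold_sum_mset by (simp add: image_mset.compositionality comp_def)
  ultimately show "feas (image_mset (\<lambda>e. (e, W e)) (mset_set Ed)) R k"
    using A(2,3) unfolding feas_def by (intro exI[of _ ?F]) simp
qed

text \<open>Divisibility is part of the induction because \<open>div\<close> has to be exact when a
  further denominator is multiplied in. The reversal stems from consing in
  \<open>scale_step\<close>.\<close>

lemma scale_eq:
  assumes "\<forall>e\<in>set es. 0 < snd (snd e)"
  shows "0 < snd (scale es) \<and> (\<forall>e\<in>set es. snd (snd e) dvd snd (scale es)) \<and>
    fst (scale es) = map (\<lambda>e. (fst (fst e), snd (fst e),
      fst (snd e) * (snd (scale es) div snd (snd e)))) (rev es)"
  using assms
proof (induction es rule: rev_induct)
  case (snoc e es)
  then have IH: "0 < snd (scale es)" "\<forall>e\<in>set es. snd (snd e) dvd snd (scale es)"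
    "fst (scale es) = map (\<lambda>e. (fst (fst e), snd (fst e),
      fst (snd e) * (snd (scale es) div snd (snd e)))) (rev es)" by auto
  have sc: "scale (es @ [e]) = scale_step (scale es) e" by (simp add: scale_def)
  show ?case
    using IH(1,2) snoc.prems
    by (auto simp: sc scale_step_def IH(3) dvd_div_mult)
qed (simp add: scale_def)

text \<open>\<open>inc\<close> drops loops whereas the filter counts them, hence the assumption on
  cardinalities.\<close>

lemma length_inc:
  assumes "\<forall>e\<in>#weighted E. card (fst e) = 2"
  shows "length (inc v E) = size (filter_mset (\<lambda>e. v \<in> fst e) (weighted E))"
  using assms
proof (induction E)
  case (Cons e E)
  have "fst e \<noteq> fst (snd e)" using Cons.prems by (auto simp: weighted_def card_2_iff doubleton_eq_iff)
  then show ?case using Cons by (auto simp: weighted_def inc_def)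
qed (simp add: inc_def weighted_def)


section \<open>The graph class\<close>

definition branch_vertices :: "'a graph \<Rightarrow> 'a set" where
  "branch_vertices G = {v \<in> verts G. 3 \<le> card {e \<in> edges G. v \<in> e}}"

definition sparse :: "'a graph \<Rightarrow> bool" where
  "sparse G \<longleftrightarrow> simple_graph G \<and>
     (\<forall>S\<subseteq>verts G. connected_graph (induced_subgraph G S) \<and> 2 \<le> card (S \<inter> branch_vertices G) \<longrightarrow>
       2 ^ card (branch_vertices G) \<le> card S)"

lemma branch_vertices_subset: "branch_vertices G \<subseteq> verts G"
  by (auto simp: branch_vertices_def)

text \<open>The whole vertex set is itself a connected set. With at most one branch vertex the
  condition is void, but then the power is at most 2, which accounts for the summand 2.\<close>

lemma sparse_connected:
  assumes "sparse G" "connected_graph G"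
  shows "2 ^ card (branch_vertices G) \<le> card (verts G) + 2"
proof (cases "2 \<le> card (branch_vertices G)")
  case True
  have "induced_subgraph G (verts G) = G"
    using assms(1) by (auto simp: sparse_def simple_graph_def induced_subgraph_def prod_eq_iff)
  moreover have "verts G \<inter> branch_vertices G = branch_vertices G" using branch_vertices_subset[of G] by blast
  ultimately have "2 ^ card (branch_vertices G) \<le> card (verts G)"
    using assms True by (auto simp: sparse_def)
  then show ?thesis by simp
next
  case False
  then have "card (branch_vertices G) \<le> 1" by simp
  then have "(2 :: nat) ^ card (branch_vertices G) \<le> 2 ^ 1" by (intro power_increasing) auto
  then show ?thesis by simp
qed

section \<open>From encoded inputs to instances\<close>

definition rat_pair :: "rat \<Rightarrow> nat \<times> nat" where
  "rat_pair q = (nat (fst (quotient_of q)), nat (snd (quotient_of q)))"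

lemma rat_pair_pos:
  assumes "q > 0"
  shows "0 < snd (rat_pair q)" "q = of_nat (fst (rat_pair q)) / of_nat (snd (rat_pair q))"
proof -
  obtain a b where ab: "quotient_of q = (a, b)" by (cases "quotient_of q")
  have b: "0 < b" using quotient_of_denom_pos[OF ab] .
  have q: "q = of_int a / of_int b" using quotient_of_div[OF ab] .
  then have "0 \<le> a" using assms b by (simp add: zero_less_divide_iff)
  moreover have "rat_pair q = (nat a, nat b)" by (simp add: rat_pair_def ab)
  ultimately show "0 < snd (rat_pair q)" "q = of_nat (fst (rat_pair q)) / of_nat (snd (rat_pair q))"
    using b by (simp, subst q, simp)
qed

lemma enc_rat_pair: "enc_rat q = enc (rat_pair q)"
  by (simp add: enc_rat_def rat_pair_def enc_nat_inst split: prod.split)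

fun represents :: "est_input \<Rightarrow> est_instance \<Rightarrow> bool" where
  "represents x (G, w, U, k) \<longleftrightarrow>
     (\<exists>vs es us.
        distinct vs \<and> set vs = verts G \<and>
        distinct (map (\<lambda>(u, v). {u, v}) es) \<and> set (map (\<lambda>(u, v). {u, v}) es) = edges G \<and>
        distinct us \<and> set us = U \<and>
        x = (vs, map (\<lambda>(u, v). ((u, v), rat_pair (w {u, v}))) es, us, k))"

lemma est_encodes_represents:
  assumes "est_encodes i d"
  shows "\<exists>x. d = enc x \<and> represents x i"
proof -
  obtain G w U k where i: "i = (G, w, U, k)" by (cases i)
  obtain vs es us where *: "distinct vs" "set vs = verts G"
    "distinct (map (\<lambda>(u, v). {u, v}) es)" "set (map (\<lambda>(u, v). {u, v}) es) = edges G"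
    "distinct us" "set us = U"
    and d: "d = Pair (enc_list enc_nat vs)
             (Pair (enc_list (\<lambda>(u, v). Pair (Pair (enc_nat u) (enc_nat v)) (enc_rat (w {u, v}))) es)
               (Pair (enc_list enc_nat us) (enc_nat k)))"
    using assms unfolding i est_encodes.simps by blast
  let ?x = "(vs, map (\<lambda>(u, v). ((u, v), rat_pair (w {u, v}))) es, us, k)"
  have "enc_list (\<lambda>(u, v). Pair (Pair (enc_nat u) (enc_nat v)) (enc_rat (w {u, v}))) es =
    enc (map (\<lambda>(u, v). ((u, v), rat_pair (w {u, v}))) es)"
    by (induction es) (auto simp: enc_rat_pair enc_nat_inst)
  then have "d = enc ?x" by (simp add: d enc_list_inst enc_nat_inst)
  moreover have "represents ?x i" unfolding i represents.simps using * by blast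
  ultimately show ?thesis by blast
qed

text \<open>The second claim ties the running time to the class: for every prefix of the vertex
  list, at most the original branch vertices have caused branching. The third expresses the number
  of vertices by the input size.\<close>

lemma represents_correct:
  assumes rep: "represents x (G, w, U, k)" and inst: "(G, w, U, k) \<in> est_instances C"
  shows "steiner x \<longleftrightarrow> est_yes (G, w, U, k)"
    "length (explore (take i (fst x)) (initial_state x)) \<le> 2 ^ card (branch_vertices G)"
    "card (verts G) \<le> esize x"
proof -
  have G: "simple_graph G" "connected_graph G" and w: "\<forall>e\<in>edges G. w e > 0" and U: "U \<subseteq> verts G"
    using inst by (auto simp: est_instances_def)
  obtain vs es0 us where vs: "distinct vs" "set vs = verts G"
    and es0: "distinct (map (\<lambda>(u, v). {u, v}) es0)" "set (map (\<lambda>(u, v). {u, v}) es0) = edges G"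
    and us: "distinct us" "set us = U"
    and x: "x = (vs, map (\<lambda>(u, v). ((u, v), rat_pair (w {u, v}))) es0, us, k)"
    using rep unfolding represents.simps by blast
  define es where "es = map (\<lambda>(u, v). ((u, v), rat_pair (w {u, v}))) es0"
  define D where "D = snd (scale es)"
  define W where "W = (\<lambda>e. fst (rat_pair (w e)) * (D div snd (rat_pair (w e))))"
  have es0': "(\<lambda>p. {fst p, snd p}) ` set es0 = edges G"
    using es0(2) by (simp add: case_prod_unfold)
  have es': "es = map (\<lambda>p. ((fst p, snd p), rat_pair (w {fst p, snd p}))) es0"
    by (simp add: es_def case_prod_unfold)
  have pos: "\<forall>e\<in>set es. 0 < snd (snd e)"
  proof
    fix e assume "e \<in> set es"
    then obtain p where p: "p \<in> set es0" "e = ((fst p, snd p), rat_pair (w {fst p, snd p}))"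
      unfolding es' by auto
    have "{fst p, snd p} \<in> edges G" using es0' p(1) by blast
    then show "0 < snd (snd e)" using rat_pair_pos(1)[of "w {fst p, snd p}"] w p(2) by simp
  qed
  note sc = scale_eq[OF pos, folded D_def]
  \<comment> \<open>Every edge is listed exactly once, in one orientation; forgetting the
    orientation yields the edge set without repetitions.\<close>
  have mset: "mset (map (\<lambda>(u, v). {u, v}) es0) = mset_set (edges G)"
    using es0 mset_set_set[OF es0(1)] by simp
  have "weighted (fst (scale es)) = image_mset (\<lambda>e. (e, W e)) (mset (map (\<lambda>(u, v). {u, v}) es0))"
    unfolding conjunct2[OF conjunct2[OF sc]] weighted_def
    unfolding es' by (simp add: W_def rev_map case_prod_unfold image_mset.compositionality comp_def)
  then have weighted: "weighted (fst (scale es)) = image_mset (\<lambda>e. (e, W e)) (mset_set (edges G))"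
    by (simp only: mset)
  have init: "initial_state x = (fst (scale es), us)" by (simp add: initial_state_def x es_def)
  have "ends (fst (scale es)) = \<Union>(edges G)"
    unfolding Union_weighted[symmetric] weighted using finite_edges[OF G(1)] by (simp add: image_image)
  then have ends: "ends (fst (initial_state x)) \<subseteq> set (fst x)"
    unfolding init using G(1) vs(2) by (auto simp: x simple_graph_def)
  have We: "of_nat (W e) = w e * of_nat D" if e: "e \<in> edges G" for e
  proof -
    obtain p where p: "p \<in> set es0" "e = {fst p, snd p}" using es0' e by blast
    then have "((fst p, snd p), rat_pair (w e)) \<in> set es" unfolding es' by simp
    from bspec[OF conjunct1[OF conjunct2[OF sc]] this] have dvd: "snd (rat_pair (w e)) dvd D" by simp
    have "w e > 0" using w e by blast
    note rp = rat_pair_pos[OF this]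
    have "(of_nat (W e) :: rat) =
      of_nat (fst (rat_pair (w e))) / of_nat (snd (rat_pair (w e))) * of_nat D"
      using dvd rp(1) by (auto simp: W_def elim!: dvdE)
    then show ?thesis unfolding rp(2)[symmetric] .
  qed
  have "0 < D" using sc by blast
  have sum: "sum W A \<le> k * D \<longleftrightarrow> sum w A \<le> of_nat k" if A: "A \<subseteq> edges G" for A
  proof -
    have "(of_nat (sum W A) :: rat) = (\<Sum>e\<in>A. w e * of_nat D)"
      unfolding of_nat_sum by (rule sum.cong) (use We A in auto)
    also have "\<dots> = sum w A * of_nat D" by (simp add: sum_distrib_right)
    finally have "(of_nat (sum W A) :: rat) \<le> of_nat (k * D) \<longleftrightarrow> sum w A * of_nat D \<le> of_nat k * of_nat D"
      by simp
    also have "\<dots> \<longleftrightarrow> sum w A \<le> of_nat k" using \<open>0 < D\<close> by simp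
    finally show ?thesis by (simp only: of_nat_le_iff)
  qed
  have "steiner x \<longleftrightarrow> feas (weighted (fst (scale es))) U (k * D)"
  proof -
    have "distinct (snd (initial_state x))" by (simp add: init us)
    moreover have "fst (snd x) = es" "snd (snd (snd x)) = k" by (simp_all add: x es_def)
    ultimately show ?thesis using steiner_iff_feas[OF _ ends] by (simp add: init us D_def)
  qed
  also have "\<dots> \<longleftrightarrow> (\<exists>A\<subseteq>edges G. linked A U \<and> sum W A \<le> k * D)"
    unfolding weighted by (rule feas_mset_set_iff[OF finite_edges[OF G(1)]])
  also have "\<dots> \<longleftrightarrow> est_yes (G, w, U, k)"
    unfolding est_yes_iff[OF G w U] using sum by blast
  finally show "steiner x \<longleftrightarrow> est_yes (G, w, U, k)" .
  have card2: "\<forall>e\<in>#weighted (fst (scale es)). card (fst e) = 2"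
    unfolding weighted using G(1) finite_edges[OF G(1)] by (auto simp: simple_graph_def)
  have deg: "length (inc v (fst (scale es))) = card {e \<in> edges G. v \<in> e}" for v
    unfolding length_inc[OF card2] weighted filter_mset_image_mset
    using finite_edges[OF G(1)] by (simp add: comp_def)
  let ?b = "filter (\<lambda>v. 3 \<le> length (inc v (fst (scale es)))) (take i vs)"
  have "length ?b = card (set ?b)" by (rule distinct_card[symmetric]) (use vs in simp)
  also have "\<dots> \<le> card (branch_vertices G)"
  proof (rule card_mono)
    show "finite (branch_vertices G)"
      by (rule finite_subset[OF branch_vertices_subset]) (use G(1) in \<open>simp add: simple_graph_def\<close>)
    show "set ?b \<subseteq> branch_vertices G"
      using vs(2) deg by (auto simp: branch_vertices_def dest: in_set_takeD)
  qed
  finally have "(2 :: nat) ^ length ?b \<le> 2 ^ card (branch_vertices G)" by (rule power_increasing) simp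
  moreover have "fst x = vs" by (simp add: x)
  ultimately show "length (explore (take i (fst x)) (initial_state x)) \<le> 2 ^ card (branch_vertices G)"
    using le_trans[OF length_explore[of "take i vs" "initial_state x"]] unfolding init fst_conv by metis
  have "card (verts G) = length vs" using distinct_card[OF vs(1)] vs(2) by simp
  also have "\<dots> \<le> esize x" using length_le_esize[of vs] by (simp add: x)
  finally show "card (verts G) \<le> esize x" .
qed

lemma sparse_poly_time: "edge_steiner_tree_in_poly_time {G. sparse G}"
proof -
  let ?I = "est_instances {G. sparse G}"
  define S where "S = {x. \<exists>i\<in>?I. represents x i}"
  have "ptime_on S steiner"
  proof (rule ptime_steiner)
    show "pbounded S esize (\<lambda>x. esize x + 2)" by (rule pb_intros)+
    fix x i assume "x \<in> S"
    then obtain G w U k where inst: "(G, w, U, k) \<in> ?I" and rep: "represents x (G, w, U, k)"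
      unfolding S_def by auto
    have "sparse G" "connected_graph G" using inst by (auto simp: est_instances_def)
    from sparse_connected[OF this] represents_correct(2,3)[OF rep inst]
    show "length (explore (take i (fst x)) (initial_state x)) \<le> esize x + 2"
      by (meson add_right_mono le_trans)
  qed
  then obtain N T c where T: "pbounded S esize T"
    and c: "\<forall>x\<in>S. runs c N (enc x) (T x) (enc (steiner x))"
    unfolding ptime_on_def by blast
  obtain p where p: "\<forall>x\<in>S. T x \<le> poly p (esize x)" using T unfolding pbounded_def by blast
  show ?thesis unfolding edge_steiner_tree_in_poly_time_def decidable_in_poly_time_def
  proof (rule exI[of _ c], rule exI[of _ p], intro ballI allI impI)
    fix i d assume i: "i \<in> ?I" and "est_encodes i d"
    then obtain x where x: "d = enc x" "represents x i" using est_encodes_represents by blast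
    then have "x \<in> S" using i by (auto simp: S_def)
    obtain G w U k where G: "i = (G, w, U, k)" by (cases i)
    have "execb c (initial_store d) (T x) ((initial_store d)(0 := enc (steiner x)))"
      by (rule runsD[OF bspec[OF c \<open>x \<in> S\<close>]]) (auto simp: initial_store_def x)
    then obtain t where t: "t \<le> T x" "exec c (initial_store d) t ((initial_store d)(0 := enc (steiner x)))"
      unfolding execb_def by blast
    have "t \<le> poly p (size d)" using t(1) p \<open>x \<in> S\<close> x(1) by (meson le_trans)
    moreover have "steiner x \<longleftrightarrow> est_yes i"
      using represents_correct(1)[of x G w U k] x(2) i unfolding G by blast
    then have "((initial_store d)(0 := enc (steiner x))) 0 \<noteq> Atom \<longleftrightarrow> est_yes i"
      by (cases "steiner x") auto
    ultimately show "\<exists>t s. exec c (initial_store d) t s \<and> t \<le> poly p (size d) \<and> (s 0 \<noteq> Atom \<longleftrightarrow> est_yes i)"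
      using t(2) by blast
  qed
qed


section \<open>Closure under vertex deletion and isomorphism\<close>

lemma induced_connected_iff:
  assumes "S \<subseteq> verts G"
  shows "connected_graph (induced_subgraph G S) \<longleftrightarrow> S \<noteq> {} \<and> linked {e \<in> edges G. e \<subseteq> S} S"
  using assms by (simp add: connected_graph_iff induced_subgraph_def Int_absorb1)

text \<open>A set avoiding \<open>v\<close> induces the same subgraph before and after the deletion,
  so the old bound applies to it, and it implies the new one, which has no larger exponent.\<close>

lemma hereditary_sparse: "hereditary {G. sparse G}"
  unfolding hereditary_def
proof (intro ballI CollectI)
  fix G :: "nat graph" and v assume "G \<in> {G. sparse G}" and v: "v \<in> verts G"
  then have G: "sparse G" "simple_graph G" by (auto simp: sparse_def)
  let ?H = "delete_vertex G v"
  have V: "verts ?H = verts G - {v}" and E: "edges ?H = {e \<in> edges G. e \<subseteq> verts G - {v}}"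
    by (auto simp: delete_vertex_def induced_subgraph_def)
  have simple: "simple_graph ?H" using G(2) unfolding simple_graph_def V E by auto
  have fin: "finite (branch_vertices G)"
    by (rule finite_subset[OF branch_vertices_subset]) (use G(2) in \<open>simp add: simple_graph_def\<close>)
  have branch: "branch_vertices ?H \<subseteq> branch_vertices G"
  proof
    fix x assume x: "x \<in> branch_vertices ?H"
    have "card {e \<in> edges ?H. x \<in> e} \<le> card {e \<in> edges G. x \<in> e}"
      by (rule card_mono) (use finite_edges[OF G(2)] E in auto)
    then show "x \<in> branch_vertices G" using x by (auto simp: branch_vertices_def V)
  qed
  have "2 ^ card (branch_vertices ?H) \<le> card S"
    if S: "S \<subseteq> verts ?H" "connected_graph (induced_subgraph ?H S)" "2 \<le> card (S \<inter> branch_vertices ?H)" for S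
  proof -
    have SG: "S \<subseteq> verts G" using S(1) V by blast
    have "{e \<in> edges ?H. e \<subseteq> S} = {e \<in> edges G. e \<subseteq> S}" using S(1) V E by auto
    then have "connected_graph (induced_subgraph G S)"
      using S(2) unfolding induced_connected_iff[OF S(1)] induced_connected_iff[OF SG] by simp
    moreover have "card (S \<inter> branch_vertices ?H) \<le> card (S \<inter> branch_vertices G)"
      by (rule card_mono) (use fin branch in auto)
    ultimately have "2 ^ card (branch_vertices G) \<le> card S"
      using G(1) SG S(3) by (auto simp: sparse_def)
    moreover have "(2 :: nat) ^ card (branch_vertices ?H) \<le> 2 ^ card (branch_vertices G)"
      by (rule power_increasing) (use card_mono[OF fin branch] in auto)
    ultimately show ?thesis by (rule le_trans[rotated])
  qed
  then show "sparse ?H" using simple by (simp add: sparse_def)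
qed

text \<open>Degrees are carried over by \<open>f\<close>; connectivity of a set in \<open>H\<close>
  is pulled back along the inverse of \<open>f\<close>.\<close>

lemma sparse_isomorphic:
  assumes G: "sparse G" and H: "simple_graph H" and iso: "isomorphic G H"
  shows "sparse H"
proof -
  obtain f where f: "bij_betw f (verts G) (verts H)" and E: "edges H = (\<lambda>e. f ` e) ` edges G"
    using iso by (auto simp: isomorphic_def)
  have simpG: "simple_graph G" using G by (simp add: sparse_def)
  have inj: "inj_on f (verts G)" and img: "f ` verts G = verts H"
    using f by (auto simp: bij_betw_def)
  have sub: "e \<subseteq> verts G" if "e \<in> edges G" for e using simpG that by (auto simp: simple_graph_def)
  have deg: "card {e \<in> edges H. f v \<in> e} = card {e \<in> edges G. v \<in> e}" if v: "v \<in> verts G" for v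
  proof -
    have "f v \<in> f ` e \<longleftrightarrow> v \<in> e" if "e \<in> edges G" for e
      using inj_on_image_mem_iff[OF inj v sub[OF that]] .
    then have "{e \<in> edges H. f v \<in> e} = (\<lambda>e. f ` e) ` {e \<in> edges G. v \<in> e}" by (auto simp: E)
    moreover have "inj_on (\<lambda>e. f ` e) {e \<in> edges G. v \<in> e}"
      by (rule inj_on_subset[OF inj_on_image_Pow[OF inj]]) (use sub in auto)
    ultimately show ?thesis by (simp add: card_image)
  qed
  have branch: "branch_vertices H = f ` branch_vertices G"
    using deg by (force simp: branch_vertices_def simp flip: img)
  have injb: "inj_on f (branch_vertices G)" by (rule inj_on_subset[OF inj branch_vertices_subset])
  have "2 ^ card (branch_vertices H) \<le> card S"
    if S: "S \<subseteq> verts H" "connected_graph (induced_subgraph H S)" "2 \<le> card (S \<inter> branch_vertices H)" for S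
  proof -
    define g where "g = the_inv_into (verts G) f"
    define S' where "S' = {x \<in> verts G. f x \<in> S}"
    have S': "S' \<subseteq> verts G" "f ` S' = S" using S(1) img by (auto simp: S'_def)
    have gf: "g (f x) = x" if "x \<in> verts G" for x
      using the_inv_into_f_f[OF inj that] by (simp add: g_def)
    have gS: "g ` S = S'" using S' gf by (force simp: image_image subset_iff simp flip: S'(2))
    have "linked {e \<in> edges G. e \<subseteq> S'} (g ` S)"
    proof (rule linked_hom)
      show "linked {e \<in> edges H. e \<subseteq> S} S" using S(2) unfolding induced_connected_iff[OF S(1)] by simp
      fix x y assume "{x, y} \<in> {e \<in> edges H. e \<subseteq> S}"
      then obtain e where e: "e \<in> edges G" "{x, y} = f ` e" "x \<in> S" "y \<in> S" by (auto simp: E)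
      have "g ` f ` e = e" using gf sub[OF e(1)] by (force simp: image_image)
      then have "{g x, g y} = e" using e(2) by (metis image_empty image_insert)
      moreover have "{g x, g y} \<subseteq> S'" using e gS by blast
      ultimately have "(g x, g y) \<in> adj {e \<in> edges G. e \<subseteq> S'}" using e(1) by (simp add: adj_iff)
      then show "(g x, g y) \<in> (adj {e \<in> edges G. e \<subseteq> S'})\<^sup>*" by blast
    qed
    moreover have "S' \<noteq> {}" using S(2) S'(2) unfolding induced_connected_iff[OF S(1)] by auto
    ultimately have "connected_graph (induced_subgraph G S')"
      unfolding induced_connected_iff[OF S'(1)] by (simp add: gS)
    moreover have "S \<inter> branch_vertices H = f ` (S' \<inter> branch_vertices G)"
      unfolding branch S'_def using branch_vertices_subset[of G] by auto
    then have "card (S' \<inter> branch_vertices G) = card (S \<inter> branch_vertices H)"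
      using inj_on_subset[OF injb, of "S' \<inter> branch_vertices G"] by (simp add: card_image)
    ultimately have "2 ^ card (branch_vertices G) \<le> card S'"
      using G S'(1) S(3) by (auto simp: sparse_def)
    moreover have "card S = card S'" using card_image[OF inj_on_subset[OF inj S'(1)]] S'(2) by simp
    ultimately show ?thesis using branch card_image[OF injb] by simp
  qed
  then show ?thesis using H by (simp add: sparse_def)
qed

lemma graph_class_sparse: "graph_class {G. sparse G}"
  unfolding graph_class_def
proof (intro conjI ballI allI impI)
  fix G H :: "nat graph" assume "G \<in> {G. sparse G}" "simple_graph H \<and> isomorphic G H"
  then show "H \<in> {G. sparse G}" using sparse_isomorphic[of G H] by simp
qed (simp add: sparse_def)


subsection \<open>The Helly property of subtrees\<close>

text \<open>The leaf is an end of a longest path: a neighbour off the path would extend it, and one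
  at position 2 or later would close a cycle.\<close>

lemma tree_leaf:
  assumes T: "is_tree T" and x: "x \<in> verts T" "y \<in> verts T" "x \<noteq> y"
  obtains l p where "l \<in> verts T" "p \<in> verts T" "l \<noteq> p" "\<And>q. {l, q} \<in> edges T \<Longrightarrow> q = p"
proof -
  have simple: "simple_graph T" and conn: "linked (edges T) (verts T)" and acyc: "\<And>vs. \<not> is_cycle T vs"
    using T by (auto simp: is_tree_def connected_graph_iff)
  have fin: "finite (verts T)" using simple by (simp add: simple_graph_def)
  define P where "P = (\<lambda>vs. vs \<noteq> [] \<and> distinct vs \<and> set vs \<subseteq> verts T \<and>
    (\<forall>i. Suc i < length vs \<longrightarrow> {vs ! i, vs ! Suc i} \<in> edges T))"
  have "P [x]" using x by (simp add: P_def)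
  moreover have "\<forall>vs. P vs \<longrightarrow> length vs < Suc (card (verts T))"
  proof (intro allI impI)
    fix vs assume "P vs"
    then have "distinct vs" "set vs \<subseteq> verts T" by (simp_all add: P_def)
    then show "length vs < Suc (card (verts T))"
      using card_mono[OF fin, of "set vs"] distinct_card[of vs] by simp
  qed
  ultimately have "\<exists>vs. P vs \<and> (\<forall>ws. P ws \<longrightarrow> length ws \<le> length vs)"
    by (rule Lattices_Big.ex_has_greatest_nat)
  then obtain vs where vs: "P vs" and max: "\<And>ws. P ws \<Longrightarrow> length ws \<le> length vs" by blast
  define l where "l = vs ! 0"
  have l: "l \<in> verts T" using vs by (auto simp: P_def l_def)
  obtain y' where y': "y' \<in> verts T" "y' \<noteq> l" using x by metis
  have "(l, y') \<in> (adj (edges T))\<^sup>*" using conn l y' by (simp add: linked_def)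
  from first_step[OF this y'(2)] obtain p0 where p0: "{l, p0} \<in> edges T" "p0 \<noteq> l" by blast
  have nbr: "q = vs ! 1 \<and> q \<noteq> l \<and> q \<in> verts T" if q: "{l, q} \<in> edges T" for q
  proof -
    have "{l, q} \<subseteq> verts T \<and> card {l, q} = 2" using simple q unfolding simple_graph_def by blast
    then have qT: "q \<in> verts T" "q \<noteq> l" by auto
    have "q \<in> set vs"
    proof (rule ccontr)
      assume "q \<notin> set vs"
      have "{(q # vs) ! i, (q # vs) ! Suc i} \<in> edges T" if "Suc i < length (q # vs)" for i
        using that vs q by (cases i) (simp_all add: P_def l_def insert_commute)
      then have "P (q # vs)" using vs qT \<open>q \<notin> set vs\<close> by (simp add: P_def)
      from max[OF this] show False by simp
    qed
    then obtain j where j: "j < length vs" "q = vs ! j" by (auto simp: in_set_conv_nth)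
    have "j \<noteq> 0" using j qT unfolding l_def by metis
    have "\<not> 2 \<le> j"
    proof
      assume "2 \<le> j"
      have "is_cycle T (take (Suc j) vs)"
        unfolding is_cycle_def
      proof (intro conjI allI impI)
        fix i assume "i < length (take (Suc j) vs)"
        then have i: "i \<le> j" using j by simp
        show "{take (Suc j) vs ! i, take (Suc j) vs ! (Suc i mod length (take (Suc j) vs))} \<in> edges T"
        proof (cases "i = j")
          case True
          then show ?thesis using j q by (simp add: l_def insert_commute)
        next
          case False
          then have "Suc i mod length (take (Suc j) vs) = Suc i" using i j by simp
          then show ?thesis using i j vs False by (simp add: P_def)
        qed
      qed (use j \<open>2 \<le> j\<close> vs in \<open>auto simp: P_def\<close>)
      with acyc show False by blast
    qed
    with \<open>j \<noteq> 0\<close> have "j = 1" by simp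
    then show ?thesis using j qT by simp
  qed
  show ?thesis
  proof (rule that)
    show "l \<in> verts T" by (rule l)
    show "vs ! 1 \<in> verts T" "l \<noteq> vs ! 1" using nbr[OF p0(1)] by auto
    show "\<And>q. {l, q} \<in> edges T \<Longrightarrow> q = vs ! 1" using nbr by blast
  qed
qed

text \<open>Moving \<open>l\<close> onto its only neighbour \<open>p\<close> maps walks inside
  \<open>S\<close> to walks that avoid the leaf.\<close>

lemma linked_delete_leaf:
  assumes linked: "linked {e \<in> E. e \<subseteq> S} S" and leaf: "\<And>q. {l, q} \<in> E \<Longrightarrow> q = p" and S: "l \<noteq> p" "S \<noteq> {l}"
  shows "linked {e \<in> {e \<in> E. l \<notin> e}. e \<subseteq> S - {l}} (S - {l})" "l \<in> S \<Longrightarrow> p \<in> S"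
proof -
  show p: "p \<in> S" if l: "l \<in> S"
  proof -
    obtain s where s: "s \<in> S" "s \<noteq> l" using S l by blast
    then have "(l, s) \<in> (adj {e \<in> E. e \<subseteq> S})\<^sup>*" using linked l by (simp add: linked_def)
    from first_step[OF this s(2)] obtain z where "{l, z} \<in> E" "z \<in> S" by auto
    with leaf show ?thesis by blast
  qed
  let ?A = "{e \<in> {e \<in> E. l \<notin> e}. e \<subseteq> S - {l}}"
  have "linked ?A ((id(l := p)) ` S)"
  proof (rule linked_hom[OF linked])
    fix x y assume xy: "{x, y} \<in> {e \<in> E. e \<subseteq> S}"
    show "((id(l := p)) x, (id(l := p)) y) \<in> (adj ?A)\<^sup>*"
    proof (cases "x = l \<or> y = l")
      case True
      then have "{x, y} = {l, p} \<or> x = y" using xy leaf[of x] leaf[of y] by (auto simp: insert_commute)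
      then have "(id(l := p)) x = (id(l := p)) y" using S(1) by (auto simp: doubleton_eq_iff)
      then show ?thesis by simp
    next
      case False
      then have "(x, y) \<in> adj ?A" using xy by (auto simp: adj_iff)
      with False show ?thesis by auto
    qed
  qed
  then show "linked ?A (S - {l})"
  proof (rule linked_subset)
    show "S - {l} \<subseteq> (id(l := p)) ` S" by force
  qed
qed

text \<open>Induction by removing a leaf \<open>l\<close> with neighbour \<open>p\<close>. Unless
  \<open>{l}\<close> itself belongs to the family, every member containing \<open>l\<close> also
  contains \<open>p\<close>, so members that meet in \<open>l\<close> still meet after its
  removal.\<close>

lemma helly_subtrees:
  assumes "is_tree T"
    and "\<And>S. S \<in> F \<Longrightarrow> S \<subseteq> verts T \<and> linked {e \<in> edges T. e \<subseteq> S} S"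
    and "\<And>S S'. S \<in> F \<Longrightarrow> S' \<in> F \<Longrightarrow> S \<inter> S' \<noteq> {}"
  shows "\<exists>t\<in>verts T. \<forall>S\<in>F. t \<in> S"
  using assms
proof (induction "card (verts T)" arbitrary: T F rule: less_induct)
  case less
  note T = less.prems(1) and F = less.prems(2) and int = less.prems(3)
  have simple: "simple_graph T" and conn: "linked (edges T) (verts T)" and ne: "verts T \<noteq> {}"
    and acyc: "\<And>vs. \<not> is_cycle T vs"
    using T by (auto simp: is_tree_def connected_graph_iff)
  show ?case
  proof (cases "\<exists>x\<in>verts T. \<exists>y\<in>verts T. x \<noteq> y")
    case False
    obtain t where t: "t \<in> verts T" using ne by blast
    have "t \<in> S" if SF: "S \<in> F" for S
    proof -
      obtain s where "s \<in> S" using int[OF SF SF] by blast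
      moreover from this have "s = t" using F[OF SF] False t by blast
      ultimately show ?thesis by simp
    qed
    then show ?thesis using t by blast
  next
    case True
    then obtain l p where l: "l \<in> verts T" "p \<in> verts T" "l \<noteq> p"
      and leaf: "\<And>q. {l, q} \<in> edges T \<Longrightarrow> q = p" using tree_leaf[OF T] by metis
    show ?thesis
    proof (cases "{l} \<in> F")
      case True
      then have "l \<in> S" if "S \<in> F" for S using int[OF True that] by blast
      then show ?thesis using l(1) by blast
    next
      case False
      let ?T = "(verts T - {l}, {e \<in> edges T. l \<notin> e})"
      let ?F = "(\<lambda>S. S - {l}) ` F"
      have delete: "linked {e \<in> {e \<in> edges T. l \<notin> e}. e \<subseteq> S - {l}} (S - {l})" "l \<in> S \<Longrightarrow> p \<in> S"
        if "S \<in> F" for S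
        by (rule linked_delete_leaf[OF conjunct2[OF F[OF that]] leaf l(3)]; use False that in blast)+
      have inT: "e \<subseteq> verts T" if "e \<in> edges T" for e using simple that by (auto simp: simple_graph_def)
      have "linked {e \<in> edges T. e \<subseteq> verts T} (verts T)"
        using conn inT by (metis (mono_tags, lifting) linked_mono mem_Collect_eq subsetI)
      then have "linked {e \<in> {e \<in> edges T. l \<notin> e}. e \<subseteq> verts T - {l}} (verts T - {l})"
        by (rule linked_delete_leaf(1)[OF _ _ l(3)]) (use leaf l in auto)
      then have "linked {e \<in> edges T. l \<notin> e} (verts T - {l})" by (rule linked_mono) auto
      then have "connected_graph ?T" unfolding connected_graph_iff using l by auto
      moreover have "simple_graph ?T" using simple by (auto simp: simple_graph_def)
      moreover have "\<not> is_cycle ?T vs" for vs using acyc[of vs] by (auto simp: is_cycle_def)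
      ultimately have tree: "is_tree ?T" by (simp add: is_tree_def)
      have "\<exists>t\<in>verts ?T. \<forall>S\<in>?F. t \<in> S"
      proof (rule less.hyps[OF _ tree])
        show "card (verts ?T) < card (verts T)"
          using card_Diff1_less[of "verts T" l] l(1) simple by (simp add: simple_graph_def)
      next
        fix S assume "S \<in> ?F"
        then obtain S0 where "S0 \<in> F" "S = S0 - {l}" by blast
        then show "S \<subseteq> verts ?T \<and> linked {e \<in> edges ?T. e \<subseteq> S} S" using F delete(1)[of S0] by auto
      next
        fix S S' assume "S \<in> ?F" "S' \<in> ?F"
        then obtain S0 S0' where S: "S0 \<in> F" "S = S0 - {l}" "S0' \<in> F" "S' = S0' - {l}" by blast
        then obtain t where t: "t \<in> S0" "t \<in> S0'" using int by blast
        show "S \<inter> S' \<noteq> {}"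
        proof (cases "t = l")
          case True
          then have "p \<in> S0 \<inter> S0'" using t S delete(2) by blast
          then show ?thesis using S l(3) by blast
        qed (use t S in blast)
      qed
      then show ?thesis by auto
    qed
  qed
qed


subsection \<open>Subdivided complete graphs\<close>

text \<open>The vertices are the numbers \<open>code a a 0\<close> for \<open>a < n\<close>, and \<open>code a b i\<close> for the \<open>i\<close>-th interior
  vertex of the path of length \<open>L\<close> that replaces the edge between \<open>a < b\<close>.\<close>

definition code :: "nat \<Rightarrow> nat \<Rightarrow> nat \<Rightarrow> nat" where
  "code a b i = prod_encode (a, prod_encode (b, i))"

definition on_path :: "nat \<Rightarrow> nat \<Rightarrow> nat \<Rightarrow> nat \<Rightarrow> nat" where
  "on_path L a b i = (if i = 0 then code a a 0 else if i = L then code b b 0 else code a b i)"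

definition subdivided :: "nat \<Rightarrow> nat \<Rightarrow> nat graph" where
  "subdivided n L =
     ({code a a 0 | a. a < n} \<union> {code a b i | a b i. a < b \<and> b < n \<and> 0 < i \<and> i < L},
      {{on_path L a b i, on_path L a b (Suc i)} | a b i. a < b \<and> b < n \<and> i < L})"

text \<open>The interior of the path between \<open>a < b\<close> is credited to \<open>a\<close>,
  so each path leaves its class only on its last edge.\<close>

definition owner :: "nat \<Rightarrow> nat" where
  "owner x = fst (prod_decode x)"

text \<open>The distance from \<open>code u u 0\<close>, capped at \<open>L\<close>.\<close>

definition level :: "nat \<Rightarrow> nat \<Rightarrow> nat \<Rightarrow> nat" where
  "level L u x = (case prod_decode x of (a, y) \<Rightarrow> case prod_decode y of (b, i) \<Rightarrow>
     if a = b then (if a = u then 0 else L) else if a = u then i else if b = u then L - i else L)"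

lemma code_eq [simp]: "code a b i = code a' b' i' \<longleftrightarrow> a = a' \<and> b = b' \<and> i = i'"
  by (auto simp: code_def prod_encode_eq)

lemma owner_code [simp]: "owner (code a b i) = a"
  by (simp add: owner_def code_def)

text \<open>Serves to show that the level changes by at most one along an edge; on paths that do not
  end at the centre of \<open>u\<close> it is constantly \<open>L\<close>.\<close>

lemma level_on_path:
  assumes "a < b" "i \<le> L"
  shows "level L u (on_path L a b i) = (if a = u then i else if b = u then L - i else L)"
  using assms by (auto simp: level_def on_path_def code_def)

lemma on_path_verts: "a < b \<Longrightarrow> b < n \<Longrightarrow> i \<le> L \<Longrightarrow> on_path L a b i \<in> verts (subdivided n L)"
  by (auto simp: on_path_def subdivided_def)

lemma on_path_edges:
  "a < b \<Longrightarrow> b < n \<Longrightarrow> i < L \<Longrightarrow> {on_path L a b i, on_path L a b (Suc i)} \<in> edges (subdivided n L)"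
  unfolding subdivided_def snd_conv by blast

lemma finite_subdivided: "finite (verts (subdivided n L))"
proof -
  have "verts (subdivided n L) \<subseteq> (\<lambda>(a, b, i). code a b i) ` ({..<n} \<times> {..<n} \<times> {..L})"
    by (force simp: subdivided_def image_iff)
  then show ?thesis by (rule finite_subset) simp
qed

lemma simple_subdivided: "simple_graph (subdivided n L)"
  unfolding simple_graph_def
proof (intro conjI ballI)
  fix e assume "e \<in> edges (subdivided n L)"
  then obtain a b i where e: "e = {on_path L a b i, on_path L a b (Suc i)}" and ab: "a < b" "b < n" "i < L"
    by (auto simp: subdivided_def)
  show "e \<subseteq> verts (subdivided n L)" using e ab on_path_verts[of a b n] by simp
  have "on_path L a b i \<noteq> on_path L a b (Suc i)" using ab by (auto simp: on_path_def)
  then show "card e = 2" using e by simp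
qed (rule finite_subdivided)

text \<open>The code of an interior vertex determines its path and its position there, so only two
  edges contain it.\<close>

lemma branch_subdivided: "branch_vertices (subdivided n L) \<subseteq> {code a a 0 | a. a < n}"
proof
  fix x assume x: "x \<in> branch_vertices (subdivided n L)"
  show "x \<in> {code a a 0 | a. a < n}"
  proof (rule ccontr)
    assume "x \<notin> {code a a 0 | a. a < n}"
    then obtain a b i where abi: "x = code a b i" "a < b" "b < n" "0 < i" "i < L"
      using x by (auto simp: branch_vertices_def subdivided_def)
    have on: "on_path L a' b' j = code a b i \<Longrightarrow> a' = a \<and> b' = b \<and> j = i" for a' b' j
      using abi by (auto simp: on_path_def split: if_splits)
    let ?N = "{{on_path L a b (i - 1), on_path L a b i}, {on_path L a b i, on_path L a b (Suc i)}}"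
    have "{e \<in> edges (subdivided n L). x \<in> e} \<subseteq> ?N"
    proof
      fix e assume e: "e \<in> {e \<in> edges (subdivided n L). x \<in> e}"
      then obtain a' b' j where e': "e = {on_path L a' b' j, on_path L a' b' (Suc j)}" "a' < b'"
        by (auto simp: subdivided_def)
      then consider "on_path L a' b' j = code a b i" | "on_path L a' b' (Suc j) = code a b i"
        using e abi(1) by auto
      then show "e \<in> ?N"
      proof cases
        case 1
        then show ?thesis using on[OF 1] e'(1) by simp
      next
        case 2
        then have "a' = a" "b' = b" "Suc j = i" using on[OF 2] by auto
        then show ?thesis using e'(1) by auto
      qed
    qed
    then have "card {e \<in> edges (subdivided n L). x \<in> e} \<le> card ?N" by (rule card_mono[rotated]) simp
    also have "\<dots> \<le> 2" by (rule order_trans[OF card_insert_le_m1]) auto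
    finally show False using x by (simp add: branch_vertices_def)
  qed
qed

text \<open>A discrete intermediate value theorem: along a walk \<open>f\<close> never rises by more
  than one per step, so no value is skipped.\<close>

lemma linked_intermediate:
  fixes f :: "'a \<Rightarrow> nat"
  assumes "linked A S" "u \<in> S" "v \<in> S" "f u = 0" "\<And>e. e \<in> A \<Longrightarrow> e \<subseteq> S"
    and step: "\<And>x y. {x, y} \<in> A \<Longrightarrow> f y \<le> Suc (f x)"
  shows "{..f v} \<subseteq> f ` S"
proof -
  have "(u, v) \<in> (adj A)\<^sup>*" using assms(1-3) by (simp add: linked_def)
  then show ?thesis
  proof induction
    case base
    then show ?case using assms(2,4) by auto
  next
    case (step y z)
    then have yz: "{y, z} \<in> A" by (simp add: adj_iff)
    have "z \<in> S" using assms(5)[OF yz] by simp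
    show ?case
    proof
      fix j assume "j \<in> {..f z}"
      then have "j \<le> f y \<or> j = f z" using assms(6)[OF yz] by auto
      then show "j \<in> f ` S" using step.IH \<open>z \<in> S\<close> by auto
    qed
  qed
qed

text \<open>Between two branch vertices the level climbs from 0 to \<open>L\<close>, so a connected
  set containing both has more than \<open>L\<close> vertices, while there are at most
  \<open>n\<close> branch vertices.\<close>

lemma sparse_subdivided:
  assumes L: "2 ^ n \<le> L"
  shows "sparse (subdivided n L)"
  unfolding sparse_def
proof (intro conjI allI impI simple_subdivided)
  let ?G = "subdivided n L"
  fix S assume S: "S \<subseteq> verts ?G"
    and "connected_graph (induced_subgraph ?G S) \<and> 2 \<le> card (S \<inter> branch_vertices ?G)"
  then have conn: "linked {e \<in> edges ?G. e \<subseteq> S} S" and two: "2 \<le> card (S \<inter> branch_vertices ?G)"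
    unfolding induced_connected_iff[OF S] by auto
  have finS: "finite S" using S finite_subdivided by (rule finite_subset)
  obtain x where x: "x \<in> S \<inter> branch_vertices ?G"
    using two by (metis card.empty ex_in_conv not_numeral_le_zero)
  have "S \<inter> branch_vertices ?G \<noteq> {x}" using two by auto
  then obtain y where y: "y \<in> S \<inter> branch_vertices ?G" "y \<noteq> x" using x by blast
  obtain u v where u: "x = code u u 0" and v: "y = code v v 0" "v \<noteq> u"
    using x y branch_subdivided[of n L] by blast
  have "{..level L u y} \<subseteq> level L u ` S"
  proof (rule linked_intermediate[OF conn])
    fix p q assume "{p, q} \<in> {e \<in> edges ?G. e \<subseteq> S}"
    then obtain a b i where "{p, q} = {on_path L a b i, on_path L a b (Suc i)}" "a < b" "i < L"
      by (auto simp: subdivided_def)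
    then show "level L u q \<le> Suc (level L u p)"
      using level_on_path[of a b i L u] level_on_path[of a b "Suc i" L u]
      by (auto simp: doubleton_eq_iff)
  qed (use x y u in \<open>auto simp: level_def code_def\<close>)
  moreover have "level L u y = L" using v by (simp add: level_def code_def)
  ultimately have "card {..L} \<le> card (level L u ` S)" by (intro card_mono) (use finS in auto)
  also have "\<dots> \<le> card S" by (rule card_image_le[OF finS])
  finally have "L \<le> card S" by simp
  have "branch_vertices ?G \<subseteq> (\<lambda>a. code a a 0) ` {..<n}" using branch_subdivided[of n L] by auto
  then have "card (branch_vertices ?G) \<le> card {..<n}" by (rule surj_card_le[rotated]) simp
  then have "(2 :: nat) ^ card (branch_vertices ?G) \<le> 2 ^ n" by (intro power_increasing) auto
  then show "2 ^ card (branch_vertices ?G) \<le> card S" using L \<open>L \<le> card S\<close> by (meson le_trans)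
qed

text \<open>The sets of vertices with the same owner are the branch sets of a complete minor. Hence the
  sets of tree nodes whose bags meet them are pairwise intersecting subtrees.\<close>

lemma subdivided_bag:
  assumes TD: "tree_decomposition (subdivided n L) T B" and L: "0 < L"
  shows "\<exists>t\<in>verts T. \<forall>a<n. \<exists>x\<in>B t. owner x = a"
proof -
  let ?G = "subdivided n L"
  have tree: "is_tree T" and cover: "(\<Union>t\<in>verts T. B t) = verts ?G"
    and edge: "\<And>e. e \<in> edges ?G \<Longrightarrow> \<exists>t\<in>verts T. e \<subseteq> B t"
    and conn: "\<And>x. x \<in> verts ?G \<Longrightarrow> connected_graph (induced_subgraph T {t \<in> verts T. x \<in> B t})"
    using TD by (auto simp: tree_decomposition_def)
  define S where "S = (\<lambda>a. {t \<in> verts T. \<exists>x\<in>B t. owner x = a})"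
  let ?A = "\<lambda>a. {e \<in> edges T. e \<subseteq> S a}"
  \<comment> \<open>The nodes whose bags contain \<open>x\<close> form a connected set, and all of
    them belong to \<open>S (owner x)\<close>.\<close>
  have bag: "(t, t') \<in> (adj (?A (owner x)))\<^sup>*"
    if x: "x \<in> verts ?G" and t: "t \<in> verts T" "x \<in> B t" "t' \<in> verts T" "x \<in> B t'" for x t t'
  proof -
    let ?T = "{t \<in> verts T. x \<in> B t}"
    have sub: "?T \<subseteq> verts T" by auto
    have "linked {e \<in> edges T. e \<subseteq> ?T} ?T"
      using conn[OF x] unfolding induced_connected_iff[OF sub] by simp
    then have "linked (?A (owner x)) ?T" by (rule linked_mono) (auto simp: S_def)
    then show ?thesis using t by (simp add: linked_def)
  qed
  have centre: "code a a 0 \<in> verts ?G" if "a < n" for a using that by (auto simp: subdivided_def)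
  have linked: "linked (?A a) (S a)" if a: "a < n" for a
  proof -
    obtain t0 where t0: "t0 \<in> verts T" "code a a 0 \<in> B t0" using centre[OF a] cover by blast
    \<comment> \<open>Induction along the path starting at the centre of \<open>a\<close>:
      consecutive vertices share a bag, where the subtree of one is left for that of the
      next.\<close>
    have path: "(t0, t) \<in> (adj (?A a))\<^sup>*"
      if "a < b" "b < n" "i < L" "t \<in> verts T" "on_path L a b i \<in> B t" for b i t
      using that
    proof (induction i arbitrary: t)
      case 0
      then show ?case using bag[OF centre[OF a] t0, of t] by (simp add: on_path_def)
    next
      case (Suc i)
      have "{on_path L a b i, on_path L a b (Suc i)} \<in> edges ?G"
        by (rule on_path_edges) (use Suc.prems in auto)
      from edge[OF this] obtain t' where t': "t' \<in> verts T" "on_path L a b i \<in> B t'"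
        "on_path L a b (Suc i) \<in> B t'" by auto
      have "(t0, t') \<in> (adj (?A a))\<^sup>*" by (rule Suc.IH) (use Suc.prems t' in auto)
      moreover have "owner (on_path L a b (Suc i)) = a" using Suc.prems by (simp add: on_path_def)
      then have "(t', t) \<in> (adj (?A a))\<^sup>*"
        using bag[OF on_path_verts[OF Suc.prems(1,2)] t'(1,3) Suc.prems(4,5)] Suc.prems(3) by simp
      ultimately show ?case by (rule rtrancl_trans)
    qed
    have all: "(t0, t) \<in> (adj (?A a))\<^sup>*" if "t \<in> S a" for t
    proof -
      obtain x where x: "t \<in> verts T" "x \<in> B t" "owner x = a" using \<open>t \<in> S a\<close> by (auto simp: S_def)
      then have "x \<in> verts ?G" using cover by blast
      then consider "x = code a a 0" | b i where "x = code a b i" "a < b" "b < n" "0 < i" "i < L"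
        using x(3) by (auto simp: subdivided_def)
      then show ?thesis
      proof cases
        case 1
        then show ?thesis using bag[OF centre[OF a] t0, of t] x by simp
      next
        case (2 b i)
        then have "x = on_path L a b i" by (simp add: on_path_def)
        then show ?thesis using path[of b i t] 2 x by simp
      qed
    qed
    have "(t, t') \<in> (adj (?A a))\<^sup>*" if "t \<in> S a" "t' \<in> S a" for t t'
      by (rule rtrancl_trans[OF adj_sym[OF all[OF that(1)]] all[OF that(2)]])
    then show ?thesis by (simp add: linked_def)
  qed
  have meet: "S a \<inter> S b \<noteq> {}" if "a < b" "b < n" for a b
  proof -
    \<comment> \<open>The last edge of the path joins a vertex owned by \<open>a\<close> to the
      centre of \<open>b\<close>, so a node whose bag contains it lies in both sets.\<close>
    have "{on_path L a b (L - 1), on_path L a b (Suc (L - 1))} \<in> edges ?G"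
      by (rule on_path_edges) (use that L in auto)
    from edge[OF this] obtain t where "t \<in> verts T" "on_path L a b (L - 1) \<in> B t" "on_path L a b L \<in> B t"
      using L by auto
    moreover have "owner (on_path L a b (L - 1)) = a" "owner (on_path L a b L) = b"
      using L by (auto simp: on_path_def)
    ultimately have "t \<in> S a \<inter> S b" by (auto simp: S_def)
    then show ?thesis by blast
  qed
  have nonempty: "S a \<noteq> {}" if "a < n" for a
    using centre[OF that] cover by (force simp: S_def)
  have "\<exists>t\<in>verts T. \<forall>X\<in>S ` {..<n}. t \<in> X"
  proof (rule helly_subtrees[OF tree])
    fix X assume "X \<in> S ` {..<n}"
    then show "X \<subseteq> verts T \<and> linked {e \<in> edges T. e \<subseteq> X} X" using linked by (auto simp: S_def)
  next
    fix X Y assume "X \<in> S ` {..<n}" "Y \<in> S ` {..<n}"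
    then obtain a b where "X = S a" "Y = S b" "a < n" "b < n" by blast
    then show "X \<inter> Y \<noteq> {}" using meet[of a b] meet[of b a] nonempty[of a] by (cases a b rule: linorder_cases) auto
  qed
  then show ?thesis by (auto simp: S_def)
qed

text \<open>A bag that meets \<open>n\<close> disjoint classes has at least \<open>n\<close>
  vertices, and width is bag size minus one.\<close>

lemma treewidth_subdivided:
  assumes L: "0 < L"
  shows "n - 1 \<le> treewidth (subdivided n L)"
proof -
  let ?G = "subdivided n L"
  \<comment> \<open>A single bag with all vertices is a decomposition, which ensures that the
    \<open>LEAST\<close> in \<open>treewidth\<close> is attained.\<close>
  let ?T = "({0}, {}) :: nat graph"
  have "is_tree ?T"
    by (auto simp: is_tree_def simple_graph_def connected_graph_def is_cycle_def intro!: exI[of _ 0])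
  moreover have "connected_graph (induced_subgraph ?T {t \<in> verts ?T. True})"
    by (simp add: connected_graph_def induced_subgraph_def)
  ultimately have "tree_decomposition ?G ?T (\<lambda>_. verts ?G)"
    using simple_subdivided[of n L] by (auto simp: tree_decomposition_def simple_graph_def)
  then have "\<exists>k (T :: nat graph) B. tree_decomposition ?G T B \<and> decomposition_width T B = k" by blast
  then have "\<exists>(T :: nat graph) B. tree_decomposition ?G T B \<and> decomposition_width T B = treewidth ?G"
    unfolding treewidth_def by (rule LeastI_ex)
  then obtain T :: "nat graph" and B where TD: "tree_decomposition ?G T B"
    and width: "decomposition_width T B = treewidth ?G" by blast
  obtain t where t: "t \<in> verts T" "\<forall>a<n. \<exists>x\<in>B t. owner x = a" using subdivided_bag[OF TD L] by blast
  have "B t \<subseteq> verts ?G" using TD t(1) by (auto simp: tree_decomposition_def)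
  then have fin: "finite (B t)" using finite_subdivided by (rule finite_subset)
  have "{..<n} \<subseteq> owner ` B t" using t(2) by auto
  then have "n \<le> card (B t)" using surj_card_le[OF fin] by fastforce
  also have "\<dots> \<le> Max ((\<lambda>t. card (B t)) ` verts T)"
    using TD t(1) by (intro Max_ge) (auto simp: tree_decomposition_def is_tree_def simple_graph_def)
  finally show ?thesis using width by (simp add: decomposition_width_def)
qed

lemma unbounded_treewidth_sparse: "unbounded_treewidth {G. sparse G}"
  unfolding unbounded_treewidth_def
proof
  fix c :: nat
  \<comment> \<open>With \<open>c + 2\<close> centres the treewidth is at least
    \<open>c + 1\<close>, and the path length is the smallest that \<open>sparse_subdivided\<close>
    admits.\<close>
  let ?G = "subdivided (c + 2) (2 ^ (c + 2))"
  have "c + 2 - 1 \<le> treewidth ?G" by (rule treewidth_subdivided) simp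
  then have "c < treewidth ?G" by linarith
  moreover have "sparse ?G" by (rule sparse_subdivided) simp
  then have "?G \<in> {G. sparse G}" by (rule CollectI)
  ultimately show "\<exists>G\<in>{G :: nat graph. sparse G}. c < treewidth G" by blast
qed

theorem theorem7:
  shows "\<exists>C :: nat graph set. graph_class C \<and> hereditary C \<and> unbounded_treewidth C \<and>
           edge_steiner_tree_in_poly_time C"
  using graph_class_sparse hereditary_sparse unbounded_treewidth_sparse sparse_poly_time by blast

end
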